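(* Let $q>6$ and let $u\in C^{6}(\mathbb{R}^{5})$, $u>0$, solve $\Delta^{3}u=u^{-q}$ in $\mathbb{R}^{5}$ with $\lim_{|x|\to+\infty}u(x)/|x|=\alpha\in[0,+\infty)$. Then there is a constant $\gamma$ such that $$u(x)=\frac{1}{64\pi^{2}}\int_{\mathbb{R}^{5}}|x-y|\,u^{-q}(y)\,dy+\gamma\qquad\forall x\in\mathbb{R}^{5},$$ and $\gamma<0$ if $6<q<11$, $\gamma=0$ if $q=11$, $\gamma>0$ if $q>11$. Furthermore, if $q=11$, then up to dilations and translations $u(x)=c(1+|x|^{2})^{1/2}$ for a constant $c>0$. *)

theory Defs
  imports "HOL-Analysis.Analysis"
begin

definition partial :: "'n::finite \<Rightarrow> (real^'n \<Rightarrow> real) \<Rightarrow> real^'n \<Rightarrow> real" where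
  "partial i f x = frechet_derivative f (at x) (axis i 1)"

fun Ck :: "nat \<Rightarrow> (real^'n::finite \<Rightarrow> real) \<Rightarrow> bool" where
  "Ck 0 f = continuous_on UNIV f"
| "Ck (Suc k) f = ((\<forall>x. f differentiable (at x)) \<and> continuous_on UNIV f \<and> (\<forall>i. Ck k (partial i f)))"

definition laplacian :: "(real^'n::finite \<Rightarrow> real) \<Rightarrow> real^'n \<Rightarrow> real" where
  "laplacian f x = (\<Sum>i\<in>UNIV. partial i (partial i f) x)"

end

theory Submission
  imports Defs
begin

text \<open>
  In dimension 5 the function \<open>|x|\<close> is a multiple of the fundamental solution of the triple Laplacian.
  Smoothing it near the origin by a Taylor polynomial at two scales \<open>e < R\<close> and subtracting gives a
  compactly supported test function, and integration by parts expresses the integral of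
  \<open>f = \<Delta>\<^sup>3 u = u\<^sup>-\<^sup>q\<close> against it by averages of \<open>u\<close> at the scales \<open>e\<close> and \<open>R\<close>. Linear growth of \<open>u\<close> first
  yields that \<open>f\<close> is integrable. Taking differences in the centre and letting \<open>e \<rightarrow> 0\<close>, \<open>R \<rightarrow> \<infinity>\<close> (the
  average at scale \<open>R\<close> of the leading term \<open>\<alpha>|x|\<close> cancels by symmetry) yields
  \<open>64 \<pi>\<^sup>2 (u x - u 0) = \<integral> (|x - y| - |y|) f y dy\<close>. Hence \<open>64 \<pi>\<^sup>2 \<alpha> = \<integral> f > 0\<close>, so \<open>u\<close> grows linearly and
  the integral equation follows.

  The remaining arguments work in every dimension \<open>n\<close>, with the critical exponent \<open>q = 2 n + 1\<close>.
  Differentiating under the dilation \<open>x \<mapsto> (1 + h) x\<close> and symmetrising the double integral gives the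
  Pohozaev identity \<open>(q - 1) \<gamma> \<integral> f = (q - (2 n + 1)) \<integral> u\<^sup>1\<^sup>-\<^sup>q\<close>, which determines the sign of \<open>\<gamma>\<close>.

  For \<open>q = 2 n + 1\<close> the integral equation is conformally invariant. The method of moving spheres shows
  that \<open>u\<close> is invariant under the Kelvin transform in a sphere around every centre \<open>a\<close>, of radius
  \<open>u a / \<alpha>\<close>. Therefore \<open>u (a + t e) - \<alpha> t \<rightarrow> (u a / \<alpha>) (\<nabla>u a \<bullet> e)\<close> as \<open>t \<rightarrow> \<infinity>\<close>, whereas the integral
  equation gives \<open>u (a + t e) - u (t e) \<rightarrow> \<alpha> (e \<bullet> a)\<close>. Hence \<open>u \<nabla>u - \<alpha>\<^sup>2 x\<close> is constant, so \<open>u\<^sup>2\<close> is a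
  quadratic polynomial.
\<close>

subsection \<open>Lebesgue integration\<close>

lemma integrable_lborel_affine:
  fixes f :: "'a::euclidean_space \<Rightarrow> 'b::{banach, second_countable_topology}"
  assumes "c \<noteq> 0" and integrable_f: "integrable lborel f"
  shows "integrable lborel (\<lambda>x. f (t + c *\<^sub>R x))"
proof -
  have [measurable]: "f \<in> borel_measurable borel" using integrable_f by auto
  have "integrable (density (distr lborel borel (\<lambda>x. t + c *\<^sub>R x)) (\<lambda>_. ennreal (\<bar>c\<bar> ^ DIM('a)))) f"
    using integrable_f lborel_affine[OF assms(1), of t] by (simp add: ennreal_power)
  then have "integrable lborel (\<lambda>x. \<bar>c\<bar> ^ DIM('a) *\<^sub>R f (t + c *\<^sub>R x))"
    by (subst (asm) integrable_density) (auto simp: integrable_distr_eq)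
  from integrable_scaleR_right[OF this, of "inverse (\<bar>c\<bar> ^ DIM('a))"] show ?thesis using assms(1) by simp
qed

lemma integrable_lborel_affine_iff:
  fixes f :: "'a::euclidean_space \<Rightarrow> 'b::{banach, second_countable_topology}"
  assumes "c \<noteq> 0"
  shows "integrable lborel (\<lambda>x. f (t + c *\<^sub>R x)) \<longleftrightarrow> integrable lborel f"
  using integrable_lborel_affine[OF assms, of f t]
    integrable_lborel_affine[of "1 / c" "\<lambda>x. f (t + c *\<^sub>R x)" "- (1 / c) *\<^sub>R t"] assms
  by (auto simp: algebra_simps)

lemma integral_lborel_affine:
  fixes f :: "'a::euclidean_space \<Rightarrow> 'b::{banach, second_countable_topology}"
  assumes "c \<noteq> 0"
  shows "(LBINT x. f x) = \<bar>c\<bar> ^ DIM('a) *\<^sub>R (LBINT x. f (t + c *\<^sub>R x))"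
proof (cases "integrable lborel f")
  case True
  then have [measurable]: "f \<in> borel_measurable borel" by auto
  show ?thesis
    using assms by (subst lborel_affine[of c t]) (simp_all add: integral_density integral_distr)
next
  case False
  then show ?thesis
    using integrable_lborel_affine_iff[OF assms, of f t] by (simp add: not_integrable_integral_eq)
qed

lemma integral_lborel_translate:
  fixes f :: "'a::euclidean_space \<Rightarrow> 'b::{banach, second_countable_topology}"
  shows "(LBINT x. f (t + x)) = (LBINT x. f x)"
  using integral_lborel_affine[of 1 f t] by simp

lemma integral_lborel_reflect:
  fixes f :: "'a::euclidean_space \<Rightarrow> 'b::{banach, second_countable_topology}"
  shows "(LBINT x. f (- x)) = (LBINT x. f x)"
  using integral_lborel_affine[of "-1" f 0] by simp

lemma integrable_continuous_on_cball:
  fixes f :: "'a::euclidean_space \<Rightarrow> real"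
  assumes "continuous_on UNIV f"
  shows "integrable lborel (\<lambda>x. indicator (cball a r) x * f x)"
  using borel_integrable_compact[OF compact_cball continuous_on_subset[OF assms subset_UNIV]] by simp

lemma integrable_continuous_compact_support:
  fixes f :: "'a::euclidean_space \<Rightarrow> real"
  assumes "continuous_on UNIV f" and "\<And>x. norm x > R \<Longrightarrow> f x = 0"
  shows "integrable lborel f"
proof -
  have "(\<lambda>x. indicator (cball 0 R) x * f x) = f"
    using assms(2) by (auto simp: indicator_def fun_eq_iff not_le)
  then show ?thesis using integrable_continuous_on_cball[OF assms(1), of 0 R] by simp
qed

lemma integrable_indicator_cball:
  "integrable lborel (indicator (cball x r) :: 'a::euclidean_space \<Rightarrow> real)"
  using emeasure_lborel_cball_finite[of x r] by (intro integrable_real_indicator) auto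

lemma integral_pos_lborel:
  fixes f :: "'a::euclidean_space \<Rightarrow> real"
  assumes integrable_f: "integrable lborel f" and nonneg: "\<And>x. f x \<ge> 0"
    and U_open: "open U" and U_nonempty: "U \<noteq> {}" and pos_on_U: "\<And>x. x \<in> U \<Longrightarrow> f x > 0"
  shows "(LBINT x. f x) > 0"
proof -
  have "(LBINT x. f x) \<noteq> 0"
  proof
    assume "(LBINT x. f x) = 0"
    then have "AE x in lborel. f x = 0" using integral_nonneg_eq_0_iff_AE[OF integrable_f] nonneg by simp
    then have "AE x in lborel. x \<notin> U" by eventually_elim (use pos_on_U in force)
    then have "U \<in> null_sets lborel" using U_open by (simp add: AE_iff_null_sets)
    then have "negligible U" by (simp add: negligible_iff_null_sets null_sets_completionI)
    then show False using U_open U_nonempty open_not_negligible by blast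
  qed
  moreover have "(LBINT x. f x) \<ge> 0" using nonneg by simp
  ultimately show ?thesis by simp
qed

lemma integrable_if_integrals_cball_bounded:
  fixes f :: "'a::euclidean_space \<Rightarrow> real"
  assumes cont: "continuous_on UNIV f" and nonneg: "\<And>x. f x \<ge> 0"
    and bound: "\<And>n::nat. (LBINT x. indicator (cball 0 (real n)) x * f x) \<le> B"
  shows "integrable lborel f"
proof -
  let ?f = "\<lambda>n x. indicator (cball 0 (real n)) x * f x"
  have integrable: "integrable lborel (?f n)" for n
    using cont by (rule integrable_continuous_on_cball)
  have mono: "?f m x \<le> ?f n x" if "m \<le> n" for m n x
    using that nonneg by (auto simp: indicator_def)
  have "incseq (\<lambda>n. LBINT x. ?f n x)"
    by (intro incseq_SucI integral_mono integrable mono) auto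
  then obtain L where lim: "(\<lambda>n. LBINT x. ?f n x) \<longlonglongrightarrow> L"
    using incseq_convergent[of "\<lambda>n. LBINT x. ?f n x" B] bound by blast
  show ?thesis
  proof (rule integrable_monotone_convergence[OF integrable _ _ lim])
    show "AE x in lborel. mono (\<lambda>n. ?f n x)" by (intro AE_I2 monoI mono)
    show "AE x in lborel. (\<lambda>n. ?f n x) \<longlonglongrightarrow> f x"
    proof (intro AE_I2 tendsto_eventually)
      fix x :: 'a
      obtain N :: nat where "norm x \<le> real N" using real_arch_simple by blast
      then show "\<forall>\<^sub>F n in sequentially. ?f n x = f x"
        by (intro eventually_sequentiallyI[of N]) (auto simp: indicator_def)
    qed
    show "f \<in> borel_measurable lborel"
      using borel_measurable_continuous_onI[OF cont] by simp
  qed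
qed

lemma has_real_derivative_integral_dominated:
  fixes F :: "real \<Rightarrow> 'a \<Rightarrow> real"
  assumes "d > 0" and integrable_F: "\<And>t. dist a t < d \<Longrightarrow> integrable M (F t)" and integrable_w: "integrable M w"
    and [measurable]: "F' \<in> borel_measurable M"
    and deriv: "AE x in M. ((\<lambda>t. F t x) has_real_derivative F' x) (at a)"
    and bound: "\<And>t x. dist a t < d \<Longrightarrow> \<bar>F t x - F a x\<bar> \<le> \<bar>t - a\<bar> * w x"
  shows "((\<lambda>t. \<integral>x. F t x \<partial>M) has_real_derivative (\<integral>x. F' x \<partial>M)) (at a)"
proof -
  have at_a: "at a = at a within ball a d" using \<open>d > 0\<close> by (subst at_within_open) auto
  show ?thesis
    unfolding has_field_derivative_iff at_a tendsto_at_iff_sequentially comp_def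
  proof (intro allI impI)
    fix X assume X_in_ball: "\<forall>i. X i \<in> ball a d - {a}" and X_lim: "X \<longlonglongrightarrow> a"
    have integrable: "integrable M (F a)" "integrable M (F (X n))" for n
      using integrable_F X_in_ball \<open>d > 0\<close> by auto
    have "(\<lambda>n. \<integral>x. (F (X n) x - F a x) / (X n - a) \<partial>M) \<longlonglongrightarrow> (\<integral>x. F' x \<partial>M)"
    proof (rule integral_dominated_convergence[where w=w])
      show "AE x in M. (\<lambda>n. (F (X n) x - F a x) / (X n - a)) \<longlonglongrightarrow> F' x"
        using deriv
      proof eventually_elim
        case (elim x)
        then show ?case
          using X_in_ball X_lim
          unfolding has_field_derivative_iff at_a tendsto_at_iff_sequentially comp_def by blast
      qed
      have "\<bar>(F (X n) x - F a x) / (X n - a)\<bar> \<le> w x" for n x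
        using bound[of "X n" x] X_in_ball by (simp add: abs_divide pos_divide_le_eq mult.commute)
      then show "AE x in M. norm ((F (X n) x - F a x) / (X n - a)) \<le> w x" for n by simp
    qed (use integrable_w integrable in auto)
    then show "(\<lambda>n. ((\<integral>x. F (X n) x \<partial>M) - (\<integral>x. F a x \<partial>M)) / (X n - a)) \<longlonglongrightarrow> (\<integral>x. F' x \<partial>M)"
      using integrable by simp
  qed
qed

lemma integral_symmetrize:
  fixes K :: "'a::euclidean_space \<Rightarrow> 'a \<Rightarrow> real"
  assumes integrable_K: "integrable (lborel \<Otimes>\<^sub>M lborel) (\<lambda>(x, y). K x y)"
  shows "2 * (LBINT x. LBINT y. K x y) = (LBINT x. LBINT y. K x y + K y x)"
proof -
  let ?S = "\<lambda>(x, y). K y x"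
  have integrable_S: "integrable (lborel \<Otimes>\<^sub>M lborel) ?S"
    using lborel_pair.integrable_product_swap[OF integrable_K] by (simp add: case_prod_beta')
  have "(LBINT x. LBINT y. K x y + K y x)
      = integral\<^sup>L (lborel \<Otimes>\<^sub>M lborel) (\<lambda>p. (\<lambda>(x, y). K x y) p + ?S p)"
    using lborel_pair.integral_fst'[OF Bochner_Integration.integrable_add[OF integrable_K integrable_S]]
      by simp
  also have "\<dots> = (LBINT x. LBINT y. K x y) + (LBINT x. LBINT y. K y x)"
    using lborel_pair.integral_fst'[OF integrable_K] lborel_pair.integral_fst'[OF integrable_S]
      integrable_K integrable_S by simp
  also have "(LBINT x. LBINT y. K y x) = (LBINT x. LBINT y. K x y)"
    by (rule lborel_pair.Fubini_integral[OF integrable_K])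
  finally show ?thesis by simp
qed

subsection \<open>Radial integrals\<close>

definition radial_density :: "nat \<Rightarrow> real \<Rightarrow> real" where
  "radial_density n r = unit_ball_vol n * (n * r ^ (n - 1)) * indicator {0..} r"

lemma borel_measurable_radial_density [measurable]: "radial_density n \<in> borel_measurable borel"
  unfolding radial_density_def[abs_def] by measurable

lemma distr_norm_lborel:
  "distr (lborel :: 'a::euclidean_space measure) borel norm = density lborel (radial_density DIM('a))"
  (is "?M = ?N")
proof (rule measure_eqI_generator_eq[where E="range (\<lambda>a::real. {..a})" and \<Omega>=UNIV and A="\<lambda>n::nat. {..real n}"])
  let ?V = "unit_ball_vol DIM('a)"
  have emeasure_M: "emeasure ?M {..a} = (if a \<ge> 0 then ennreal (?V * a ^ DIM('a)) else 0)" for a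
  proof -
    have "emeasure ?M {..a} = emeasure lborel (cball (0::'a) a)"
      by (subst emeasure_distr) (auto intro!: arg_cong[of _ _ "emeasure lborel"])
    then show ?thesis by (simp add: emeasure_cball)
  qed
  have emeasure_N: "emeasure ?N {..a} = (if a \<ge> 0 then ennreal (?V * a ^ DIM('a)) else 0)" for a
  proof -
    have "emeasure ?N {..a} = (\<integral>\<^sup>+r. ennreal (?V * (DIM('a) * r ^ (DIM('a) - 1))) * indicator {0..a} r \<partial>lborel)"
      by (subst emeasure_density) (auto intro!: nn_integral_cong simp: radial_density_def indicator_def)
    also have "\<dots> = (if a \<ge> 0 then ennreal (?V * a ^ DIM('a)) else 0)"
    proof (cases "a \<ge> 0")
      case True
      have "(\<integral>\<^sup>+r. ennreal (?V * (DIM('a) * r ^ (DIM('a) - 1))) * indicator {0..a} r \<partial>lborel) =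
        ennreal (?V * a ^ DIM('a) - ?V * 0 ^ DIM('a))"
        by (rule nn_integral_FTC_Icc) (auto intro!: derivative_eq_intros True)
      then show ?thesis using True by simp
    qed simp
    finally show ?thesis .
  qed
  show "emeasure ?M X = emeasure ?N X" if "X \<in> range (\<lambda>a. {..a})" for X
    using that emeasure_M emeasure_N by auto
  show "Int_stable (range (\<lambda>a::real. {..a}))" by (auto simp: Int_stable_def)
  show "sets ?M = sigma_sets UNIV (range (\<lambda>a::real. {..a}))"
    unfolding sets_distr by (subst borel_eq_atMost) simp
  show "sets ?N = sigma_sets UNIV (range (\<lambda>a::real. {..a}))"
    unfolding sets_density sets_lborel by (subst borel_eq_atMost) simp
  show "(\<Union>i. {..real i}) = UNIV" by (auto intro: real_arch_simple)
  show "emeasure ?M {..real i} \<noteq> \<infinity>" for i by (simp add: emeasure_M)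
qed auto

lemma nn_integral_radial:
  fixes F :: "real \<Rightarrow> ennreal"
  assumes [measurable]: "F \<in> borel_measurable borel"
  shows "(\<integral>\<^sup>+x. F (norm (x::'a::euclidean_space)) \<partial>lborel) = (\<integral>\<^sup>+r. radial_density DIM('a) r * F r \<partial>lborel)"
proof -
  have "(\<integral>\<^sup>+x. F (norm (x::'a)) \<partial>lborel) = (\<integral>\<^sup>+r. F r \<partial>(distr (lborel :: 'a measure) borel norm))"
    by (simp add: nn_integral_distr)
  then show ?thesis unfolding distr_norm_lborel by (subst (asm) nn_integral_density) auto
qed

lemma integral_radial:
  fixes F :: "real \<Rightarrow> real"
  assumes [measurable]: "F \<in> borel_measurable borel"
  shows "(LBINT x. F (norm (x::'a::euclidean_space))) = (LBINT r. radial_density DIM('a) r * F r)"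
proof -
  have "(LBINT x. F (norm (x::'a))) = (\<integral>r. F r \<partial>(distr (lborel :: 'a measure) borel norm))"
    by (simp add: integral_distr)
  then show ?thesis
    unfolding distr_norm_lborel
    by (subst (asm) integral_density) (auto simp: radial_density_def indicator_def)
qed

lemma integrable_one_plus_norm_powr:
  fixes p :: real
  assumes p_gt: "p > DIM('a)"
  shows "integrable lborel (\<lambda>x::'a::euclidean_space. (1 + norm x) powr (-p))"
proof (rule integrableI_nonneg)
  define A where "A = unit_ball_vol (DIM('a)) * DIM('a)"
  have A_nonneg: "A \<ge> 0" by (simp add: A_def)
  have density_le: "A * r ^ (DIM('a) - 1) * (1 + r) powr (-p) \<le> A * (1 + r) powr (DIM('a) - 1 - p)"
    if "r \<ge> 0" for r
  proof -
    have "r ^ (DIM('a) - 1) * (1 + r) powr (-p) \<le> (1 + r) ^ (DIM('a) - 1) * (1 + r) powr (-p)"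
      using that by (intro mult_right_mono power_mono) auto
    also have "\<dots> = (1 + r) powr (DIM('a) - 1 - p)"
      using that by (simp add: of_nat_diff flip: powr_realpow powr_add)
    finally show ?thesis using A_nonneg by (simp add: mult_left_mono mult.assoc)
  qed
  have "(\<integral>\<^sup>+x. ennreal ((1 + norm (x::'a)) powr (-p)) \<partial>lborel)
    = (\<integral>\<^sup>+r. ennreal (A * r ^ (DIM('a) - 1) * (1 + r) powr (-p)) * indicator {0..} r \<partial>lborel)"
    by (subst nn_integral_radial)
       (auto intro!: nn_integral_cong simp: A_def radial_density_def indicator_def mult_ac simp flip: ennreal_mult)
  also have "\<dots> \<le> (\<integral>\<^sup>+r. ennreal (A * (1 + r) powr (DIM('a) - 1 - p)) * indicator {0..} r \<partial>lborel)"
    by (intro nn_integral_mono) (use density_le in \<open>auto simp: indicator_def intro!: ennreal_leI\<close>)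
  also have "\<dots> = ennreal (0 - A / (DIM('a) - p) * (1 + 0) powr (DIM('a) - p))"
  proof (rule nn_integral_FTC_atLeast)
    show "((\<lambda>r. A / (DIM('a) - p) * (1 + r) powr (DIM('a) - p)) \<longlongrightarrow> 0) at_top"
      using p_gt by (intro tendsto_mult_right_zero tendsto_neg_powr
        filterlim_tendsto_add_at_top[OF tendsto_const filterlim_ident]) auto
    show "((\<lambda>r. A / (DIM('a) - p) * (1 + r) powr (DIM('a) - p)) has_real_derivative
        A * (1 + x) powr (DIM('a) - 1 - p)) (at x)" if "0 \<le> x" for x
      using that p_gt by (auto intro!: derivative_eq_intros simp: diff_diff_eq add.commute)
  qed (use A_nonneg in auto)
  also have "\<dots> < \<infinity>" by simp
  finally show "(\<integral>\<^sup>+x. ennreal ((1 + norm (x::'a)) powr (-p)) \<partial>lborel) < \<infinity>" .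
qed auto

subsection \<open>Integration by parts\<close>

lemma partial_eqI: "(f has_derivative D) (at x) \<Longrightarrow> partial i f x = D (axis i 1)"
  by (metis frechet_derivative_at partial_def)

lemma has_real_derivative_partial:
  assumes "f differentiable (at (x + t *\<^sub>R axis i 1))"
  shows "((\<lambda>t. f (x + t *\<^sub>R axis i 1)) has_real_derivative partial i f (x + t *\<^sub>R axis i 1)) (at t)"
proof -
  let ?y = "x + t *\<^sub>R axis i (1::real)"
  have frechet: "(f has_derivative frechet_derivative f (at ?y)) (at ?y)"
    using assms frechet_derivative_works by blast
  have "((\<lambda>t. x + t *\<^sub>R axis i 1) has_derivative (\<lambda>h. h *\<^sub>R axis i 1)) (at t)"
    by (auto intro!: derivative_eq_intros)
  from has_derivative_compose[OF this frechet] show ?thesis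
    by (rule has_derivative_imp_has_field_derivative)
       (simp add: linear_scale[OF has_derivative_linear[OF frechet]] partial_def)
qed

lemma continuous_on_if_differentiable:
  "(\<And>x. f differentiable (at x)) \<Longrightarrow> continuous_on UNIV f"
  by (simp add: continuous_at_imp_continuous_on differentiable_imp_continuous_within)

lemma partial_eq_0_outside:
  assumes "\<And>x. norm x > R \<Longrightarrow> f x = 0" "norm x > R"
  shows "partial i f x = 0"
proof -
  have "open {x::real^'a. norm x > R}" by (intro open_Collect_less continuous_intros)
  from has_derivative_transform_within_open[OF has_derivative_const this, of x 0 f]
  have "(f has_derivative (\<lambda>_. 0)) (at x)" using assms by simp
  then show ?thesis by (rule partial_eqI)
qed

text \<open>By translation invariance the integral of \<open>g (x + t e\<^sub>i)\<close> does not depend on \<open>t\<close>.\<close>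

lemma integral_partial_eq_0:
  fixes g :: "real^'n::finite \<Rightarrow> real"
  assumes diff: "\<And>x. g differentiable (at x)" and cont: "continuous_on UNIV (partial i g)"
    and supp: "\<And>x. norm x > R \<Longrightarrow> g x = 0"
  shows "(LBINT x. partial i g x) = 0"
proof -
  let ?e = "axis i 1 :: real^'n"
  have integrable_g: "integrable lborel g"
    using continuous_on_if_differentiable[OF diff] supp by (rule integrable_continuous_compact_support)
  have along: "((\<lambda>t. g (x + t *\<^sub>R ?e)) has_real_derivative partial i g (x + t *\<^sub>R ?e)) (at t)" for x t
    by (rule has_real_derivative_partial[OF diff])
  obtain M where M_nonneg: "M \<ge> 0" and M_bound: "\<And>x. norm x \<le> R \<Longrightarrow> \<bar>partial i g x\<bar> \<le> M"
    using continuous_on_compact_bound[of "cball 0 R" "partial i g"] continuous_on_subset[OF cont]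
    by (metis compact_cball mem_cball_0 real_norm_def subset_UNIV)
  have partial_le: "\<bar>partial i g x\<bar> \<le> M" for x
    using M_nonneg M_bound partial_eq_0_outside[of R g x i] supp by (cases "norm x \<le> R") auto
  have diff_le: "\<bar>g (x + t *\<^sub>R ?e) - g (x + 0 *\<^sub>R ?e)\<bar> \<le> \<bar>t - 0\<bar> * (M * indicator (cball 0 (R + 1)) x)"
    if "dist 0 t < 1" for t x
  proof (cases "norm x \<le> R + 1")
    case True
    then show ?thesis
      using field_differentiable_bound[of UNIV "\<lambda>t. g (x + t *\<^sub>R ?e)" "\<lambda>t. partial i g (x + t *\<^sub>R ?e)" M t 0]
        along partial_le by (simp add: mult.commute)
  next
    case False
    moreover have "norm x - norm (t *\<^sub>R ?e) \<le> norm (x + t *\<^sub>R ?e)" by (rule norm_diff_ineq)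
    ultimately show ?thesis using that by (simp add: supp)
  qed
  have "((\<lambda>t. LBINT x. g (x + t *\<^sub>R ?e)) has_real_derivative (LBINT x. partial i g x)) (at 0)"
  proof (rule has_real_derivative_integral_dominated[OF zero_less_one _ _ _ _ diff_le])
    show "integrable lborel (\<lambda>x. g (x + t *\<^sub>R ?e))" for t
      using integrable_lborel_affine[of 1 g "t *\<^sub>R ?e"] integrable_g by (simp add: add.commute)
    show "integrable lborel (\<lambda>x::real^'n. M * indicator (cball 0 (R + 1)) x)"
      using integrable_indicator_cball by (rule integrable_mult_right)
    show "partial i g \<in> borel_measurable lborel"
      using borel_measurable_continuous_onI[OF cont] by simp
    show "AE x in lborel. ((\<lambda>t. g (x + t *\<^sub>R ?e)) has_real_derivative partial i g x) (at 0)"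
      using along[of _ 0] by simp
  qed
  moreover have "(LBINT x. g (x + t *\<^sub>R ?e)) = (LBINT x. g x)" for t
    using integral_lborel_translate[of g "t *\<^sub>R ?e"] by (simp add: add.commute)
  ultimately show ?thesis using DERIV_unique[OF _ DERIV_const] by simp
qed

lemma Ck_imp_continuous_on: "Ck k f \<Longrightarrow> continuous_on UNIV f" by (cases k) auto

lemma Ck_Suc_imp_Ck: "Ck (Suc k) f \<Longrightarrow> Ck k f"
proof (induction k arbitrary: f)
  case (Suc k)
  then show ?case using Ck.simps(2)[of "Suc k" f] Ck.simps(2)[of k f] by blast
qed simp

lemma partial_add:
  "f differentiable (at x) \<Longrightarrow> g differentiable (at x) \<Longrightarrow>
   partial i (\<lambda>x. f x + g x) x = partial i f x + partial i g x"
  by (subst partial_eqI[OF has_derivative_add, of f "frechet_derivative f (at x)" x g "frechet_derivative g (at x)"])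
     (auto simp: partial_def frechet_derivative_works[symmetric])

lemma Ck_add: "Ck k f \<Longrightarrow> Ck k g \<Longrightarrow> Ck k (\<lambda>x. f x + g x)"
proof (induction k arbitrary: f g)
  case (Suc k)
  have "partial i (\<lambda>x. f x + g x) = (\<lambda>x. partial i f x + partial i g x)" for i
    using Suc.prems by (simp add: fun_eq_iff partial_add)
  then show ?case using Suc by (simp add: continuous_on_add)
qed (simp add: continuous_on_add)

lemma Ck_const: "Ck k (\<lambda>x::real^'n::finite. c)"
proof (induction k arbitrary: c)
  case (Suc k)
  have "partial i (\<lambda>x::real^'n. c) = (\<lambda>x. 0)" for i
    by (simp add: fun_eq_iff partial_def)
  then show ?case using Suc by (auto simp: Ck.simps)
qed simp

lemma Ck_sum: "(\<And>i. i \<in> I \<Longrightarrow> Ck k (f i)) \<Longrightarrow> Ck k (\<lambda>x. \<Sum>i\<in>I. f i x)"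
  by (induction I rule: infinite_finite_induct) (auto intro: Ck_add Ck_const)

lemma Ck_laplacian: "Ck (Suc (Suc k)) f \<Longrightarrow> Ck k (laplacian f)"
  unfolding laplacian_def[abs_def] by (rule Ck_sum) simp

definition gradient :: "(real^'n::finite \<Rightarrow> real) \<Rightarrow> real^'n \<Rightarrow> real^'n" where
  "gradient f x = (\<chi> i. partial i f x)"

lemma has_derivative_gradient:
  assumes "Ck (Suc k) f"
  shows "(f has_derivative (\<lambda>v. gradient f x \<bullet> v)) (at x)"
proof -
  have frechet: "(f has_derivative frechet_derivative f (at x)) (at x)"
    using assms by (simp add: frechet_derivative_works[symmetric])
  note linear = has_derivative_linear[OF frechet]
  have "frechet_derivative f (at x) v = gradient f x \<bullet> v" for v
  proof -
    have "frechet_derivative f (at x) (\<Sum>i\<in>UNIV. (v $ i) *\<^sub>R axis i 1) = (\<Sum>i\<in>UNIV. v $ i * partial i f x)"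
      by (simp add: linear_sum[OF linear] linear_scale[OF linear] partial_def)
    moreover have "(\<Sum>i\<in>UNIV. (v $ i) *\<^sub>R axis i (1::real)) = v"
      using basis_expansion[of v] by (simp add: scalar_mult_eq_scaleR)
    ultimately show ?thesis by (simp add: gradient_def inner_vec_def mult.commute)
  qed
  then have "frechet_derivative f (at x) = (\<lambda>v. gradient f x \<bullet> v)" by auto
  with frechet show ?thesis by simp
qed

lemma continuous_on_gradient: "Ck (Suc k) f \<Longrightarrow> continuous_on UNIV (gradient f)"
  unfolding gradient_def[abs_def]
  by (intro continuous_on_vec_lambda) (auto intro: Ck_imp_continuous_on)

lemma
  fixes v \<phi> :: "real^'n::finite \<Rightarrow> real"
  assumes Ck_v: "Ck 2 v" and Ck_\<phi>: "Ck 2 \<phi>" and supp: "\<And>x. norm x > R \<Longrightarrow> \<phi> x = 0"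
  shows integrable_mult_partial_partial:
      "integrable lborel (\<lambda>x. v x * partial i (partial i \<phi>) x)"
      "integrable lborel (\<lambda>x. partial i (partial i v) x * \<phi> x)"
    and integral_mult_partial_partial:
      "(LBINT x. partial i (partial i v) x * \<phi> x) = (LBINT x. v x * partial i (partial i \<phi>) x)"
proof -
  have Ck_2D: "continuous_on UNIV f" "f differentiable (at x)" "partial i f differentiable (at x)"
      "continuous_on UNIV (partial i f)" "continuous_on UNIV (partial i (partial i f))"
    if "Ck 2 f" for f :: "real^'n \<Rightarrow> real" and x
    using that by (auto simp: numeral_2_eq_2)
  have frechet: "(f has_derivative frechet_derivative f (at x)) (at x)"
      "(partial i f has_derivative frechet_derivative (partial i f) (at x)) (at x)"
    if "Ck 2 f" for f :: "real^'n \<Rightarrow> real" and x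
    using Ck_2D(2,3)[OF that] frechet_derivative_works by blast+
  have supp_partial: "partial i \<phi> x = 0" if "norm x > R" for x
    by (rule partial_eq_0_outside[OF supp that])
  have supp_partial2: "partial i (partial i \<phi>) x = 0" if "norm x > R" for x
    by (rule partial_eq_0_outside[OF supp_partial that])
  show integrable: "integrable lborel (\<lambda>x. v x * partial i (partial i \<phi>) x)"
      "integrable lborel (\<lambda>x. partial i (partial i v) x * \<phi> x)"
    by ((rule integrable_continuous_compact_support[of _ R],
        use Ck_2D[OF Ck_v] Ck_2D[OF Ck_\<phi>] supp supp_partial2 in \<open>auto intro!: continuous_intros\<close>)[1])+
  define w where "w x = v x * partial i \<phi> x - partial i v x * \<phi> x" for x
  have partial_w: "partial i w x = v x * partial i (partial i \<phi>) x - partial i (partial i v) x * \<phi> x" for x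
    unfolding w_def
    by (subst partial_eqI[OF has_derivative_diff[OF has_derivative_mult[OF frechet(1)[OF Ck_v] frechet(2)[OF Ck_\<phi>]]
          has_derivative_mult[OF frechet(2)[OF Ck_v] frechet(1)[OF Ck_\<phi>]]]])
       (simp add: partial_def algebra_simps)
  have "(LBINT x. partial i w x) = 0"
  proof (rule integral_partial_eq_0)
    show "w differentiable (at x)" for x
      unfolding w_def using Ck_2D[OF Ck_v] Ck_2D[OF Ck_\<phi>]
      by (intro differentiable_diff differentiable_mult) auto
    show "continuous_on UNIV (partial i w)"
      unfolding partial_w[abs_def] using Ck_2D[OF Ck_v] Ck_2D[OF Ck_\<phi>] by (intro continuous_intros)
    show "w x = 0" if "norm x > R" for x using that by (simp add: w_def supp supp_partial)
  qed
  then show "(LBINT x. partial i (partial i v) x * \<phi> x) = (LBINT x. v x * partial i (partial i \<phi>) x)"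
    using integrable by (simp add: partial_w)
qed

lemma Green_compact_support:
  fixes v \<phi> :: "real^'n::finite \<Rightarrow> real"
  assumes "Ck 2 v" "Ck 2 \<phi>" "\<And>x. norm x > R \<Longrightarrow> \<phi> x = 0"
  shows "(LBINT x. laplacian v x * \<phi> x) = (LBINT x. v x * laplacian \<phi> x)"
  using integrable_mult_partial_partial[OF assms] integral_mult_partial_partial[OF assms]
  by (simp add: laplacian_def sum_distrib_left sum_distrib_right)

subsection \<open>Radial test functions\<close>

definition radial :: "'a::real_inner \<Rightarrow> (real \<Rightarrow> real) \<Rightarrow> 'a \<Rightarrow> real" where
  "radial x F y = F ((norm (y - x))\<^sup>2)"

lemma has_derivative_radial:
  assumes "\<And>s. (F has_real_derivative F' s) (at s)"
  shows "(radial x F has_derivative (\<lambda>h. radial x F' y * (2 * ((y - x) \<bullet> h)))) (at y)"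
proof -
  have "((\<lambda>y. (norm (y - x))\<^sup>2) has_derivative (\<lambda>h. 2 * ((y - x) \<bullet> h))) (at y)"
    unfolding power2_norm_eq_inner by (auto intro!: derivative_eq_intros simp: inner_commute)
  from has_derivative_compose[OF this, of F "(*) (F' ((norm (y - x))\<^sup>2))"] assms show ?thesis
    by (simp add: has_field_derivative_def radial_def[abs_def])
qed

lemma continuous_on_radial: "continuous_on UNIV F \<Longrightarrow> continuous_on UNIV (radial x F)"
  unfolding radial_def[abs_def]
  by (erule continuous_on_compose2) (auto intro!: continuous_intros)

lemma partial_radial:
  fixes x :: "real^'n::finite"
  assumes "\<And>s. (F has_real_derivative F' s) (at s)"
  shows "partial i (radial x F) = (\<lambda>y. radial x F' y * (2 * (y - x) $ i))"
  by (rule ext, subst partial_eqI[OF has_derivative_radial[OF assms]]) (simp add: inner_axis)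

lemma has_derivative_partial_radial:
  fixes x :: "real^'n::finite"
  assumes "\<And>s. (F has_real_derivative F' s) (at s)"
  shows "((\<lambda>y. radial x F y * (2 * (y - x) $ i)) has_derivative
    (\<lambda>h. radial x F y * (2 * h $ i) + radial x F' y * (2 * ((y - x) \<bullet> h)) * (2 * (y - x) $ i))) (at y)"
proof -
  have "((\<lambda>y. 2 * (y - x) $ i) has_derivative (\<lambda>h. 2 * h $ i)) (at y)"
    by (auto intro!: derivative_eq_intros bounded_linear.has_derivative[OF bounded_linear_vec_nth])
  then show ?thesis by (rule has_derivative_mult[OF has_derivative_radial[OF assms]])
qed

lemma
  fixes x :: "real^'n::finite" and F F1 F2 :: "real \<Rightarrow> real"
  assumes deriv_F: "\<And>s. (F has_real_derivative F1 s) (at s)"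
    and deriv_F1: "\<And>s. (F1 has_real_derivative F2 s) (at s)"
    and cont_F2: "continuous_on UNIV F2"
  shows Ck_radial: "Ck 2 (radial x F)"
    and laplacian_radial:
      "laplacian (radial x F) = radial x (\<lambda>s. 4 * s * F2 s + 2 * real CARD('n) * F1 s)"
proof -
  note partial_derivs = has_derivative_partial_radial[OF deriv_F1, of x]
  have partial_partial: "partial j (partial i (radial x F)) =
      (\<lambda>y. radial x F1 y * (2 * (axis j 1 :: real^'n) $ i) + radial x F2 y * (2 * (y - x) $ j) * (2 * (y - x) $ i))" for i j
    unfolding partial_radial[OF deriv_F]
    by (rule ext, subst partial_eqI[OF partial_derivs]) (simp add: inner_axis)
  have "continuous_on UNIV F" "continuous_on UNIV F1"
    using deriv_F deriv_F1 by (auto intro!: continuous_at_imp_continuous_on DERIV_isCont)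
  then have "Ck (Suc (Suc 0)) (radial x F)"
    unfolding Ck.simps partial_partial unfolding partial_radial[OF deriv_F]
    using has_derivative_radial[OF deriv_F, of x] partial_derivs cont_F2
    by (intro conjI allI continuous_intros continuous_on_radial) (unfold differentiable_def, blast+)
  then show "Ck 2 (radial x F)" by (simp add: numeral_2_eq_2[symmetric])
  show "laplacian (radial x F) = radial x (\<lambda>s. 4 * s * F2 s + 2 * real CARD('n) * F1 s)"
  proof
    fix y
    have "laplacian (radial x F) y = (\<Sum>i\<in>UNIV. 2 * radial x F1 y + 4 * radial x F2 y * ((y - x) $ i)\<^sup>2)"
      unfolding laplacian_def partial_partial
      by (rule sum.cong) (simp_all add: power2_eq_square[of "_ $ _ - _"] algebra_simps)
    also have "\<dots> = 2 * real CARD('n) * radial x F1 y + 4 * radial x F2 y * (\<Sum>i\<in>UNIV. ((y - x) $ i)\<^sup>2)"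
      by (simp add: sum.distrib sum_distrib_left)
    also have "(\<Sum>i\<in>UNIV. ((y - x) $ i)\<^sup>2) = (norm (y - x))\<^sup>2"
      unfolding power2_norm_eq_inner by (simp add: inner_vec_def power2_eq_square)
    finally show "laplacian (radial x F) y = radial x (\<lambda>s. 4 * s * F2 s + 2 * real CARD('n) * F1 s) y"
      by (simp add: radial_def[of x F1] radial_def[of x F2] radial_def[of x "\<lambda>s. _ s + _ s"])
  qed
qed

text \<open>The Laplacian of \<open>F(|x|\<^sup>2)\<close> in dimension \<open>n\<close> is \<open>H(|x|\<^sup>2)\<close>.\<close>

definition has_radial_laplacian :: "nat \<Rightarrow> (real \<Rightarrow> real) \<Rightarrow> (real \<Rightarrow> real) \<Rightarrow> bool" where
  "has_radial_laplacian n F H \<longleftrightarrow> (\<exists>F1 F2. (\<forall>s. (F has_real_derivative F1 s) (at s)) \<and>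
     (\<forall>s. (F1 has_real_derivative F2 s) (at s)) \<and> continuous_on UNIV F2 \<and>
     H = (\<lambda>s. 4 * s * F2 s + 2 * real n * F1 s))"

lemma has_radial_laplacian_diff:
  assumes "has_radial_laplacian n F H" "has_radial_laplacian n G K"
  shows "has_radial_laplacian n (\<lambda>s. F s - G s) (\<lambda>s. H s - K s)"
proof -
  obtain F1 F2 G1 G2 where
    "\<And>s. (F has_real_derivative F1 s) (at s)" "\<And>s. (F1 has_real_derivative F2 s) (at s)"
    "continuous_on UNIV F2" "H = (\<lambda>s. 4 * s * F2 s + 2 * real n * F1 s)"
    "\<And>s. (G has_real_derivative G1 s) (at s)" "\<And>s. (G1 has_real_derivative G2 s) (at s)"
    "continuous_on UNIV G2" "K = (\<lambda>s. 4 * s * G2 s + 2 * real n * G1 s)"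
    using assms unfolding has_radial_laplacian_def by blast
  then show ?thesis unfolding has_radial_laplacian_def
    by (intro exI[of _ "\<lambda>s. F1 s - G1 s"] exI[of _ "\<lambda>s. F2 s - G2 s"])
       (auto intro!: DERIV_diff continuous_intros simp: algebra_simps)
qed

definition rescale :: "nat \<Rightarrow> real \<Rightarrow> (real \<Rightarrow> real) \<Rightarrow> real \<Rightarrow> real" where
  "rescale j a F s = a / a ^ (2 * j) * F (s / a\<^sup>2)"

lemma has_radial_laplacian_rescale:
  assumes "has_radial_laplacian n F H"
  shows "has_radial_laplacian n (rescale j a F) (rescale (Suc j) a H)"
proof -
  obtain F1 F2 where F_derivs:
    "\<And>s. (F has_real_derivative F1 s) (at s)" "\<And>s. (F1 has_real_derivative F2 s) (at s)"
    "continuous_on UNIV F2" "H = (\<lambda>s. 4 * s * F2 s + 2 * real n * F1 s)"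
    using assms unfolding has_radial_laplacian_def by blast
  have chain: "((\<lambda>s. K (s / a\<^sup>2)) has_real_derivative K' (s / a\<^sup>2) / a\<^sup>2) (at s)"
    if "\<And>s. (K has_real_derivative K' s) (at s)" for K K' s
    using DERIV_chain'[of "\<lambda>s. s / a\<^sup>2" "1 / a\<^sup>2" s UNIV, OF _ that]
    by (simp add: DERIV_cdivide)
  show ?thesis
    unfolding has_radial_laplacian_def rescale_def[abs_def]
  proof (intro exI conjI allI)
    let ?k = "a / a ^ (2 * j)"
    show "((\<lambda>s. ?k * F (s / a\<^sup>2)) has_real_derivative ?k * (F1 (s / a\<^sup>2) / a\<^sup>2)) (at s)" for s
      by (intro DERIV_cmult chain F_derivs)
    show "((\<lambda>s. ?k * (F1 (s / a\<^sup>2) / a\<^sup>2)) has_real_derivative ?k * (F2 (s / a\<^sup>2) / a\<^sup>2 / a\<^sup>2)) (at s)" for s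
      by (intro DERIV_cmult DERIV_cdivide chain F_derivs)
    show "continuous_on UNIV (\<lambda>s. ?k * (F2 (s / a\<^sup>2) / a\<^sup>2 / a\<^sup>2))"
      unfolding divide_inverse by (intro continuous_intros continuous_on_compose2[OF F_derivs(3)]) auto
    show "(\<lambda>s. a / a ^ (2 * Suc j) * H (s / a\<^sup>2)) =
        (\<lambda>s. 4 * s * (?k * (F2 (s / a\<^sup>2) / a\<^sup>2 / a\<^sup>2)) + 2 * real n * (?k * (F1 (s / a\<^sup>2) / a\<^sup>2)))"
      unfolding F_derivs(4) by (simp add: fun_eq_iff divide_inverse power2_eq_square algebra_simps)
  qed
qed

lemma Green_radial:
  fixes v :: "real^'n::finite \<Rightarrow> real"
  assumes Ck_v: "Ck 2 v" and laplacian_F: "has_radial_laplacian CARD('n) F H"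
    and supp: "\<And>s. s \<ge> R\<^sup>2 \<Longrightarrow> F s = 0" and R_nonneg: "R \<ge> 0"
  shows "(LBINT y. laplacian v y * radial x F y) = (LBINT y. v y * radial x H y)"
proof -
  obtain F1 F2 where F_derivs:
    "\<And>s. (F has_real_derivative F1 s) (at s)" "\<And>s. (F1 has_real_derivative F2 s) (at s)"
    "continuous_on UNIV F2" "H = (\<lambda>s. 4 * s * F2 s + 2 * real CARD('n) * F1 s)"
    using laplacian_F unfolding has_radial_laplacian_def by blast
  have "radial x F y = 0" if "norm y > R + norm x" for y :: "real^'n"
    unfolding radial_def
  proof (rule supp)
    have "norm (y - x) \<ge> R" using that norm_triangle_ineq2[of y x] by simp
    then show "R\<^sup>2 \<le> (norm (y - x))\<^sup>2" using R_nonneg by (rule power_mono)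
  qed
  then show ?thesis
    using Green_compact_support[OF Ck_v Ck_radial[OF F_derivs(1-3)], of "R + norm x" x]
    by (simp add: laplacian_radial[OF F_derivs(1-3)] F_derivs(4))
qed

lemma Green_radial_trilaplacian:
  fixes u :: "real^'n::finite \<Rightarrow> real"
  assumes Ck_u: "Ck 6 u" and laplacians: "has_radial_laplacian CARD('n) F0 F1"
      "has_radial_laplacian CARD('n) F1 F2" "has_radial_laplacian CARD('n) F2 F3"
    and supp: "\<And>s. s \<ge> R\<^sup>2 \<Longrightarrow> F0 s = 0 \<and> F1 s = 0 \<and> F2 s = 0" and R_nonneg: "R \<ge> 0"
  shows "(LBINT y. (laplacian ^^ 3) u y * radial x F0 y) = (LBINT y. u y * radial x F3 y)"
proof -
  have "Ck 4 (laplacian u)" using Ck_u Ck_laplacian[of 4 u] by (simp add: eval_nat_numeral)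
  moreover from this have "Ck 2 (laplacian (laplacian u))"
    using Ck_laplacian[of 2 "laplacian u"] by (simp add: eval_nat_numeral)
  ultimately have "Ck 2 u" "Ck 2 (laplacian u)" "Ck 2 (laplacian (laplacian u))"
    using Ck_u Ck_Suc_imp_Ck by (auto simp: eval_nat_numeral)
  then show ?thesis
    using laplacians supp R_nonneg Green_radial[where x=x and R=R] by (simp add: numeral_3_eq_3)
qed

subsection \<open>A smooth profile for the norm\<close>

definition patch :: "(real \<Rightarrow> real) \<Rightarrow> real \<Rightarrow> real \<Rightarrow> real \<Rightarrow> real" where
  "patch p c a s = (if s \<le> 1 then p s else c * s powr a)"

lemma patch_outside: "s \<ge> 1 \<Longrightarrow> p 1 = c \<Longrightarrow> patch p c a s = c * s powr a"
  by (cases "s = 1") (auto simp: patch_def)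

lemma continuous_on_patch:
  assumes "continuous_on UNIV p" "p 1 = c"
  shows "continuous_on UNIV (patch p c a)"
proof -
  have "continuous_on UNIV (\<lambda>s. if s \<le> 1 then p s else c * s powr a)"
    using assms by (intro continuous_on_cases_le continuous_intros) (auto intro: continuous_on_subset)
  then show ?thesis by (simp add: patch_def[abs_def])
qed

lemma has_real_derivative_patch:
  assumes deriv_p: "\<And>s. (p has_real_derivative p' s) (at s)" and match: "p 1 = c" "p' 1 = c * a"
  shows "(patch p c a has_real_derivative patch p' (c * a) (a - 1) s) (at s)"
proof -
  have outer: "((\<lambda>s. c * s powr a) has_real_derivative c * a * s powr (a - 1)) (at s)" if "s > 0" for s
    using that by (auto intro!: derivative_eq_intros)
  have closures: "closure {..1::real} = {..1}" "closure {1<..} = {1::real..}" by simp_all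
  have "((\<lambda>s. if s \<in> {..1} then p s else c * s powr a) has_derivative
      (if s \<in> {..1} then (*) (p' s) else (*) (c * a * s powr (a - 1)))) (at s within {..1} \<union> {1<..})"
  proof (rule has_derivative_If_within_closures)
    show "(p has_derivative (*) (p' s)) (at s within {..1} \<union> closure {..1} \<inter> closure {1<..})"
      using deriv_p[of s] unfolding has_field_derivative_def by (rule has_derivative_at_withinI)
    show "((\<lambda>s. c * s powr a) has_derivative (*) (c * a * s powr (a - 1)))
        (at s within {1<..} \<union> closure {..1} \<inter> closure {1<..})"
      if "s \<in> {1<..} \<union> closure {..1} \<inter> closure {1<..}"
    proof (rule has_derivative_at_withinI)
      have "s > 0" using that by (auto simp: closures)
      from outer[OF this] show "((\<lambda>s. c * s powr a) has_derivative (*) (c * a * s powr (a - 1))) (at s)"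
        unfolding has_field_derivative_def .
    qed
  qed (use match in \<open>auto simp: closures\<close>)
  moreover have "{..1::real} \<union> {1<..} = UNIV" by auto
  ultimately show ?thesis
    by (auto simp: patch_def[abs_def] has_field_derivative_def split: if_splits)
qed

lemma has_radial_laplacian_patch:
  assumes p_derivs: "\<And>s. (p has_real_derivative p1 s) (at s)" "\<And>s. (p1 has_real_derivative p2 s) (at s)"
      "continuous_on UNIV p2" "\<And>s. h s = 4 * s * p2 s + 2 * real n * p1 s"
    and match: "p 1 = c" "p1 1 = c * a" "p2 1 = c * a * (a - 1)"
    and coeffs: "d = c * a * (4 * (a - 1) + 2 * real n)" "b = a - 1"
  shows "has_radial_laplacian n (patch p c a) (patch h d b)"
  unfolding has_radial_laplacian_def
proof (intro exI conjI allI)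
  show "(patch p c a has_real_derivative patch p1 (c * a) (a - 1) s) (at s)" for s
    using p_derivs(1) match(1,2) by (rule has_real_derivative_patch)
  show "(patch p1 (c * a) (a - 1) has_real_derivative patch p2 (c * a * (a - 1)) (a - 1 - 1) s) (at s)" for s
    using p_derivs(2) match(2,3) by (rule has_real_derivative_patch)
  show "continuous_on UNIV (patch p2 (c * a * (a - 1)) (a - 1 - 1))"
    using p_derivs(3) match(3) by (rule continuous_on_patch)
  have "s powr (a - 1) = s * s powr (a - 2)" if "s > 1" for s
    using that powr_mult_base[of s "a - 2"] by simp
  then show "patch h d b =
      (\<lambda>s. 4 * s * patch p2 (c * a * (a - 1)) (a - 1 - 1) s + 2 * real n * patch p1 (c * a) (a - 1) s)"
    by (auto simp: fun_eq_iff patch_def p_derivs(4) coeffs algebra_simps)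
qed

lemma rescale_patch:
  assumes a_pos: "a > 0" and s_ge: "s \<ge> a\<^sup>2" and p_1: "p 1 = c" and b_eq: "b = 1 / 2 - real j"
  shows "rescale j a (patch p c b) s = c * s powr b"
proof -
  have "(a\<^sup>2) powr b = a powr (2 * b)"
    using a_pos by (simp add: powr_powr flip: powr_numeral)
  also have "\<dots> = a / a ^ (2 * j)"
    using a_pos by (simp add: b_eq algebra_simps powr_diff flip: powr_realpow)
  finally have "(s / a\<^sup>2) powr b = s powr b * (a ^ (2 * j) / a)"
    using a_pos s_ge by (simp add: powr_divide)
  then show ?thesis using a_pos s_ge p_1 by (simp add: rescale_def patch_outside)
qed

text \<open>The inner piece of \<open>smooth_sqrt\<close> is the Taylor polynomial of degree 6 of \<open>sqrt (1 - t)\<close> with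
  \<open>t = 1 - s\<close>, which makes \<open>smooth_sqrt\<close> a \<open>C\<^sup>6\<close> function. The next three definitions are its iterated
  Laplacians in dimension 5; the last one vanishes for \<open>s \<ge> 1\<close> since \<open>|x|\<close> is triharmonic.\<close>

definition smooth_sqrt :: "real \<Rightarrow> real" where
  "smooth_sqrt = patch (\<lambda>s. 1 - 1/2 * (1 - s) - 1/8 * (1 - s)^2 - 1/16 * (1 - s)^3
     - 5/128 * (1 - s)^4 - 7/256 * (1 - s)^5 - 21/1024 * (1 - s)^6) 1 (1/2)"

definition lap_smooth_sqrt :: "real \<Rightarrow> real" where
  "lap_smooth_sqrt = patch (\<lambda>s. 4 + 2 * (1 - s) + 3/2 * (1 - s)^2 + 5/4 * (1 - s)^3
     + 35/32 * (1 - s)^4 + 945/256 * (1 - s)^5) 4 (-1/2)"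

definition bilap_smooth_sqrt :: "real \<Rightarrow> real" where
  "bilap_smooth_sqrt = patch (\<lambda>s. - 8 - 12 * (1 - s) - 15 * (1 - s)^2 + 3185/16 * (1 - s)^3
     - 61425/128 * (1 - s)^4) (-8) (-3/2)"

definition trilap_smooth_sqrt :: "real \<Rightarrow> real" where
  "trilap_smooth_sqrt = patch (\<lambda>s. 10395/16 * (8 * (1 - s) - 52 * (1 - s)^2 + 65 * (1 - s)^3)) 0 (-5/2)"

lemma has_radial_laplacian_smooth_sqrt: "has_radial_laplacian 5 smooth_sqrt lap_smooth_sqrt"
  unfolding smooth_sqrt_def lap_smooth_sqrt_def
proof (rule has_radial_laplacian_patch)
  show "((\<lambda>s. 1 - 1/2 * (1 - s) - 1/8 * (1 - s)^2 - 1/16 * (1 - s)^3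
       - 5/128 * (1 - s)^4 - 7/256 * (1 - s)^5 - 21/1024 * (1 - s)^6) has_real_derivative
     1/2 + 1/4 * (1 - s) + 3/16 * (1 - s)^2 + 5/32 * (1 - s)^3 + 35/256 * (1 - s)^4 + 63/512 * (1 - s)^5) (at s)"
    for s :: real
    by (auto intro!: derivative_eq_intros simp: field_simps)
  show "((\<lambda>s. 1/2 + 1/4 * (1 - s) + 3/16 * (1 - s)^2 + 5/32 * (1 - s)^3 + 35/256 * (1 - s)^4 + 63/512 * (1 - s)^5)
     has_real_derivative - 1/4 - 3/8 * (1 - s) - 15/32 * (1 - s)^2 - 35/64 * (1 - s)^3 - 315/512 * (1 - s)^4) (at s)"
    for s :: real
    by (auto intro!: derivative_eq_intros simp: field_simps)
  show "4 + 2 * (1 - s) + 3/2 * (1 - s)^2 + 5/4 * (1 - s)^3 + 35/32 * (1 - s)^4 + 945/256 * (1 - s)^5 =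
     4 * s * (- 1/4 - 3/8 * (1 - s) - 15/32 * (1 - s)^2 - 35/64 * (1 - s)^3 - 315/512 * (1 - s)^4)
     + 2 * real 5 * (1/2 + 1/4 * (1 - s) + 3/16 * (1 - s)^2 + 5/32 * (1 - s)^3 + 35/256 * (1 - s)^4 + 63/512 * (1 - s)^5)"
    for s :: real
    by (simp add: field_simps eval_nat_numeral)
qed (auto intro!: continuous_intros)

lemma has_radial_laplacian_lap_smooth_sqrt: "has_radial_laplacian 5 lap_smooth_sqrt bilap_smooth_sqrt"
  unfolding lap_smooth_sqrt_def bilap_smooth_sqrt_def
proof (rule has_radial_laplacian_patch)
  show "((\<lambda>s. 4 + 2 * (1 - s) + 3/2 * (1 - s)^2 + 5/4 * (1 - s)^3 + 35/32 * (1 - s)^4 + 945/256 * (1 - s)^5)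
     has_real_derivative - 2 - 3 * (1 - s) - 15/4 * (1 - s)^2 - 35/8 * (1 - s)^3 - 4725/256 * (1 - s)^4) (at s)"
    for s :: real
    by (auto intro!: derivative_eq_intros simp: field_simps)
  show "((\<lambda>s. - 2 - 3 * (1 - s) - 15/4 * (1 - s)^2 - 35/8 * (1 - s)^3 - 4725/256 * (1 - s)^4)
     has_real_derivative 3 + 15/2 * (1 - s) + 105/8 * (1 - s)^2 + 4725/64 * (1 - s)^3) (at s)" for s :: real
    by (auto intro!: derivative_eq_intros simp: field_simps)
  show "- 8 - 12 * (1 - s) - 15 * (1 - s)^2 + 3185/16 * (1 - s)^3 - 61425/128 * (1 - s)^4 =
     4 * s * (3 + 15/2 * (1 - s) + 105/8 * (1 - s)^2 + 4725/64 * (1 - s)^3)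
     + 2 * real 5 * (- 2 - 3 * (1 - s) - 15/4 * (1 - s)^2 - 35/8 * (1 - s)^3 - 4725/256 * (1 - s)^4)" for s :: real
    by (simp add: field_simps eval_nat_numeral)
qed (auto intro!: continuous_intros)

lemma has_radial_laplacian_bilap_smooth_sqrt: "has_radial_laplacian 5 bilap_smooth_sqrt trilap_smooth_sqrt"
  unfolding bilap_smooth_sqrt_def trilap_smooth_sqrt_def
proof (rule has_radial_laplacian_patch)
  show "((\<lambda>s. - 8 - 12 * (1 - s) - 15 * (1 - s)^2 + 3185/16 * (1 - s)^3 - 61425/128 * (1 - s)^4)
     has_real_derivative 12 + 30 * (1 - s) - 9555/16 * (1 - s)^2 + 61425/32 * (1 - s)^3) (at s)" for s :: real
    by (auto intro!: derivative_eq_intros simp: field_simps)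
  show "((\<lambda>s. 12 + 30 * (1 - s) - 9555/16 * (1 - s)^2 + 61425/32 * (1 - s)^3)
     has_real_derivative - 30 + 9555/8 * (1 - s) - 184275/32 * (1 - s)^2) (at s)" for s :: real
    by (auto intro!: derivative_eq_intros simp: field_simps)
  show "10395/16 * (8 * (1 - s) - 52 * (1 - s)^2 + 65 * (1 - s)^3) =
     4 * s * (- 30 + 9555/8 * (1 - s) - 184275/32 * (1 - s)^2)
     + 2 * real 5 * (12 + 30 * (1 - s) - 9555/16 * (1 - s)^2 + 61425/32 * (1 - s)^3)" for s :: real
    by (simp add: field_simps eval_nat_numeral)
qed (auto intro!: continuous_intros)

lemma triharmonic_radial_identity:
  fixes u :: "real^5 \<Rightarrow> real"
  assumes Ck_u: "Ck 6 u" and scales: "0 < e" "e \<le> R"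
  shows "(LBINT y. (laplacian ^^ 3) u y * radial x (\<lambda>s. rescale 0 e smooth_sqrt s - rescale 0 R smooth_sqrt s) y)
       = (LBINT y. u y * radial x (\<lambda>s. rescale 3 e trilap_smooth_sqrt s - rescale 3 R trilap_smooth_sqrt s) y)"
proof (rule Green_radial_trilaplacian[OF Ck_u])
  let ?D = "\<lambda>j F s. rescale j e F s - rescale j R F s"
  have laplacian_scales: "has_radial_laplacian CARD(5) (?D j F) (?D (Suc j) H)"
    if "has_radial_laplacian 5 F H" for j F H
    using that by (simp add: has_radial_laplacian_diff has_radial_laplacian_rescale)
  show "has_radial_laplacian CARD(5) (?D 0 smooth_sqrt) (?D 1 lap_smooth_sqrt)"
    "has_radial_laplacian CARD(5) (?D 1 lap_smooth_sqrt) (?D 2 bilap_smooth_sqrt)"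
    "has_radial_laplacian CARD(5) (?D 2 bilap_smooth_sqrt) (?D 3 trilap_smooth_sqrt)"
    using laplacian_scales[OF has_radial_laplacian_smooth_sqrt, of 0]
      laplacian_scales[OF has_radial_laplacian_lap_smooth_sqrt, of 1]
      laplacian_scales[OF has_radial_laplacian_bilap_smooth_sqrt, of 2] by (simp_all add: eval_nat_numeral)
  show "?D 0 smooth_sqrt s = 0 \<and> ?D 1 lap_smooth_sqrt s = 0 \<and> ?D 2 bilap_smooth_sqrt s = 0" if "R\<^sup>2 \<le> s" for s
  proof -
    have cancel: "rescale j e (patch p c b) s - rescale j R (patch p c b) s = 0"
      if "p 1 = c" "b = 1 / 2 - real j" for j p c b
      using rescale_patch[of e s p c b j] rescale_patch[of R s p c b j] that scales \<open>R\<^sup>2 \<le> s\<close>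
        order_trans[OF power_mono[of e R 2] \<open>R\<^sup>2 \<le> s\<close>] by simp
    show ?thesis
      unfolding smooth_sqrt_def lap_smooth_sqrt_def bilap_smooth_sqrt_def by (intro conjI cancel) auto
  qed
qed (use scales in auto)

lemma sqrt_le_smooth_sqrt:
  assumes "s \<ge> 0" shows "sqrt s \<le> smooth_sqrt s"
proof (cases "s \<le> 1")
  case True
  define r where "r = sqrt s"
  have r_bounds: "0 \<le> r" "r \<le> 1" "s = r^2" using True assms by (auto simp: r_def)
  have "smooth_sqrt s - r = (1 - r)^7 * (231 + 593 * r + 686 * r^2 + 434 * r^3 + 147 * r^4 + 21 * r^5) / 1024"
    using True unfolding smooth_sqrt_def patch_def r_bounds(3) by (simp add: field_simps) algebra
  also have "\<dots> \<ge> 0" using r_bounds by simp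
  finally show ?thesis by (simp add: r_def)
qed (use assms in \<open>auto simp: smooth_sqrt_def patch_def powr_half_sqrt\<close>)

lemma smooth_sqrt_eq_sqrt: "s \<ge> 1 \<Longrightarrow> smooth_sqrt s = sqrt s"
  by (simp add: smooth_sqrt_def patch_outside powr_half_sqrt)

lemma
  assumes "s \<ge> 0"
  shows smooth_sqrt_ge: "smooth_sqrt s \<ge> 231 / 1024"
    and smooth_sqrt_le: "smooth_sqrt s \<le> max 1 (sqrt s)"
proof -
  have "smooth_sqrt s \<ge> 231 / 1024 \<and> smooth_sqrt s \<le> max 1 (sqrt s)"
  proof (cases "s \<le> 1")
    case True
    then have power_bounds: "(1 - s) ^ k \<le> 1 \<and> (1 - s) ^ k \<ge> 0" for k
      using assms by (auto intro: power_le_one)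
    have "smooth_sqrt s = 1 - 1/2 * (1 - s) ^ 1 - 1/8 * (1 - s)^2 - 1/16 * (1 - s)^3
        - 5/128 * (1 - s)^4 - 7/256 * (1 - s)^5 - 21/1024 * (1 - s)^6"
      using True by (simp add: smooth_sqrt_def patch_def)
    then have "smooth_sqrt s \<ge> 231 / 1024" "smooth_sqrt s \<le> 1"
      using power_bounds[of 1] power_bounds[of 2] power_bounds[of 3] power_bounds[of 4]
        power_bounds[of 5] power_bounds[of 6] by linarith+
    then show ?thesis by simp
  next
    case False
    then have "sqrt s \<ge> 1" "smooth_sqrt s = sqrt s" by (simp_all add: smooth_sqrt_eq_sqrt)
    then show ?thesis by linarith
  qed
  then show "smooth_sqrt s \<ge> 231 / 1024" "smooth_sqrt s \<le> max 1 (sqrt s)" by auto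
qed

subsection \<open>Asymptotics along rays\<close>

lemma filterlim_inverse_at_0: "filterlim inverse (at (0::real)) at_top"
  using filterlim_inverse_at_right_top by (rule filterlim_mono) (auto simp: at_le)

lemma tendsto_inverse_at_top: "(inverse \<longlongrightarrow> (0::real)) at_top"
  using filterlim_inverse_at_0 by (rule filterlim_mono) (auto simp: at_within_def)

lemma has_real_derivative_norm_line:
  fixes a b :: "'a::real_inner"
  assumes "a \<noteq> 0"
  shows "((\<lambda>t. norm (a + t *\<^sub>R b)) has_real_derivative b \<bullet> sgn a) (at 0)"
proof -
  have line: "((\<lambda>t. a + t *\<^sub>R b) has_derivative (\<lambda>h. h *\<^sub>R b)) (at 0)"
    by (auto intro!: derivative_eq_intros)
  have "(norm has_derivative (\<lambda>v. v \<bullet> sgn a)) (at (a + 0 *\<^sub>R b))"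
    using has_derivative_norm[OF assms] by simp
  from has_derivative_compose[OF line this] show ?thesis
    by (rule has_derivative_imp_has_field_derivative) simp
qed

lemma tendsto_norm_ray_diff:
  fixes x z :: "'a::real_inner"
  assumes "z \<noteq> 0"
  shows "((\<lambda>t. norm (t *\<^sub>R z - x) - t * norm z) \<longlongrightarrow> - (x \<bullet> sgn z)) at_top"
proof -
  have "((\<lambda>s. (norm (z - s *\<^sub>R x) - norm z) / s) \<longlongrightarrow> - (x \<bullet> sgn z)) (at 0)"
    using has_real_derivative_norm_line[OF assms, of "- x"] by (simp add: has_field_derivative_iff)
  from filterlim_compose[OF this filterlim_inverse_at_0]
  have "((\<lambda>t. (norm (z - inverse t *\<^sub>R x) - norm z) / inverse t) \<longlongrightarrow> - (x \<bullet> sgn z)) at_top" .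
  moreover have "\<forall>\<^sub>F t in at_top. (norm (z - inverse t *\<^sub>R x) - norm z) / inverse t
      = norm (t *\<^sub>R z - x) - t * norm z"
    using eventually_gt_at_top[of 0]
  proof eventually_elim
    case (elim t)
    then have "t *\<^sub>R z - x = t *\<^sub>R (z - inverse t *\<^sub>R x)" by (simp add: scaleR_diff_right)
    then have "norm (t *\<^sub>R z - x) = t * norm (z - inverse t *\<^sub>R x)" using elim by simp
    then show ?case by (simp add: divide_inverse algebra_simps)
  qed
  ultimately show ?thesis by (rule Lim_transform_eventually)
qed

lemma tendsto_norm_unit_ray_diff:
  fixes e x :: "'a::real_inner"
  assumes "norm e = 1"
  shows "((\<lambda>t. norm (t *\<^sub>R e - x) - t) \<longlongrightarrow> - (e \<bullet> x)) at_top"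
proof -
  have "e \<noteq> 0" "sgn e = e" using assms by (auto simp: sgn_div_norm)
  then show ?thesis using tendsto_norm_ray_diff[of e x] assms by (simp add: inner_commute)
qed

lemma abs_norm_diff_le: "\<bar>norm (x - y) - norm y\<bar> \<le> norm (x::'a::real_normed_vector)"
  using norm_triangle_ineq3[of "x - y" "- y"] by simp

lemma tendsto_ray_if_sublinear:
  fixes e :: "'a::real_normed_vector \<Rightarrow> real"
  assumes "((\<lambda>x. e x / norm x) \<longlongrightarrow> 0) at_infinity"
  shows "((\<lambda>R. e (R *\<^sub>R z) / R) \<longlongrightarrow> 0) at_top"
proof (cases "z = 0")
  case True
  then show ?thesis
    using tendsto_mult_right_zero[OF tendsto_inverse_at_top, of "e 0"] by (simp add: divide_inverse)
next
  case False
  have "filterlim (\<lambda>R. \<bar>R\<bar> * norm z) at_top at_top"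
    using False by (intro filterlim_at_top_mult_tendsto_pos[OF tendsto_const] filterlim_abs_real) auto
  then have "filterlim (\<lambda>R. R *\<^sub>R z) at_infinity at_top"
    by (simp add: filterlim_at_infinity_conv_norm_at_top)
  from tendsto_mult_right_zero[OF filterlim_compose[OF assms this], of "norm z"]
  have "((\<lambda>R. norm z * (e (R *\<^sub>R z) / norm (R *\<^sub>R z))) \<longlongrightarrow> 0) at_top" .
  moreover have "\<forall>\<^sub>F R in at_top. norm z * (e (R *\<^sub>R z) / norm (R *\<^sub>R z)) = e (R *\<^sub>R z) / R"
    using eventually_gt_at_top[of 0] by eventually_elim (use False in simp)
  ultimately show ?thesis by (rule Lim_transform_eventually)
qed

lemma continuous_linear_growth:
  fixes u :: "'a::euclidean_space \<Rightarrow> real"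
  assumes cont: "continuous_on UNIV u" and lim: "((\<lambda>x. u x / norm x) \<longlongrightarrow> \<alpha>) at_infinity"
  obtains A where "A \<ge> 0" "\<And>x. \<bar>u x\<bar> \<le> A * (1 + norm x)"
proof -
  have "\<forall>\<^sub>F x in at_infinity. dist (u x / norm x) \<alpha> < 1" using lim by (rule tendstoD) simp
  then obtain b where near_\<alpha>: "\<And>x. norm x \<ge> b \<Longrightarrow> dist (u x / norm x) \<alpha> < 1"
    by (auto simp: eventually_at_infinity)
  obtain B where B_nonneg: "B \<ge> 0" and B_bound: "\<And>x. x \<in> cball 0 \<bar>b\<bar> \<Longrightarrow> norm (u x) \<le> B"
    using continuous_on_compact_bound[OF compact_cball continuous_on_subset[OF cont subset_UNIV]] by blast
  show ?thesis
  proof (rule that)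
    show "B + \<bar>\<alpha>\<bar> + 1 \<ge> 0" using B_nonneg by simp
    fix x :: 'a
    show "\<bar>u x\<bar> \<le> (B + \<bar>\<alpha>\<bar> + 1) * (1 + norm x)"
    proof (cases "norm x \<le> \<bar>b\<bar>")
      case True
      then have "\<bar>u x\<bar> \<le> B * 1" using B_bound[of x] by simp
      also have "\<dots> \<le> (B + \<bar>\<alpha>\<bar> + 1) * (1 + norm x)" using B_nonneg by (intro mult_mono) auto
      finally show ?thesis .
    next
      case False
      then have x_pos: "norm x > 0" by linarith
      have "\<bar>u x / norm x\<bar> \<le> \<bar>\<alpha>\<bar> + 1" using near_\<alpha>[of x] False unfolding dist_real_def by linarith
      then have "\<bar>u x\<bar> \<le> (\<bar>\<alpha>\<bar> + 1) * norm x" using x_pos by (simp add: abs_divide pos_divide_le_eq)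
      also have "\<dots> \<le> (B + \<bar>\<alpha>\<bar> + 1) * (1 + norm x)" using B_nonneg by (intro mult_mono) auto
      finally show ?thesis .
    qed
  qed
qed

subsection \<open>Averages against an even kernel\<close>

definition average :: "('a::euclidean_space \<Rightarrow> real) \<Rightarrow> ('a \<Rightarrow> real) \<Rightarrow> real \<Rightarrow> 'a \<Rightarrow> real" where
  "average K u a x = (LBINT z. u (x + a *\<^sub>R z) * K z)"

locale averaging_kernel =
  fixes K :: "'a::euclidean_space \<Rightarrow> real"
  assumes lipschitz: "\<exists>L. L-lipschitz_on UNIV K"
    and support: "\<And>z. norm z \<ge> 1 \<Longrightarrow> K z = 0"
    and even: "\<And>z. K (- z) = K z"
begin

lemma continuous: "continuous_on UNIV K"
  using lipschitz lipschitz_on_continuous_on by blast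

lemma borel_measurable [measurable]: "K \<in> borel_measurable borel"
  using continuous by (rule borel_measurable_continuous_onI)

lemma integrable_mult: "continuous_on UNIV h \<Longrightarrow> integrable lborel (\<lambda>z. h z * K z)"
  by (rule integrable_continuous_compact_support[where R=1])
     (use continuous support in \<open>auto intro!: continuous_intros\<close>)

lemma integrable: "integrable lborel K"
  using integrable_mult[of "\<lambda>_. 1"] by simp

lemma integrable_average:
  assumes "continuous_on UNIV u"
  shows "integrable lborel (\<lambda>z. u (x + a *\<^sub>R z) * K z)"
  by (intro integrable_mult continuous_on_compose2[OF assms]) (auto intro!: continuous_intros)

lemma
  fixes u :: "'a \<Rightarrow> real"
  assumes "a > 0"
  shows average_eq_integral: "average K u a x = (LBINT y. u y * (K ((y - x) /\<^sub>R a) / a ^ DIM('a)))"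
    and integrable_average_rescaled:
      "continuous_on UNIV u \<Longrightarrow> integrable lborel (\<lambda>y. u y * (K ((y - x) /\<^sub>R a) / a ^ DIM('a)))"
  using assms integral_lborel_affine[of a "\<lambda>y. u y * (K ((y - x) /\<^sub>R a) / a ^ DIM('a))" x]
    integrable_lborel_affine_iff[of a "\<lambda>y. u y * (K ((y - x) /\<^sub>R a) / a ^ DIM('a))" x]
    integrable_average[of u x a]
  by (simp_all add: average_def)

lemma average_add_cmult:
  assumes "continuous_on UNIV u" "continuous_on UNIV v"
  shows "average K (\<lambda>y. u y + k * v y) a x = average K u a x + k * average K v a x"
  using integrable_average[OF assms(1), of x a] integrable_average[OF assms(2), of x a]
  by (simp add: average_def distrib_right mult.assoc)

lemma abs_average_le:
  assumes cont: "continuous_on UNIV u" and growth: "A \<ge> 0" "\<And>x. \<bar>u x\<bar> \<le> A * (1 + norm x)" and a_pos: "a > 0"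
  shows "\<bar>average K u a 0\<bar> \<le> A * (1 + a) * (LBINT z. \<bar>K z\<bar>)"
proof -
  have "\<bar>average K u a 0\<bar> \<le> (LBINT z. \<bar>u (0 + a *\<^sub>R z) * K z\<bar>)"
    unfolding average_def by (rule integral_abs_bound)
  also have "\<dots> \<le> (LBINT z. A * (1 + a) * \<bar>K z\<bar>)"
  proof (rule integral_mono)
    show "integrable lborel (\<lambda>z. \<bar>u (0 + a *\<^sub>R z) * K z\<bar>)"
      using integrable_average[OF cont] by (rule integrable_abs)
    show "integrable lborel (\<lambda>z. A * (1 + a) * \<bar>K z\<bar>)" using integrable by auto
    show "\<bar>u (0 + a *\<^sub>R z) * K z\<bar> \<le> A * (1 + a) * \<bar>K z\<bar>" for z
    proof (cases "norm z \<ge> 1")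
      case False
      have "\<bar>u (0 + a *\<^sub>R z)\<bar> \<le> A * (1 + norm (0 + a *\<^sub>R z))" by (rule growth(2))
      also have "\<dots> \<le> A * (1 + a)"
        using False a_pos growth(1) mult_left_mono[of "norm z" 1 a] by (intro mult_left_mono) auto
      finally show ?thesis by (simp add: abs_mult mult_right_mono)
    qed (simp add: support)
  qed
  finally show ?thesis by simp
qed

lemma abs_average_diff_le:
  assumes cont: "continuous_on UNIV u" and growth: "A \<ge> 0" "\<And>x. \<bar>u x\<bar> \<le> A * (1 + norm x)" and R_ge: "R \<ge> 3"
  shows "\<bar>average K u R 0 - average K u 1 0\<bar> \<le> 2 * R * (A * (LBINT z. \<bar>K z\<bar>))"
proof -
  define B where "B = A * (LBINT z. \<bar>K z\<bar>)"
  have "\<bar>average K u a 0\<bar> \<le> B * (1 + a)" if "a > 0" for a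
    using abs_average_le[OF cont growth that] by (simp add: B_def mult_ac)
  from this[of R] this[of 1] have "\<bar>average K u R 0 - average K u 1 0\<bar> \<le> B * (3 + R)"
    using R_ge by (simp add: algebra_simps)
  also have "\<dots> \<le> B * (2 * R)" using growth(1) R_ge by (intro mult_left_mono) (auto simp: B_def)
  finally show ?thesis by (simp add: B_def mult_ac)
qed

lemma tendsto_average_small:
  assumes cont: "continuous_on UNIV u"
  shows "((\<lambda>R. average K u (inverse R) x) \<longlongrightarrow> (LBINT z. K z) * u x) at_top"
proof -
  have [measurable]: "u \<in> borel_measurable borel" using cont by (rule borel_measurable_continuous_onI)
  obtain M where u_bound: "\<And>y. y \<in> cball x 1 \<Longrightarrow> norm (u y) \<le> M"
    using continuous_on_compact_bound[OF compact_cball continuous_on_subset[OF cont subset_UNIV]] by metis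
  have "((\<lambda>R. average K u (inverse R) x) \<longlongrightarrow> (LBINT z. u x * K z)) at_top"
    unfolding average_def
  proof (rule integral_dominated_convergence_at_top[where w="\<lambda>z. M * \<bar>K z\<bar>"])
    show "integrable lborel (\<lambda>z. M * \<bar>K z\<bar>)" using integrable by auto
    show "AE z in lborel. ((\<lambda>R. u (x + inverse R *\<^sub>R z) * K z) \<longlongrightarrow> u x * K z) at_top"
    proof (intro AE_I2 tendsto_mult tendsto_const)
      fix z
      have "((\<lambda>R. x + inverse R *\<^sub>R z) \<longlongrightarrow> x + 0 *\<^sub>R z) at_top"
        by (intro tendsto_intros tendsto_inverse_at_top)
      then show "((\<lambda>R. u (x + inverse R *\<^sub>R z)) \<longlongrightarrow> u x) at_top"
        using cont by (auto simp: continuous_on_eq_continuous_at intro: isCont_tendsto_compose)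
    qed
    show "\<forall>\<^sub>F R in at_top. AE z in lborel. norm (u (x + inverse R *\<^sub>R z) * K z) \<le> M * \<bar>K z\<bar>"
      using eventually_ge_at_top[of 1]
    proof eventually_elim
      case (elim R)
      have "norm (u (x + inverse R *\<^sub>R z) * K z) \<le> M * \<bar>K z\<bar>" for z
      proof (cases "norm z \<ge> 1")
        case False
        then have "inverse R * norm z \<le> 1 * 1"
          using elim by (intro mult_mono) (auto simp: inverse_le_1_iff)
        then have "x + inverse R *\<^sub>R z \<in> cball x 1" using elim by (simp add: dist_norm)
        then show ?thesis using u_bound by (simp add: abs_mult mult_right_mono)
      qed (simp add: support)
      then show ?case by simp
    qed
  qed measurable
  then show ?thesis by (simp add: mult.commute)
qed

text \<open>The first order term in \<open>x\<close> drops out because the kernel is even.\<close>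

lemma average_norm_diff_eq:
  "2 * (average K norm R x - average K norm R 0)
    = (LBINT z. (norm (R *\<^sub>R z - - x) + norm (R *\<^sub>R z - x) - 2 * norm (R *\<^sub>R z)) * K z)"
proof -
  have integrable: "integrable lborel (\<lambda>z. norm (y + R *\<^sub>R z) * K z)" for y R
    by (intro integrable_average continuous_intros)
  have "2 * (average K norm R x - average K norm R 0)
      = average K norm R x + average K norm R (- x) - 2 * average K norm R 0"
    using integral_lborel_reflect[of "\<lambda>z. norm (x + R *\<^sub>R z) * K z"]
    by (simp add: average_def even norm_minus_commute)
  also have "\<dots> = (LBINT z. norm (x + R *\<^sub>R z) * K z + norm (- x + R *\<^sub>R z) * K z - 2 * (norm (0 + R *\<^sub>R z) * K z))"
    unfolding average_def using integrable[of x R] integrable[of "- x" R] integrable[of 0 R] by simp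
  finally show ?thesis by (simp add: algebra_simps)
qed

lemma tendsto_average_norm_diff:
  "((\<lambda>R. average K norm R x - average K norm R 0) \<longlongrightarrow> 0) at_top"
proof -
  let ?D = "\<lambda>R z. norm (R *\<^sub>R z - - x) + norm (R *\<^sub>R z - x) - 2 * norm (R *\<^sub>R z)"
  have "((\<lambda>R. LBINT z. ?D R z * K z) \<longlongrightarrow> (\<integral>z. 0 \<partial>(lborel :: 'a measure))) at_top"
  proof (rule integral_dominated_convergence_at_top[where w="\<lambda>z. 2 * norm x * \<bar>K z\<bar>"])
    show "integrable lborel (\<lambda>z. 2 * norm x * \<bar>K z\<bar>)" using integrable by auto
    have "\<bar>?D R z\<bar> \<le> 2 * norm x" for R z
      using norm_triangle_ineq3[of "R *\<^sub>R z - - x" "R *\<^sub>R z"] norm_triangle_ineq3[of "R *\<^sub>R z - x" "R *\<^sub>R z"]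
      by simp
    then show "\<forall>\<^sub>F R in at_top. AE z in lborel. norm (?D R z * K z) \<le> 2 * norm x * \<bar>K z\<bar>"
      by (simp add: abs_mult mult_right_mono)
    have "AE z in lborel. z \<noteq> (0::'a)" by (rule AE_lborel_singleton)
    then show "AE z in lborel. ((\<lambda>R. ?D R z * K z) \<longlongrightarrow> 0) at_top"
    proof eventually_elim
      case (elim z)
      have "((\<lambda>R. (norm (R *\<^sub>R z - - x) - R * norm z) + (norm (R *\<^sub>R z - x) - R * norm z))
          \<longlongrightarrow> - (- x \<bullet> sgn z) + - (x \<bullet> sgn z)) at_top"
        by (intro tendsto_add tendsto_norm_ray_diff elim)
      moreover have "\<forall>\<^sub>F R in at_top.
          (norm (R *\<^sub>R z - - x) - R * norm z) + (norm (R *\<^sub>R z - x) - R * norm z) = ?D R z"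
        using eventually_ge_at_top[of 0] by eventually_elim simp
      ultimately have "((\<lambda>R. ?D R z) \<longlongrightarrow> - (- x \<bullet> sgn z) + - (x \<bullet> sgn z)) at_top"
        by (rule Lim_transform_eventually)
      then show ?case by (intro tendsto_mult_left_zero) simp
    qed
  qed measurable
  then have "((\<lambda>R. 2 * (average K norm R x - average K norm R 0)) \<longlongrightarrow> 0) at_top"
    unfolding average_norm_diff_eq by simp
  from tendsto_mult_right_zero[OF this, of "1 / 2"] show ?thesis by (simp add: diff_divide_distrib)
qed

lemma average_shift_diff:
  assumes cont: "continuous_on UNIV e" and R_pos: "R > 0"
  shows "average K e R x - average K e R 0 = (LBINT z. e (R *\<^sub>R z) * (K (z - x /\<^sub>R R) - K z))"
proof -
  have shift: "e (x + R *\<^sub>R (- (x /\<^sub>R R) + z)) * K (- (x /\<^sub>R R) + z) = e (R *\<^sub>R z) * K (z - x /\<^sub>R R)" for z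
    using R_pos by (simp add: algebra_simps)
  have "average K e R x = (LBINT z. e (R *\<^sub>R z) * K (z - x /\<^sub>R R))"
    unfolding average_def
    using integral_lborel_translate[of "\<lambda>z. e (x + R *\<^sub>R z) * K z" "- (x /\<^sub>R R)"] unfolding shift by simp
  moreover have "integrable lborel (\<lambda>z. e (R *\<^sub>R z) * K (z - x /\<^sub>R R))"
    using integrable_lborel_affine[of 1 "\<lambda>z. e (x + R *\<^sub>R z) * K z" "- (x /\<^sub>R R)"]
      integrable_average[OF cont, of x R] unfolding scaleR_one shift by simp
  moreover have "integrable lborel (\<lambda>z. e (R *\<^sub>R z) * K z)"
    using integrable_average[OF cont, of 0 R] by simp
  ultimately show ?thesis by (simp add: average_def right_diff_distrib)
qed

lemma abs_kernel_shift_le: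
  assumes L_lipschitz: "L-lipschitz_on UNIV K" and R_ge: "R \<ge> 1"
  shows "\<bar>K (z - x /\<^sub>R R) - K z\<bar> \<le> L * norm x / R * indicator (cball 0 (1 + norm x)) z"
proof (cases "norm z \<le> 1 + norm x")
  case True
  then show ?thesis
    using lipschitz_on_normD[OF L_lipschitz, of "z - x /\<^sub>R R" z] R_ge by (simp add: divide_inverse mult_ac)
next
  case False
  have "norm x / R \<le> norm x / 1" using R_ge by (intro divide_left_mono) auto
  then have "norm (z - x /\<^sub>R R) \<ge> 1"
    using False R_ge norm_triangle_ineq2[of z "x /\<^sub>R R"] by (simp add: divide_inverse mult.commute)
  moreover have "norm z \<ge> 1" using False norm_ge_zero[of x] by linarith
  ultimately show ?thesis using False by (simp add: support)
qed

lemma abs_shifted_integrand_le: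
  assumes L_lipschitz: "L-lipschitz_on UNIV K"
    and R_ge: "R \<ge> 1" and growth: "A \<ge> 0" "\<And>x. \<bar>e x\<bar> \<le> A * (1 + norm x)"
  shows "\<bar>e (R *\<^sub>R z) * (K (z - x /\<^sub>R R) - K z)\<bar>
      \<le> \<bar>e (R *\<^sub>R z) / R\<bar> * (L * norm x * indicator (cball 0 (1 + norm x)) z)"
    and "\<bar>e (R *\<^sub>R z) * (K (z - x /\<^sub>R R) - K z)\<bar>
        \<le> A * (2 + norm x) * (L * norm x * indicator (cball 0 (1 + norm x)) z)"
proof -
  show quotient: "\<bar>e (R *\<^sub>R z) * (K (z - x /\<^sub>R R) - K z)\<bar>
      \<le> \<bar>e (R *\<^sub>R z) / R\<bar> * (L * norm x * indicator (cball 0 (1 + norm x)) z)"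
    using mult_left_mono[OF abs_kernel_shift_le[OF L_lipschitz R_ge, of z x], of "\<bar>e (R *\<^sub>R z)\<bar>"] R_ge
    by (simp add: abs_mult abs_divide mult_ac)
  show "\<bar>e (R *\<^sub>R z) * (K (z - x /\<^sub>R R) - K z)\<bar>
      \<le> A * (2 + norm x) * (L * norm x * indicator (cball 0 (1 + norm x)) z)"
  proof (cases "norm z \<le> 1 + norm x")
    case True
    have "\<bar>e (R *\<^sub>R z)\<bar> \<le> A * (1 + R * norm z)" using growth(2)[of "R *\<^sub>R z"] R_ge by simp
    also have "\<dots> \<le> A * (R + R * (1 + norm x))"
      using True R_ge growth(1) by (intro mult_left_mono add_mono) auto
    finally have "\<bar>e (R *\<^sub>R z) / R\<bar> \<le> A * (2 + norm x)" using R_ge by (simp add: abs_divide field_simps)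
    from mult_right_mono[OF this, of "L * norm x * indicator (cball 0 (1 + norm x)) z"] show ?thesis
      using quotient lipschitz_on_nonneg[OF L_lipschitz] by simp
  qed (use quotient in simp)
qed

lemma tendsto_average_sublinear_diff:
  assumes cont: "continuous_on UNIV e" and lim: "((\<lambda>x. e x / norm x) \<longlongrightarrow> 0) at_infinity"
  shows "((\<lambda>R. average K e R x - average K e R 0) \<longlongrightarrow> 0) at_top"
proof -
  have [measurable]: "e \<in> borel_measurable borel" using cont by (rule borel_measurable_continuous_onI)
  obtain A where growth: "A \<ge> 0" "\<And>x. \<bar>e x\<bar> \<le> A * (1 + norm x)"
    using continuous_linear_growth[OF cont lim] by blast
  obtain L where L_lipschitz: "L-lipschitz_on UNIV K" using lipschitz by blast
  let ?I = "\<lambda>R z. e (R *\<^sub>R z) * (K (z - x /\<^sub>R R) - K z)"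
  let ?w = "\<lambda>z::'a. L * norm x * indicator (cball 0 (1 + norm x)) z"
  have "((\<lambda>R. LBINT z. ?I R z) \<longlongrightarrow> (\<integral>z. 0 \<partial>(lborel :: 'a measure))) at_top"
  proof (rule integral_dominated_convergence_at_top[where w="\<lambda>z. A * (2 + norm x) * ?w z"])
    show "integrable lborel (\<lambda>z. A * (2 + norm x) * ?w z)"
      using integrable_indicator_cball by (intro integrable_mult_right)
    show "\<forall>\<^sub>F R in at_top. AE z in lborel. norm (?I R z) \<le> A * (2 + norm x) * ?w z"
      using eventually_ge_at_top[of 1]
      by eventually_elim (use abs_shifted_integrand_le(2)[OF L_lipschitz _ growth] in simp)
    have "((\<lambda>R. ?I R z) \<longlongrightarrow> 0) at_top" for z
    proof (rule Lim_null_comparison)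
      show "\<forall>\<^sub>F R in at_top. norm (?I R z) \<le> \<bar>e (R *\<^sub>R z) / R\<bar> * ?w z"
        using eventually_ge_at_top[of 1]
        by eventually_elim (use abs_shifted_integrand_le(1)[OF L_lipschitz _ growth] in simp)
      show "((\<lambda>R. \<bar>e (R *\<^sub>R z) / R\<bar> * ?w z) \<longlongrightarrow> 0) at_top"
        by (intro tendsto_mult_left_zero tendsto_rabs_zero tendsto_ray_if_sublinear lim)
    qed
    then show "AE z in lborel. ((\<lambda>R. ?I R z) \<longlongrightarrow> 0) at_top" by simp
  qed measurable
  moreover have "\<forall>\<^sub>F R in at_top. (LBINT z. ?I R z) = average K e R x - average K e R 0"
    using eventually_gt_at_top[of 0] by eventually_elim (simp add: average_shift_diff[OF cont])
  ultimately show ?thesis by (simp add: Lim_transform_eventually)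
qed

lemma tendsto_average_diff:
  assumes cont: "continuous_on UNIV u" and lim: "((\<lambda>x. u x / norm x) \<longlongrightarrow> \<alpha>) at_infinity"
  shows "((\<lambda>R. average K u R x - average K u R 0) \<longlongrightarrow> 0) at_top"
proof -
  define e where "e y = u y - \<alpha> * norm y" for y
  have cont_e: "continuous_on UNIV e" unfolding e_def[abs_def] by (intro continuous_intros cont)
  have "((\<lambda>x. u x / norm x - \<alpha>) \<longlongrightarrow> 0) at_infinity"
    using tendsto_diff[OF lim tendsto_const[of \<alpha>]] by simp
  moreover have "\<forall>\<^sub>F x in at_infinity. u x / norm x - \<alpha> = e x / norm x"
    unfolding eventually_at_infinity e_def by (rule exI[of _ 1]) (auto simp: diff_divide_distrib)
  ultimately have sublinear: "((\<lambda>x. e x / norm x) \<longlongrightarrow> 0) at_infinity"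
    by (rule Lim_transform_eventually)
  have "average K u R y = average K e R y + \<alpha> * average K norm R y" for R y
    using average_add_cmult[OF cont_e, of norm \<alpha> R y] by (simp add: e_def continuous_on_norm_id)
  then show ?thesis
    using tendsto_add[OF tendsto_average_sublinear_diff[OF cont_e sublinear, of x]
        tendsto_mult_right_zero[OF tendsto_average_norm_diff[of x], of \<alpha>]]
    by (simp add: algebra_simps)
qed

end

subsection \<open>Smoothing the norm\<close>

lemma lipschitz_on_interval_if_continuous_derivative:
  fixes f f' :: "real \<Rightarrow> real"
  assumes deriv: "\<And>x. x \<in> {a..b} \<Longrightarrow> (f has_real_derivative f' x) (at x)" and cont: "continuous_on {a..b} f'"
  obtains L where "L-lipschitz_on {a..b} f"
proof -
  obtain B where B_nonneg: "B \<ge> 0" and B_bound: "\<And>x. x \<in> {a..b} \<Longrightarrow> norm (f' x) \<le> B"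
    using continuous_on_compact_bound[OF compact_Icc cont] by blast
  have "B-lipschitz_on {a..b} f"
  proof (rule lipschitz_onI)
    show "dist (f x) (f y) \<le> B * dist x y" if "x \<in> {a..b}" "y \<in> {a..b}" for x y
      using field_differentiable_bound[of "{a..b}" f f' B x y] deriv B_bound that
      by (auto simp: dist_norm intro: has_field_derivative_at_within)
  qed (rule B_nonneg)
  then show ?thesis by (rule that)
qed

lemma smooth_sqrt_square_lipschitz:
  obtains L where "L-lipschitz_on {0..} (\<lambda>r. smooth_sqrt (r\<^sup>2))"
proof -
  let ?h = "\<lambda>r. smooth_sqrt (r\<^sup>2)"
  obtain F1 F2 where F_derivs: "\<And>s. (smooth_sqrt has_real_derivative F1 s) (at s)"
    "\<And>s. (F1 has_real_derivative F2 s) (at s)"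
    using has_radial_laplacian_smooth_sqrt unfolding has_radial_laplacian_def by blast
  have cont: "continuous_on UNIV F1"
    using F_derivs(2) by (intro continuous_at_imp_continuous_on ballI DERIV_isCont)
  have "continuous_on {0..1} (\<lambda>r. F1 (r\<^sup>2) * (2 * r))"
    by (intro continuous_intros continuous_on_compose2[OF cont]) auto
  moreover have "(?h has_real_derivative F1 (r\<^sup>2) * (2 * r)) (at r)" for r
    by (rule DERIV_chain'[where f="\<lambda>r. r\<^sup>2", OF _ F_derivs(1)]) (auto intro!: derivative_eq_intros)
  ultimately obtain L where L_lipschitz: "L-lipschitz_on {0..1} ?h"
    using lipschitz_on_interval_if_continuous_derivative[of 0 1 ?h "\<lambda>r. F1 (r\<^sup>2) * (2 * r)"] by blast
  have h_eq: "?h r = ?h (min 1 r) + (max 1 r - 1)" if "r \<ge> 0" for r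
    using that smooth_sqrt_eq_sqrt[of "r\<^sup>2"] smooth_sqrt_eq_sqrt[of 1]
    by (cases "r \<le> 1") (auto simp: min_def max_def)
  have "(L + 1)-lipschitz_on {0..} ?h"
  proof (rule lipschitz_onI)
    fix r t :: real assume "r \<in> {0..}" "t \<in> {0..}"
    then have r_nonneg: "r \<ge> 0" and t_nonneg: "t \<ge> 0" by auto
    have "dist (?h r) (?h t) \<le> dist (?h (min 1 r)) (?h (min 1 t)) + dist (max 1 r) (max 1 t)"
      using h_eq[OF r_nonneg] h_eq[OF t_nonneg] unfolding dist_real_def by linarith
    also have "\<dots> \<le> L * dist (min 1 r) (min 1 t) + dist r t"
      using r_nonneg t_nonneg by (intro add_mono lipschitz_onD[OF L_lipschitz]) (auto simp: dist_real_def)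
    also have "\<dots> \<le> L * dist r t + dist r t"
      using lipschitz_on_nonneg[OF L_lipschitz] by (intro add_mono mult_left_mono) (auto simp: dist_real_def)
    finally show "dist (?h r) (?h t) \<le> (L + 1) * dist r t" by (simp add: algebra_simps)
  qed (use lipschitz_on_nonneg[OF L_lipschitz] in simp)
  then show ?thesis by (rule that)
qed

definition smooth_norm :: "real \<Rightarrow> 'a::real_normed_vector \<Rightarrow> real" where
  "smooth_norm a y = a * smooth_sqrt ((norm y / a)\<^sup>2)"

lemma smooth_norm_lipschitz:
  obtains L where "\<And>a. a > 0 \<Longrightarrow> L-lipschitz_on UNIV (smooth_norm a :: 'a::real_normed_vector \<Rightarrow> real)"
proof -
  obtain L where L_lipschitz: "L-lipschitz_on {0..} (\<lambda>r. smooth_sqrt (r\<^sup>2))"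
    using smooth_sqrt_square_lipschitz .
  have "L-lipschitz_on UNIV (smooth_norm a :: 'a \<Rightarrow> real)" if a_pos: "a > 0" for a
  proof (rule lipschitz_onI)
    fix y z :: 'a
    have "dist (smooth_norm a y) (smooth_norm a z)
        = a * dist (smooth_sqrt ((norm y / a)\<^sup>2)) (smooth_sqrt ((norm z / a)\<^sup>2))"
      using a_pos by (simp add: smooth_norm_def dist_real_def abs_mult right_diff_distrib[symmetric])
    also have "\<dots> \<le> a * (L * dist (norm y / a) (norm z / a))"
      using a_pos by (intro mult_left_mono lipschitz_onD[OF L_lipschitz]) auto
    also have "\<dots> = L * \<bar>norm y - norm z\<bar>"
      using a_pos by (simp add: dist_real_def diff_divide_distrib[symmetric] abs_divide)
    also have "\<dots> \<le> L * dist y z"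
      using lipschitz_on_nonneg[OF L_lipschitz] norm_triangle_ineq3[of y z]
      by (intro mult_left_mono) (auto simp: dist_norm)
    finally show "dist (smooth_norm a y) (smooth_norm a z) \<le> L * dist y z" .
  qed (rule lipschitz_on_nonneg[OF L_lipschitz])
  then show ?thesis by (rule that)
qed

lemma continuous_on_smooth_norm:
  assumes "a > 0"
  shows "continuous_on UNIV (\<lambda>y::'a::real_normed_vector. smooth_norm a (y - x))"
proof -
  have "continuous_on UNIV (smooth_norm a :: 'a \<Rightarrow> real)"
    using smooth_norm_lipschitz lipschitz_on_continuous_on assms by metis
  then show ?thesis by (rule continuous_on_compose2) (auto intro!: continuous_intros)
qed

lemma borel_measurable_smooth_norm [measurable]:
  "(smooth_norm a :: 'a::euclidean_space \<Rightarrow> real) \<in> borel_measurable borel"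
  unfolding smooth_norm_def[abs_def] smooth_sqrt_def patch_def[abs_def] by measurable

lemma
  assumes "a > 0"
  shows norm_le_smooth_norm: "norm y \<le> smooth_norm a y"
    and smooth_norm_le_max: "smooth_norm a y \<le> max a (norm y)"
    and smooth_norm_ge: "231 / 1024 * a \<le> smooth_norm a y"
    and smooth_norm_eq_norm: "norm y \<ge> a \<Longrightarrow> smooth_norm a y = norm y"
proof -
  have sqrt_eq: "sqrt ((norm y / a)\<^sup>2) = norm y / a" using assms by simp
  show "norm y \<le> smooth_norm a y"
    using sqrt_le_smooth_sqrt[of "(norm y / a)\<^sup>2"] assms unfolding sqrt_eq
    by (simp add: smooth_norm_def field_simps)
  show "smooth_norm a y \<le> max a (norm y)"
    using mult_left_mono[OF smooth_sqrt_le[of "(norm y / a)\<^sup>2"], of a] assms unfolding sqrt_eq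
    by (simp add: smooth_norm_def max_mult_distrib_left)
  show "231 / 1024 * a \<le> smooth_norm a y"
    using mult_left_mono[OF smooth_sqrt_ge[of "(norm y / a)\<^sup>2"], of a] assms
    by (simp add: smooth_norm_def mult.commute)
  show "smooth_norm a y = norm y" if "norm y \<ge> a"
    using smooth_sqrt_eq_sqrt[of "(norm y / a)\<^sup>2"] that assms unfolding sqrt_eq
    by (simp add: smooth_norm_def)
qed

lemma
  assumes "R \<ge> 16"
  shows smooth_norm_ge_smooth_norm_1: "smooth_norm 1 y \<le> smooth_norm R y"
    and smooth_norm_diff_one_ge: "norm y \<le> R / 16 \<Longrightarrow> R / 8 \<le> smooth_norm R y - smooth_norm 1 y"
proof -
  have bounds: "norm y \<le> smooth_norm R y"
    "231 / 1024 * R \<le> smooth_norm R y" "smooth_norm 1 y \<le> max 1 (norm y)"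
    using norm_le_smooth_norm[of R y] smooth_norm_ge[of R y] smooth_norm_le_max[of 1 y] assms by auto
  then show "smooth_norm 1 y \<le> smooth_norm R y" using assms by linarith
  show "R / 8 \<le> smooth_norm R y - smooth_norm 1 y" if "norm y \<le> R / 16"
    using bounds that assms by linarith
qed

lemma tendsto_smooth_norm_small: "((\<lambda>R. smooth_norm (inverse R) y) \<longlongrightarrow> norm y) at_top"
proof (rule tendsto_sandwich[OF _ _ tendsto_const])
  show "\<forall>\<^sub>F R in at_top. norm y \<le> smooth_norm (inverse R) y"
    using eventually_gt_at_top[of 0] by eventually_elim (simp add: norm_le_smooth_norm)
  show "\<forall>\<^sub>F R in at_top. smooth_norm (inverse R) y \<le> max (inverse R) (norm y)"
    using eventually_gt_at_top[of 0] by eventually_elim (simp add: smooth_norm_le_max)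
  show "((\<lambda>R. max (inverse R) (norm y)) \<longlongrightarrow> norm y) at_top"
    using tendsto_max[OF tendsto_inverse_at_top tendsto_const[of "norm y"]] by (simp add: max_absorb2)
qed

lemma tendsto_smooth_norm_large_diff:
  fixes y z :: "'a::real_normed_vector"
  shows "((\<lambda>R. smooth_norm R y - smooth_norm R z) \<longlongrightarrow> 0) at_top"
proof -
  obtain F1 where deriv_smooth_sqrt: "\<And>s. (smooth_sqrt has_real_derivative F1 s) (at s)"
    using has_radial_laplacian_smooth_sqrt unfolding has_radial_laplacian_def by blast
  have lim: "((\<lambda>R. smooth_norm R y - R * smooth_sqrt 0) \<longlongrightarrow> 0) at_top" for y :: 'a
  proof -
    have "((\<lambda>t. smooth_sqrt ((norm y * t)\<^sup>2)) has_real_derivative F1 ((norm y * 0)\<^sup>2) * 0) (at 0)"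
      by (rule DERIV_chain'[where f="\<lambda>t. (norm y * t)\<^sup>2", OF _ deriv_smooth_sqrt])
         (auto intro!: derivative_eq_intros)
    then have "((\<lambda>t. (smooth_sqrt ((norm y * t)\<^sup>2) - smooth_sqrt 0) / t) \<longlongrightarrow> 0) (at 0)"
      by (simp add: has_field_derivative_iff)
    from filterlim_compose[OF this filterlim_inverse_at_0]
    show ?thesis by (simp add: smooth_norm_def divide_inverse algebra_simps)
  qed
  from tendsto_diff[OF lim[of y] lim[of z]] show ?thesis by simp
qed

definition triharmonic_kernel :: "real^5 \<Rightarrow> real" where
  "triharmonic_kernel = radial 0 trilap_smooth_sqrt"

lemma triharmonic_kernel_lipschitz: "\<exists>L. L-lipschitz_on UNIV triharmonic_kernel"
proof -
  define g :: "real \<Rightarrow> real" where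
    "g r = 10395/16 * (8 * (1 - r\<^sup>2) - 52 * (1 - r\<^sup>2)^2 + 65 * (1 - r\<^sup>2)^3)" for r
  have "(g has_real_derivative 10395/16 * (- 16 * r + 208 * r * (1 - r\<^sup>2) - 390 * r * (1 - r\<^sup>2)^2)) (at r)"
    for r
    unfolding g_def[abs_def] by (auto intro!: derivative_eq_intros simp: field_simps)
  then obtain L where L_lipschitz: "L-lipschitz_on {0..1} g"
    by (rule lipschitz_on_interval_if_continuous_derivative) (auto intro!: continuous_intros)
  have kernel_eq: "triharmonic_kernel z = g (min 1 (norm z))" for z
    using abs_square_le_1[of "norm z"]
    by (auto simp: triharmonic_kernel_def radial_def trilap_smooth_sqrt_def patch_def g_def min_def)
  have "L-lipschitz_on UNIV triharmonic_kernel"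
  proof (rule lipschitz_onI)
    fix z w :: "real^5"
    have "dist (triharmonic_kernel z) (triharmonic_kernel w) \<le> L * dist (min 1 (norm z)) (min 1 (norm w))"
      unfolding kernel_eq by (rule lipschitz_onD[OF L_lipschitz]) auto
    also have "\<dots> \<le> L * dist z w"
      using lipschitz_on_nonneg[OF L_lipschitz] norm_triangle_ineq3[of z w]
      by (intro mult_left_mono) (auto simp: dist_real_def dist_norm min_def)
    finally show "dist (triharmonic_kernel z) (triharmonic_kernel w) \<le> L * dist z w" .
  qed (rule lipschitz_on_nonneg[OF L_lipschitz])
  then show ?thesis ..
qed

interpretation triharmonic: averaging_kernel triharmonic_kernel
proof
  show "\<exists>L. L-lipschitz_on UNIV triharmonic_kernel" by (rule triharmonic_kernel_lipschitz)
  show "triharmonic_kernel z = 0" if "norm z \<ge> 1" for z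
    using that by (simp add: triharmonic_kernel_def radial_def trilap_smooth_sqrt_def patch_outside)
  show "triharmonic_kernel (- z) = triharmonic_kernel z" for z
    by (simp add: triharmonic_kernel_def radial_def)
qed

lemma integral_triharmonic_kernel: "(LBINT z. triharmonic_kernel z) = 64 * pi\<^sup>2"
proof -
  let ?P = "\<lambda>r::real. pi\<^sup>2 / 6 * (43659 * r^5 - 147015 * r^7 + 165165 * r^9 - 61425 * r^11)"
  let ?p = "\<lambda>r::real. 8 / 3 * pi\<^sup>2 * r^4 * (10395/16 * (8 * (1 - r\<^sup>2) - 52 * (1 - r\<^sup>2)^2 + 65 * (1 - r\<^sup>2)^3))"
  have [measurable]: "trilap_smooth_sqrt \<in> borel_measurable borel"
    unfolding trilap_smooth_sqrt_def patch_def[abs_def] by measurable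
  have "(LBINT z. triharmonic_kernel z) = (LBINT r. radial_density 5 r * trilap_smooth_sqrt (r\<^sup>2))"
    unfolding triharmonic_kernel_def radial_def
    using integral_radial[where 'a="real^5", of "\<lambda>r. trilap_smooth_sqrt (r\<^sup>2)"] by simp
  also have "\<dots> = (LBINT r. ?p r * indicator {0..1} r)"
  proof (rule Bochner_Integration.integral_cong)
    show "radial_density 5 r * trilap_smooth_sqrt (r\<^sup>2) = ?p r * indicator {0..1} r" for r
      using abs_square_le_1[of r]
      by (auto simp: radial_density_def unit_ball_vol_5 trilap_smooth_sqrt_def patch_def indicator_def)
  qed simp
  also have "\<dots> = ?P 1 - ?P 0"
  proof (rule integral_FTC_Icc_real)
    show "(?P has_real_derivative ?p r) (at r)" for r
      by (auto intro!: derivative_eq_intros) (simp add: field_simps eval_nat_numeral)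
  qed (auto intro!: continuous_intros)
  also have "\<dots> = 64 * pi\<^sup>2" by simp
  finally show ?thesis .
qed

subsection \<open>The difference formula\<close>

lemma triharmonic_identity:
  fixes u :: "real^5 \<Rightarrow> real"
  assumes Ck_u: "Ck 6 u" and scales: "0 < e" "e \<le> R"
  shows "(LBINT y. (laplacian ^^ 3) u y * (smooth_norm e (y - x) - smooth_norm R (y - x))) =
    average triharmonic_kernel u e x - average triharmonic_kernel u R x"
proof -
  have cont: "continuous_on UNIV u" using Ck_u by (rule Ck_imp_continuous_on)
  have R_pos: "R > 0" using scales by simp
  have kernel: "rescale 3 a trilap_smooth_sqrt ((norm (y - x))\<^sup>2)
      = triharmonic_kernel ((y - x) /\<^sub>R a) / a ^ DIM(real^5)" if "a > 0" for a y
    using that by (simp add: rescale_def triharmonic_kernel_def radial_def power_mult_distrib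
      power_inverse divide_inverse eval_nat_numeral mult_ac)
  have norm: "rescale 0 a smooth_sqrt ((norm (y - x))\<^sup>2) = smooth_norm a (y - x)" for a y
    by (simp add: rescale_def smooth_norm_def power_divide)
  have "(LBINT y. (laplacian ^^ 3) u y * (smooth_norm e (y - x) - smooth_norm R (y - x)))
      = (LBINT y. u y * (triharmonic_kernel ((y - x) /\<^sub>R e) / e ^ DIM(real^5))
        - u y * (triharmonic_kernel ((y - x) /\<^sub>R R) / R ^ DIM(real^5)))"
    using triharmonic_radial_identity[OF assms, of x]
    unfolding radial_def norm kernel[OF scales(1)] kernel[OF R_pos] right_diff_distrib .
  also have "\<dots> = average triharmonic_kernel u e x - average triharmonic_kernel u R x"
    using triharmonic.integrable_average_rescaled[OF _ cont]
    unfolding triharmonic.average_eq_integral[OF scales(1)] triharmonic.average_eq_integral[OF R_pos]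
    by (intro Bochner_Integration.integral_diff) (use scales R_pos in auto)
  finally show ?thesis .
qed

lemma integral_trilaplacian_cball_le:
  fixes u :: "real^5 \<Rightarrow> real"
  assumes Ck_u: "Ck 6 u" and growth: "A \<ge> 0" "\<And>x. \<bar>u x\<bar> \<le> A * (1 + norm x)"
    and nonneg: "\<And>x. (laplacian ^^ 3) u x \<ge> 0" and cont: "continuous_on UNIV ((laplacian ^^ 3) u)"
    and R_ge: "R \<ge> 16"
  shows "(LBINT y. indicator (cball 0 (R / 16)) y * (laplacian ^^ 3) u y)
    \<le> 16 * (A * (LBINT z. \<bar>triharmonic_kernel z\<bar>))"
proof -
  let ?f = "(laplacian ^^ 3) u"
  let ?P = "\<lambda>y::real^5. smooth_norm R (y - 0) - smooth_norm 1 (y - 0)"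
  have "R / 8 * (LBINT y. indicator (cball 0 (R / 16)) y * ?f y)
      = (LBINT y. R / 8 * (indicator (cball 0 (R / 16)) y * ?f y))" by simp
  also have "\<dots> \<le> (LBINT y. ?f y * ?P y)"
  proof (rule integral_mono)
    show "integrable lborel (\<lambda>y. R / 8 * (indicator (cball 0 (R / 16)) y * ?f y))"
      by (intro integrable_mult_right integrable_continuous_on_cball cont)
    show "integrable lborel (\<lambda>y. ?f y * ?P y)"
    proof (rule integrable_continuous_compact_support[where R=R])
      show "continuous_on UNIV (\<lambda>y. ?f y * ?P y)"
        using R_ge by (intro continuous_intros cont continuous_on_smooth_norm) auto
      show "?f y * ?P y = 0" if "norm y > R" for y
        using that R_ge by (simp add: smooth_norm_eq_norm)
    qed
    show "R / 8 * (indicator (cball 0 (R / 16)) y * ?f y) \<le> ?f y * ?P y" for y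
    proof (cases "norm y \<le> R / 16")
      case True
      then show ?thesis
        using mult_left_mono[OF smooth_norm_diff_one_ge[OF R_ge True] nonneg[of y]]
        by (simp add: mult.commute)
    qed (use smooth_norm_ge_smooth_norm_1[OF R_ge, of y] nonneg[of y] in simp)
  qed
  also have "\<dots> = - (LBINT y. ?f y * (smooth_norm 1 (y - 0) - smooth_norm R (y - 0)))"
    by (simp add: algebra_simps flip: Bochner_Integration.integral_minus)
  also have "\<dots> = average triharmonic_kernel u R 0 - average triharmonic_kernel u 1 0"
    using triharmonic_identity[OF Ck_u, of 1 R 0] R_ge by simp
  also have "\<dots> \<le> R / 8 * (16 * (A * (LBINT z. \<bar>triharmonic_kernel z\<bar>)))"
    using triharmonic.abs_average_diff_le[OF Ck_imp_continuous_on[OF Ck_u] growth, of R] R_ge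
    by (simp add: abs_le_iff mult_ac)
  finally show ?thesis using R_ge by simp
qed

lemma integrable_trilaplacian:
  fixes u :: "real^5 \<Rightarrow> real"
  assumes Ck_u: "Ck 6 u" and lim: "((\<lambda>x. u x / norm x) \<longlongrightarrow> \<alpha>) at_infinity"
    and nonneg: "\<And>x. (laplacian ^^ 3) u x \<ge> 0" and cont: "continuous_on UNIV ((laplacian ^^ 3) u)"
  shows "integrable lborel ((laplacian ^^ 3) u)"
proof -
  obtain A where growth: "A \<ge> 0" "\<And>x. \<bar>u x\<bar> \<le> A * (1 + norm x)"
    using continuous_linear_growth[OF Ck_imp_continuous_on[OF Ck_u] lim] by blast
  show ?thesis
  proof (rule integrable_if_integrals_cball_bounded[OF cont nonneg])
    fix n :: nat
    have "(LBINT y. indicator (cball 0 (real n)) y * (laplacian ^^ 3) u y)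
        \<le> (LBINT y. indicator (cball 0 (16 * (real n + 1) / 16)) y * (laplacian ^^ 3) u y)"
      using nonneg by (intro integral_mono integrable_continuous_on_cball cont) (auto simp: indicator_def)
    also have "\<dots> \<le> 16 * (A * (LBINT z. \<bar>triharmonic_kernel z\<bar>))"
      by (rule integral_trilaplacian_cball_le[OF Ck_u growth nonneg cont]) simp
    finally show "(LBINT y. indicator (cball 0 (real n)) y * (laplacian ^^ 3) u y)
        \<le> 16 * (A * (LBINT z. \<bar>triharmonic_kernel z\<bar>))" .
  qed
qed

lemma integrable_mult_smooth_norm_diff:
  fixes f :: "'a::euclidean_space \<Rightarrow> real"
  assumes integrable_f: "integrable lborel f" and scales: "0 < e" "e \<le> R"
  shows "integrable lborel (\<lambda>y. f y * (smooth_norm e (y - x) - smooth_norm R (y - x)))"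
proof (rule Bochner_Integration.integrable_bound[of _ "\<lambda>y. f y * R"])
  show "(\<lambda>y. f y * (smooth_norm e (y - x) - smooth_norm R (y - x))) \<in> borel_measurable lborel"
    using integrable_f by measurable
  have "\<bar>smooth_norm e w - smooth_norm R w\<bar> \<le> R" for w :: 'a
    using norm_le_smooth_norm[of e w] smooth_norm_le_max[of e w] norm_le_smooth_norm[of R w]
      smooth_norm_le_max[of R w] scales norm_ge_zero[of w] by linarith
  then show "AE y in lborel. norm (f y * (smooth_norm e (y - x) - smooth_norm R (y - x))) \<le> norm (f y * R)"
    using scales by (intro AE_I2) (auto simp: abs_mult intro!: mult_left_mono)
qed (use integrable_f in simp)

lemma tendsto_integral_smooth_norm_diff:
  fixes f :: "'a::euclidean_space \<Rightarrow> real"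
  assumes integrable_f: "integrable lborel f"
  defines "D \<equiv> \<lambda>R y x. smooth_norm (inverse R) (y - x) - smooth_norm R (y - x)"
  shows "((\<lambda>R. LBINT y. f y * (D R y x - D R y 0)) \<longlongrightarrow> (LBINT y. f y * (norm (x - y) - norm y))) at_top"
proof -
  obtain L where L_lipschitz: "\<And>a. a > 0 \<Longrightarrow> L-lipschitz_on UNIV (smooth_norm a :: 'a \<Rightarrow> real)"
    using smooth_norm_lipschitz by blast
  have [measurable]: "f \<in> borel_measurable borel" using integrable_f by auto
  show ?thesis
  proof (rule integral_dominated_convergence_at_top[where w="\<lambda>y. \<bar>f y\<bar> * (2 * (L * norm x))"])
    show "(\<lambda>y. f y * (D R y x - D R y 0)) \<in> borel_measurable lborel" for R
      unfolding D_def by measurable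
    show "integrable lborel (\<lambda>y. \<bar>f y\<bar> * (2 * (L * norm x)))" using integrable_f by simp
    show "\<forall>\<^sub>F R in at_top. AE y in lborel. norm (f y * (D R y x - D R y 0)) \<le> \<bar>f y\<bar> * (2 * (L * norm x))"
      using eventually_gt_at_top[of 0]
    proof eventually_elim
      case (elim R)
      have "\<bar>smooth_norm a (y - x) - smooth_norm a (y - 0)\<bar> \<le> L * norm x" if "a > 0" for a and y :: 'a
        using lipschitz_on_normD[OF L_lipschitz[OF that], of "y - x" "y - 0"] by simp
      from this[of R] this[of "inverse R"] elim have "\<bar>D R y x - D R y 0\<bar> \<le> 2 * (L * norm x)" for y
        unfolding D_def by (smt (verit) positive_imp_inverse_positive)
      then show ?case by (simp add: abs_mult mult_left_mono)
    qed
    have "((\<lambda>R. D R y x - D R y 0) \<longlongrightarrow> norm (x - y) - norm y) at_top" for y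
    proof -
      have "((\<lambda>R. (smooth_norm (inverse R) (y - x) - smooth_norm (inverse R) (y - 0))
          - (smooth_norm R (y - x) - smooth_norm R (y - 0))) \<longlongrightarrow> (norm (y - x) - norm (y - 0)) - 0) at_top"
        by (intro tendsto_diff[OF tendsto_diff[OF tendsto_smooth_norm_small tendsto_smooth_norm_small]
            tendsto_smooth_norm_large_diff])
      then show ?thesis by (simp add: D_def norm_minus_commute algebra_simps)
    qed
    then show "AE y in lborel. ((\<lambda>R. f y * (D R y x - D R y 0)) \<longlongrightarrow> f y * (norm (x - y) - norm y)) at_top"
      by (intro AE_I2 tendsto_mult tendsto_const)
  qed measurable
qed

lemma triharmonic_difference_formula:
  fixes u :: "real^5 \<Rightarrow> real"
  assumes Ck_u: "Ck 6 u" and lim: "((\<lambda>x. u x / norm x) \<longlongrightarrow> \<alpha>) at_infinity"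
    and integrable_f: "integrable lborel ((laplacian ^^ 3) u)"
  shows "64 * pi\<^sup>2 * (u x - u 0) = (LBINT y. (laplacian ^^ 3) u y * (norm (x - y) - norm y))"
proof (rule tendsto_unique[OF trivial_limit_at_top_linorder])
  let ?f = "(laplacian ^^ 3) u" and ?avg = "average triharmonic_kernel u"
  define D :: "real \<Rightarrow> real^5 \<Rightarrow> real^5 \<Rightarrow> real"
    where "D R y x = smooth_norm (inverse R) (y - x) - smooth_norm R (y - x)" for R y x
  note cont = Ck_imp_continuous_on[OF Ck_u]
  show "((\<lambda>R. LBINT y. ?f y * (D R y x - D R y 0)) \<longlongrightarrow> (LBINT y. ?f y * (norm (x - y) - norm y))) at_top"
    unfolding D_def by (rule tendsto_integral_smooth_norm_diff[OF integrable_f])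
  have "((\<lambda>R. (?avg (inverse R) x - ?avg (inverse R) 0) - (?avg R x - ?avg R 0))
      \<longlongrightarrow> (64 * pi\<^sup>2 * u x - 64 * pi\<^sup>2 * u 0) - 0) at_top"
    using triharmonic.tendsto_average_small[OF cont]
    by (intro tendsto_diff[OF tendsto_diff triharmonic.tendsto_average_diff[OF cont lim]])
       (auto simp: integral_triharmonic_kernel)
  moreover have "\<forall>\<^sub>F R in at_top. (?avg (inverse R) x - ?avg (inverse R) 0) - (?avg R x - ?avg R 0)
      = (LBINT y. ?f y * (D R y x - D R y 0))"
    using eventually_ge_at_top[of 1]
  proof eventually_elim
    case (elim R)
    then have scales: "0 < inverse R" "inverse R \<le> R"
      using inverse_le_1_iff[of R] by (auto intro: order_trans[of _ 1])
    have "integrable lborel (\<lambda>y. ?f y * D R y z)"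
      "(LBINT y. ?f y * D R y z) = ?avg (inverse R) z - ?avg R z" for z
      unfolding D_def using integrable_mult_smooth_norm_diff[OF integrable_f scales]
        triharmonic_identity[OF Ck_u scales] by auto
    then show ?case by (simp add: right_diff_distrib)
  qed
  ultimately show "((\<lambda>R. LBINT y. ?f y * (D R y x - D R y 0)) \<longlongrightarrow> 64 * pi\<^sup>2 * (u x - u 0)) at_top"
    by (simp add: Lim_transform_eventually right_diff_distrib)
qed

subsection \<open>The integral equation\<close>

lemma tendsto_ray_slope:
  fixes u f :: "'a::euclidean_space \<Rightarrow> real"
  assumes norm_e: "norm e = 1" and integrable_f: "integrable lborel f"
    and u_diff_eq: "\<And>x. u x - u 0 = c * (LBINT y. f y * (norm (x - y) - norm y))"
  shows "((\<lambda>t. u (t *\<^sub>R e) / t) \<longlongrightarrow> c * (LBINT y. f y)) at_top"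
proof -
  have [measurable]: "f \<in> borel_measurable borel" using integrable_f by auto
  have quotient: "((\<lambda>t. (norm (t *\<^sub>R e - y) - norm y) / t) \<longlongrightarrow> 1) at_top" for y
  proof -
    have "((\<lambda>t. (norm (t *\<^sub>R e - y) - t) - norm y) \<longlongrightarrow> - (e \<bullet> y) - norm y) at_top"
      by (intro tendsto_diff tendsto_norm_unit_ray_diff[OF norm_e] tendsto_const)
    from tendsto_add[OF real_tendsto_divide_at_top[OF this filterlim_ident] tendsto_const[of 1]]
    have "((\<lambda>t. ((norm (t *\<^sub>R e - y) - t) - norm y) / t + 1) \<longlongrightarrow> 0 + 1) at_top" .
    moreover have "\<forall>\<^sub>F t in at_top. ((norm (t *\<^sub>R e - y) - t) - norm y) / t + 1
        = (norm (t *\<^sub>R e - y) - norm y) / t"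
      using eventually_gt_at_top[of 0] by eventually_elim (simp add: field_simps)
    ultimately show ?thesis by (simp add: Lim_transform_eventually)
  qed
  have "((\<lambda>t. LBINT y. f y * ((norm (t *\<^sub>R e - y) - norm y) / t)) \<longlongrightarrow> (LBINT y. f y * 1)) at_top"
  proof (rule integral_dominated_convergence_at_top[where w="\<lambda>y. \<bar>f y\<bar>"])
    show "\<forall>\<^sub>F t in at_top. AE y in lborel. norm (f y * ((norm (t *\<^sub>R e - y) - norm y) / t)) \<le> \<bar>f y\<bar>"
      using eventually_gt_at_top[of 0]
    proof eventually_elim
      case (elim t)
      have "\<bar>(norm (t *\<^sub>R e - y) - norm y) / t\<bar> \<le> 1" for y
        using abs_norm_diff_le[of "t *\<^sub>R e" y] elim norm_e by (simp add: abs_divide)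
      from mult_left_mono[OF this] show ?case by (intro AE_I2) (simp add: abs_mult)
    qed
    show "AE y in lborel. ((\<lambda>t. f y * ((norm (t *\<^sub>R e - y) - norm y) / t)) \<longlongrightarrow> f y * 1) at_top"
      by (intro AE_I2 tendsto_mult tendsto_const quotient)
  qed (use integrable_f in auto)
  then have "((\<lambda>t. c * (LBINT y. f y * ((norm (t *\<^sub>R e - y) - norm y) / t)) + u 0 * inverse t)
      \<longlongrightarrow> c * (LBINT y. f y * 1) + u 0 * 0) at_top"
    by (intro tendsto_intros tendsto_inverse_at_top)
  moreover have "c * (LBINT y. f y * ((norm (t *\<^sub>R e - y) - norm y) / t)) + u 0 * inverse t = u (t *\<^sub>R e) / t"
    for t
    using u_diff_eq[of "t *\<^sub>R e"] by (simp add: divide_inverse flip: distrib_right mult.assoc)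
  ultimately show ?thesis by simp
qed

lemma slope_at_infinity:
  fixes u f :: "'a::euclidean_space \<Rightarrow> real"
  assumes lim: "((\<lambda>x. u x / norm x) \<longlongrightarrow> \<alpha>) at_infinity"
    and integrable_f: "integrable lborel f"
    and u_diff_eq: "\<And>x. u x - u 0 = c * (LBINT y. f y * (norm (x - y) - norm y))"
  shows "\<alpha> = c * (LBINT y. f y)"
proof -
  obtain e :: 'a where norm_e: "norm e = 1" using norm_Basis nonempty_Basis by blast
  have "filterlim (\<lambda>t. t *\<^sub>R e) at_infinity at_top"
    using norm_e by (simp add: filterlim_at_infinity_conv_norm_at_top filterlim_abs_real)
  from filterlim_compose[OF lim this] have "((\<lambda>t. u (t *\<^sub>R e) / norm (t *\<^sub>R e)) \<longlongrightarrow> \<alpha>) at_top" .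
  moreover have "\<forall>\<^sub>F t in at_top. u (t *\<^sub>R e) / norm (t *\<^sub>R e) = u (t *\<^sub>R e) / t"
    using eventually_gt_at_top[of 0] by eventually_elim (simp add: norm_e)
  ultimately have "((\<lambda>t. u (t *\<^sub>R e) / t) \<longlongrightarrow> \<alpha>) at_top" by (rule Lim_transform_eventually)
  then show ?thesis
    using tendsto_ray_slope[OF norm_e integrable_f u_diff_eq]
    by (rule tendsto_unique[OF trivial_limit_at_top_linorder])
qed

lemma linear_lower_bound:
  fixes u :: "'a::euclidean_space \<Rightarrow> real"
  assumes cont: "continuous_on UNIV u" and pos: "\<And>x. u x > 0" and \<alpha>_pos: "\<alpha> > 0"
    and lim: "((\<lambda>x. u x / norm x) \<longlongrightarrow> \<alpha>) at_infinity"
  shows "\<exists>\<kappa>>0. \<forall>x. \<kappa> * (1 + norm x) \<le> u x"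
proof -
  have "\<forall>\<^sub>F x in at_infinity. u x / norm x > \<alpha> / 2" using lim \<alpha>_pos by (intro order_tendstoD(1)) auto
  then obtain b where outside: "\<And>x. norm x \<ge> b \<Longrightarrow> u x / norm x > \<alpha> / 2"
    by (auto simp: eventually_at_infinity)
  have nonzero: "1 + norm x \<noteq> 0" for x :: 'a by (smt (verit) norm_ge_zero)
  have "continuous_on (cball 0 (max 1 b)) (\<lambda>x. u x / (1 + norm x))"
    using nonzero by (intro continuous_intros continuous_on_subset[OF cont]) auto
  then have "\<exists>x0\<in>cball 0 (max 1 b). \<forall>x\<in>cball 0 (max 1 b). u x0 / (1 + norm x0) \<le> u x / (1 + norm x)"
    by (intro continuous_attains_inf) auto
  then obtain x0 where inside: "\<And>x. norm x \<le> max 1 b \<Longrightarrow> u x0 / (1 + norm x0) \<le> u x / (1 + norm x)"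
    by (metis mem_cball_0)
  define \<kappa> where "\<kappa> = min (u x0 / (1 + norm x0)) (\<alpha> / 4)"
  have "\<kappa> > 0" using pos[of x0] \<alpha>_pos by (simp add: \<kappa>_def add_pos_nonneg)
  moreover have "\<kappa> * (1 + norm x) \<le> u x" for x
  proof (cases "norm x \<le> max 1 b")
    case True
    then have "\<kappa> \<le> u x / (1 + norm x)" using inside[OF True] by (simp add: \<kappa>_def)
    then show ?thesis by (simp add: pos_le_divide_eq add_pos_nonneg)
  next
    case False
    have "\<kappa> \<le> \<alpha> / 4" unfolding \<kappa>_def by (rule min.cobounded2)
    then have "\<kappa> * (1 + norm x) \<le> \<alpha> / 4 * (2 * norm x)"
      using \<alpha>_pos False by (intro mult_mono) auto
    also have "\<dots> \<le> u x"
    proof -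
      have "norm x > 0" "norm x > b" using False by auto
      then have "\<alpha> / 2 * norm x < u x" using outside[of x] pos_less_divide_eq[of "norm x"] by simp
      then show ?thesis by simp
    qed
    finally show ?thesis .
  qed
  ultimately show ?thesis by blast
qed

lemma abs_powr_diff_le:
  fixes a b m p :: real
  assumes m_pos: "m > 0" and a_ge: "a \<ge> m" and b_ge: "b \<ge> m" and p_le: "p \<le> 1"
  shows "\<bar>a powr p - b powr p\<bar> \<le> \<bar>p\<bar> * m powr (p - 1) * \<bar>a - b\<bar>"
proof -
  have "norm (a powr p - b powr p) \<le> (\<bar>p\<bar> * m powr (p - 1)) * norm (a - b)"
  proof (rule field_differentiable_bound[where S="{m..}" and f'="\<lambda>z. p * z powr (p - 1)"])
    show "((\<lambda>z. z powr p) has_real_derivative p * z powr (p - 1)) (at z within {m..})" if "z \<in> {m..}" for z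
      using that m_pos has_real_derivative_powr[of z p] by (auto intro: has_field_derivative_at_within)
    show "norm (p * z powr (p - 1)) \<le> \<bar>p\<bar> * m powr (p - 1)" if "z \<in> {m..}" for z
      using that m_pos p_le powr_mono2'[of "p - 1" m z] by (simp add: abs_mult mult_left_mono)
  qed (use m_pos a_ge b_ge in auto)
  then show ?thesis by simp
qed

locale linear_growth =
  fixes u :: "'a::euclidean_space \<Rightarrow> real" and grad :: "'a \<Rightarrow> 'a" and q :: real
  assumes q_gt: "q > DIM('a) + 1"
    and lower: "\<exists>\<kappa>>0. \<forall>x. \<kappa> * (1 + norm x) \<le> u x"
    and has_derivative: "\<And>x. (u has_derivative (\<lambda>v. grad x \<bullet> v)) (at x)"
    and continuous_on_grad: "continuous_on UNIV grad"
begin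

definition source where "source y = u y powr (-q)"

lemma pos: "u x > 0"
  using lower by (smt (verit) mult_pos_pos norm_ge_zero)

lemma source_pos: "source x > 0"
  using pos[of x] by (simp add: source_def)

lemma u_mult_source: "u x * source x = u x powr (1 - q)"
  using powr_mult_base[of "u x" "-q"] pos[of x] by (simp add: source_def)

lemma continuous_on_u: "continuous_on UNIV u"
  using has_derivative by (intro has_derivative_continuous_on) auto

lemma continuous_on_source: "continuous_on UNIV source"
  unfolding source_def[abs_def] using pos by (intro continuous_intros continuous_on_u) (metis less_irrefl)

lemma borel_measurable_u [measurable]: "u \<in> borel_measurable borel"
  using continuous_on_u by (rule borel_measurable_continuous_onI)

lemma borel_measurable_source [measurable]: "source \<in> borel_measurable borel"
  using continuous_on_source by (rule borel_measurable_continuous_onI)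

lemma borel_measurable_grad [measurable]: "grad \<in> borel_measurable borel"
  using continuous_on_grad by (rule borel_measurable_continuous_onI)

lemma has_real_derivative_along_curve:
  assumes "(p has_vector_derivative p') (at t)"
  shows "((\<lambda>t. u (p t)) has_real_derivative grad (p t) \<bullet> p') (at t)"
  using has_derivative_compose[OF assms[unfolded has_vector_derivative_def] has_derivative]
  by (rule has_derivative_imp_has_field_derivative) simp

lemma has_real_derivative_along_line:
  "((\<lambda>t. u (x + t *\<^sub>R v)) has_real_derivative grad x \<bullet> v) (at 0)"
proof -
  have "((\<lambda>t. x + t *\<^sub>R v) has_vector_derivative v) (at 0)"
    by (auto intro!: derivative_eq_intros)
  from has_real_derivative_along_curve[OF this] show ?thesis by simp
qed

lemma integrable_u_powr:
  fixes p :: real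
  assumes p_gt: "p > DIM('a)"
  shows "integrable lborel (\<lambda>x. u x powr (-p))"
proof -
  obtain \<kappa> where \<kappa>_pos: "\<kappa> > 0" and u_ge: "\<And>x. \<kappa> * (1 + norm x) \<le> u x" using lower by blast
  show ?thesis
  proof (rule Bochner_Integration.integrable_bound)
    show "integrable lborel (\<lambda>x::'a. \<kappa> powr (-p) * (1 + norm x) powr (-p))"
      using integrable_one_plus_norm_powr[OF p_gt] by simp
    have "u x powr (-p) \<le> (\<kappa> * (1 + norm x)) powr (-p)" for x
      using \<kappa>_pos u_ge p_gt by (intro powr_mono2') (auto simp: add_pos_nonneg)
    then show "AE x in lborel. norm (u x powr (-p)) \<le> norm (\<kappa> powr (-p) * (1 + norm x) powr (-p))"
      using \<kappa>_pos by (simp add: powr_mult)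
  qed measurable
qed

lemma integrable_u_powr_1_minus_q: "integrable lborel (\<lambda>x. u x powr (1 - q))"
  using integrable_u_powr[of "q - 1"] q_gt by simp

lemma integrable_source: "integrable lborel source"
  using integrable_u_powr[of q] q_gt by (simp add: source_def[abs_def])

lemma integrable_norm_source: "integrable lborel (\<lambda>y. norm y * source y)"
proof -
  obtain \<kappa> where \<kappa>_pos: "\<kappa> > 0" and u_ge: "\<And>x. \<kappa> * (1 + norm x) \<le> u x" using lower by blast
  show ?thesis
  proof (rule Bochner_Integration.integrable_bound)
    show "integrable lborel (\<lambda>y. inverse \<kappa> * u y powr (1 - q))"
      using integrable_u_powr_1_minus_q by (rule integrable_mult_right)
    have "norm y * source y \<le> inverse \<kappa> * u y powr (1 - q)" for y
    proof -
      have "norm y \<le> inverse \<kappa> * u y" using \<kappa>_pos u_ge[of y] by (simp add: field_simps)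
      from mult_right_mono[OF this, of "source y"] source_pos[of y] show ?thesis
        by (simp add: mult.assoc u_mult_source)
    qed
    then show "AE y in lborel. norm (norm y * source y) \<le> norm (inverse \<kappa> * u y powr (1 - q))"
      using \<kappa>_pos less_imp_le[OF source_pos] by (simp add: abs_mult)
  qed measurable
qed

lemma integrable_potential: "integrable lborel (\<lambda>y. norm (x - y) * source y)"
proof (rule Bochner_Integration.integrable_bound)
  show "integrable lborel (\<lambda>y. norm x * source y + norm y * source y)"
    using integrable_norm_source integrable_source by auto
  have "norm (x - y) * source y \<le> (norm x + norm y) * source y" for y
    using norm_triangle_ineq4[of x y] source_pos[of y] by (intro mult_right_mono) auto
  then show "AE y in lborel. norm (norm (x - y) * source y) \<le> norm (norm x * source y + norm y * source y)"
    using less_imp_le[OF source_pos] by (intro AE_I2) (simp add: distrib_right abs_mult)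
qed measurable

lemma integral_source_pos: "(LBINT y. source y) > 0"
  using integral_pos_lborel[OF integrable_source, of UNIV] source_pos by (simp add: less_imp_le)

end

locale integral_equation = linear_growth u grad q
  for u :: "'a::euclidean_space \<Rightarrow> real" and grad and q +
  fixes c \<gamma> :: real
  assumes c_pos: "c > 0"
    and u_eq: "\<And>x. u x = c * (LBINT y. norm (x - y) * source y) + \<gamma>"
begin

lemma u_diff_eq: "u x - u z = c * (LBINT y. source y * (norm (x - y) - norm (z - y)))"
  using u_eq[of x] u_eq[of z] integrable_potential[of x] integrable_potential[of z]
  by (simp add: mult.commute[of _ "source _"] right_diff_distrib)

definition slope where "slope = c * (LBINT y. source y)"

lemma slope_pos: "slope > 0"
  using c_pos integral_source_pos by (simp add: slope_def)

lemma tendsto_ray: "norm e = 1 \<Longrightarrow> ((\<lambda>t. u (t *\<^sub>R e) / t) \<longlongrightarrow> slope) at_top"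
  unfolding slope_def
  by (rule tendsto_ray_slope[OF _ integrable_source]) (use u_diff_eq[of _ 0] in simp_all)

lemma lipschitz: "slope-lipschitz_on UNIV u"
proof (rule lipschitz_onI)
  fix x z :: 'a
  have integrable: "integrable lborel (\<lambda>y. source y * (norm (x - y) - norm (z - y)))"
    using integrable_potential[of x] integrable_potential[of z]
    by (simp add: mult.commute[of _ "source _"] right_diff_distrib)
  have "\<bar>LBINT y. source y * (norm (x - y) - norm (z - y))\<bar> \<le> (LBINT y. source y * dist x z)"
  proof (rule integral_abs_bound[THEN order_trans], rule integral_mono)
    show "\<bar>source y * (norm (x - y) - norm (z - y))\<bar> \<le> source y * dist x z" for y
      using norm_triangle_ineq3[of "x - y" "z - y"] source_pos[of y]
      by (simp add: abs_mult dist_norm mult_left_mono)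
  qed (use integrable integrable_source in auto)
  then show "dist (u x) (u z) \<le> slope * dist x z"
    using c_pos by (simp add: dist_real_def u_diff_eq slope_def abs_mult mult_ac)
qed (use slope_pos in simp)

lemma abs_u_diff_le: "\<bar>u x - u z\<bar> \<le> slope * norm (x - z)"
  using lipschitz_on_normD[OF lipschitz, of x z] by simp

subsection \<open>The Pohozaev identity\<close>

lemma inner_grad_eq: "grad x \<bullet> v = c * (LBINT y. (v \<bullet> sgn (x - y)) * source y)"
proof -
  have "((\<lambda>t. LBINT y. norm (x + t *\<^sub>R v - y) * source y) has_real_derivative
      (LBINT y. (v \<bullet> sgn (x - y)) * source y)) (at 0)"
  proof (rule has_real_derivative_integral_dominated[OF zero_less_one, where w="\<lambda>y. norm v * source y"])
    show "integrable lborel (\<lambda>y. norm (x + t *\<^sub>R v - y) * source y)" for t by (rule integrable_potential)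
    show "integrable lborel (\<lambda>y. norm v * source y)" using integrable_source by simp
    show "(\<lambda>y. (v \<bullet> sgn (x - y)) * source y) \<in> borel_measurable lborel"
      by (simp add: sgn_div_norm)
    show "\<bar>norm (x + t *\<^sub>R v - y) * source y - norm (x + 0 *\<^sub>R v - y) * source y\<bar>
        \<le> \<bar>t - 0\<bar> * (norm v * source y)" for t y
      using mult_right_mono[OF norm_triangle_ineq3[of "x + t *\<^sub>R v - y" "x - y"], of "source y"] source_pos[of y]
      by (simp add: abs_mult mult.assoc flip: left_diff_distrib)
    have "AE y in lborel. y \<noteq> x" by (rule AE_lborel_singleton)
    then show "AE y in lborel. ((\<lambda>t. norm (x + t *\<^sub>R v - y) * source y) has_real_derivative
        (v \<bullet> sgn (x - y)) * source y) (at 0)"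
    proof eventually_elim
      case (elim y)
      then show ?case
        using DERIV_cmult_right[OF has_real_derivative_norm_line[of "x - y" v]] by (simp add: algebra_simps)
    qed
  qed
  then have "((\<lambda>t. c * (LBINT y. norm (x + t *\<^sub>R v - y) * source y) + \<gamma>) has_real_derivative
      c * (LBINT y. (v \<bullet> sgn (x - y)) * source y)) (at 0)"
    by (auto intro!: derivative_eq_intros)
  moreover have "(\<lambda>t. u (x + t *\<^sub>R v)) = (\<lambda>t. c * (LBINT y. norm (x + t *\<^sub>R v - y) * source y) + \<gamma>)"
    by (rule ext) (rule u_eq)
  ultimately have "((\<lambda>t. u (x + t *\<^sub>R v)) has_real_derivative c * (LBINT y. (v \<bullet> sgn (x - y)) * source y)) (at 0)"
    by simp
  with has_real_derivative_along_line show ?thesis by (rule DERIV_unique)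
qed

lemma dilation_difference_bound:
  obtains C where "\<And>t x. \<bar>t\<bar> < 1 / 2 \<Longrightarrow>
    \<bar>u (x + t *\<^sub>R x) powr (1 - q) - u x powr (1 - q)\<bar> \<le> \<bar>t\<bar> * (C * (1 + norm x) powr (1 - q))"
proof -
  obtain \<kappa> where \<kappa>_pos: "\<kappa> > 0" and u_ge: "\<And>x. \<kappa> * (1 + norm x) \<le> u x" using lower by blast
  show ?thesis
  proof (rule that)
    fix t :: real and x :: 'a assume t_small: "\<bar>t\<bar> < 1 / 2"
    let ?m = "\<kappa> / 2 * (1 + norm x)"
    have m_pos: "?m > 0" using \<kappa>_pos by (simp add: add_pos_nonneg)
    have "1 / 2 * norm x \<le> \<bar>1 + t\<bar> * norm x" using t_small by (intro mult_right_mono) auto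
    also have "\<dots> = norm (x + t *\<^sub>R x)" by (simp flip: norm_scaleR add: scaleR_add_left)
    finally have "(1 + norm x) / 2 \<le> 1 + norm (x + t *\<^sub>R x)" by simp
    from mult_left_mono[OF this, of \<kappa>] \<kappa>_pos have "?m \<le> \<kappa> * (1 + norm (x + t *\<^sub>R x))" by simp
    also have "\<dots> \<le> u (x + t *\<^sub>R x)" by (rule u_ge)
    finally have m_le_dilated: "?m \<le> u (x + t *\<^sub>R x)" .
    have "?m \<le> \<kappa> * (1 + norm x)" using \<kappa>_pos by (intro mult_right_mono) auto
    also have "\<dots> \<le> u x" by (rule u_ge)
    finally have m_le: "?m \<le> u x" .
    have "\<bar>u (x + t *\<^sub>R x) - u x\<bar> \<le> slope * (\<bar>t\<bar> * norm x)"
      using abs_u_diff_le[of "x + t *\<^sub>R x" x] by simp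
    also have "\<dots> \<le> slope * (\<bar>t\<bar> * (1 + norm x))"
      using slope_pos by (intro mult_left_mono) auto
    finally have u_diff: "\<bar>u (x + t *\<^sub>R x) - u x\<bar> \<le> slope * (\<bar>t\<bar> * (1 + norm x))" .
    have m_powr: "?m powr (1 - q - 1) = (\<kappa> / 2) powr (-q) * (1 + norm x) powr (-q)"
      using powr_mult[of "\<kappa> / 2" "1 + norm x" "-q"] \<kappa>_pos by simp
    have "\<bar>u (x + t *\<^sub>R x) powr (1 - q) - u x powr (1 - q)\<bar>
        \<le> \<bar>1 - q\<bar> * ?m powr (1 - q - 1) * \<bar>u (x + t *\<^sub>R x) - u x\<bar>"
      using m_pos m_le_dilated m_le q_gt by (intro abs_powr_diff_le) auto
    also have "\<dots> \<le> \<bar>1 - q\<bar> * ?m powr (1 - q - 1) * (slope * (\<bar>t\<bar> * (1 + norm x)))"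
      using u_diff by (intro mult_left_mono) auto
    also have "\<dots> = \<bar>t\<bar> * (\<bar>1 - q\<bar> * (\<kappa> / 2) powr (-q) * slope * ((1 + norm x) * (1 + norm x) powr (-q)))"
      unfolding m_powr by (simp add: mult_ac)
    also have "(1 + norm x) * (1 + norm x) powr (-q) = (1 + norm x) powr (1 - q)"
      using powr_mult_base[of "1 + norm x" "-q"] by (simp add: add_nonneg_pos)
    finally show "\<bar>u (x + t *\<^sub>R x) powr (1 - q) - u x powr (1 - q)\<bar>
        \<le> \<bar>t\<bar> * (\<bar>1 - q\<bar> * (\<kappa> / 2) powr (-q) * slope * (1 + norm x) powr (1 - q))" .
  qed
qed

lemma dilation_identity:
  "(q - 1) * (LBINT x. source x * (grad x \<bullet> x)) = DIM('a) * (LBINT x. u x powr (1 - q))"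
proof -
  define W where "W x = u x powr (1 - q)" for x
  have integrable_W: "integrable lborel W"
    using integrable_u_powr_1_minus_q by (simp add: W_def[abs_def])
  obtain C where W_diff_le:
    "\<And>t x. \<bar>t\<bar> < 1 / 2 \<Longrightarrow> \<bar>W (x + t *\<^sub>R x) - W x\<bar> \<le> \<bar>t\<bar> * (C * (1 + norm x) powr (1 - q))"
    unfolding W_def using dilation_difference_bound by blast
  have dilate: "x + t *\<^sub>R x = 0 + (1 + t) *\<^sub>R x" for t and x :: 'a by (simp add: scaleR_add_left)
  have "((\<lambda>t. LBINT x. W (x + t *\<^sub>R x)) has_real_derivative (LBINT x. (1 - q) * (source x * (grad x \<bullet> x)))) (at 0)"
  proof (rule has_real_derivative_integral_dominated[of "1 / 2" _ _ _ "\<lambda>x. C * (1 + norm x) powr (1 - q)"])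
    show "integrable lborel (\<lambda>x. W (x + t *\<^sub>R x))" if "dist 0 t < 1 / 2" for t
      unfolding dilate using integrable_W that by (intro integrable_lborel_affine) auto
    show "integrable lborel (\<lambda>x::'a. C * (1 + norm x) powr (1 - q))"
      using integrable_one_plus_norm_powr[where 'a='a, of "q - 1"] q_gt by simp
    have "((\<lambda>t. W (x + t *\<^sub>R x)) has_real_derivative (1 - q) * u x powr (1 - q - 1) * (grad x \<bullet> x)) (at 0)"
      for x
      unfolding W_def
      by (rule DERIV_chain'[OF has_real_derivative_along_line])
         (use has_real_derivative_powr[OF pos[of x], of "1 - q"] in simp)
    then show "AE x in lborel. ((\<lambda>t. W (x + t *\<^sub>R x))
        has_real_derivative (1 - q) * (source x * (grad x \<bullet> x))) (at 0)"
      by (simp add: source_def mult.assoc)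
    show "\<bar>W (x + t *\<^sub>R x) - W (x + 0 *\<^sub>R x)\<bar> \<le> \<bar>t - 0\<bar> * (C * (1 + norm x) powr (1 - q))"
      if "dist 0 t < 1 / 2" for t x
      using W_diff_le[of t x] that by simp
  qed auto
  moreover have "((\<lambda>t. LBINT x. W (x + t *\<^sub>R x)) has_real_derivative - DIM('a) * (LBINT x. W x)) (at 0)"
  proof (rule has_field_derivative_transform_within_open)
    show "((\<lambda>t. inverse ((1 + t) ^ DIM('a)) * (LBINT x. W x))
        has_real_derivative - DIM('a) * (LBINT x. W x)) (at 0)"
      by (auto intro!: derivative_eq_intros)
    show "inverse ((1 + t) ^ DIM('a)) * (LBINT x. W x) = (LBINT x. W (x + t *\<^sub>R x))" if "t \<in> {-1<..}" for t
      unfolding dilate using integral_lborel_affine[of "1 + t" W 0] that by (simp add: field_simps)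
  qed auto
  ultimately have "(LBINT x. (1 - q) * (source x * (grad x \<bullet> x))) = - DIM('a) * (LBINT x. W x)"
    by (rule DERIV_unique)
  then show ?thesis unfolding integral_mult_right_zero by (simp add: W_def algebra_simps)
qed

lemma integrable_interaction:
  "integrable (lborel \<Otimes>\<^sub>M lborel) (\<lambda>(x, y). source x * ((x \<bullet> sgn (x - y)) * source y))"
proof (rule Bochner_Integration.integrable_bound)
  show "integrable (lborel \<Otimes>\<^sub>M lborel) (\<lambda>(x, y). norm x * source x * source y)"
  proof (rule lborel_pair.Fubini_integrable)
    show "integrable lborel (\<lambda>x. LBINT y. norm (case (x, y) of (x, y) \<Rightarrow> norm x * source x * source y))"
      using integrable_norm_source less_imp_le[OF source_pos] by (simp add: abs_mult)
  qed (use integrable_source in auto)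
  show "(\<lambda>(x, y). source x * ((x \<bullet> sgn (x - y)) * source y)) \<in> borel_measurable (lborel \<Otimes>\<^sub>M lborel)"
    unfolding sgn_div_norm by measurable
  have "norm (source x * ((x \<bullet> sgn (x - y)) * source y)) \<le> norm (norm x * source x * source y)" for x y :: 'a
  proof -
    have "\<bar>x \<bullet> sgn (x - y)\<bar> \<le> norm x * norm (sgn (x - y))" by (rule Cauchy_Schwarz_ineq2)
    also have "\<dots> \<le> norm x" by (simp add: norm_sgn)
    finally have "source x * source y * \<bar>x \<bullet> sgn (x - y)\<bar> \<le> source x * source y * norm x"
      using source_pos[of x] source_pos[of y] by (intro mult_left_mono) auto
    then show ?thesis using source_pos[of x] source_pos[of y] by (simp add: abs_mult mult_ac)
  qed
  then show "AE z in lborel \<Otimes>\<^sub>M lborel. norm (case z of (x, y) \<Rightarrow> source x * ((x \<bullet> sgn (x - y)) * source y))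
      \<le> norm (case z of (x, y) \<Rightarrow> norm x * source x * source y)"
    by (intro AE_I2) auto
qed

lemma integral_source_inner_grad:
  "2 * (LBINT x. source x * (grad x \<bullet> x)) = (LBINT x. u x powr (1 - q)) - \<gamma> * (LBINT x. source x)"
proof -
  define K where "K x y = source x * ((x \<bullet> sgn (x - y)) * source y)" for x y
  have K_symmetrized: "K x y + K y x = source x * (norm (x - y) * source y)" for x y
  proof -
    have "sgn (y - x) = - sgn (x - y)" using sgn_minus[of "x - y"] by simp
    then have "K x y + K y x = source x * source y * ((x - y) \<bullet> sgn (x - y))"
      by (simp add: K_def inner_diff_left algebra_simps)
    also have "(x - y) \<bullet> sgn (x - y) = norm (x - y)"
      by (cases "x = y") (auto simp: sgn_div_norm power2_norm_eq_inner[symmetric] power2_eq_square)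
    finally show ?thesis by simp
  qed
  have "source x * (grad x \<bullet> x) = c * (LBINT y. K x y)" for x
    by (simp add: inner_grad_eq K_def mult.left_commute[of _ c])
  then have "2 * (LBINT x. source x * (grad x \<bullet> x)) = c * (2 * (LBINT x. LBINT y. K x y))" by simp
  also have "2 * (LBINT x. LBINT y. K x y) = (LBINT x. LBINT y. K x y + K y x)"
    using integrable_interaction by (intro integral_symmetrize) (simp add: K_def)
  also have "c * \<dots> = (LBINT x. u x powr (1 - q) - \<gamma> * source x)"
  proof -
    have "c * (source x * (LBINT y. norm (x - y) * source y)) = u x powr (1 - q) - \<gamma> * source x" for x
      using u_eq[of x] u_mult_source[of x, symmetric] by (simp add: algebra_simps)
    then show ?thesis by (simp add: K_symmetrized flip: integral_mult_right_zero)
  qed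
  also have "\<dots> = (LBINT x. u x powr (1 - q)) - \<gamma> * (LBINT x. source x)"
    using integrable_u_powr_1_minus_q integrable_source by simp
  finally show ?thesis .
qed

lemma Pohozaev:
  "(q - 1) * \<gamma> * (LBINT x. source x) = (q - (2 * DIM('a) + 1)) * (LBINT x. u x powr (1 - q))"
proof -
  have "(q - 1) * ((LBINT x. u x powr (1 - q)) - \<gamma> * (LBINT x. source x))
      = 2 * DIM('a) * (LBINT x. u x powr (1 - q))"
    using dilation_identity unfolding integral_source_inner_grad[symmetric] by simp
  then show ?thesis by (simp add: algebra_simps)
qed

lemma sgn_\<gamma>: "sgn \<gamma> = sgn (q - (2 * DIM('a) + 1))"
proof -
  have "(LBINT x. u x powr (1 - q)) > 0"
    using integral_pos_lborel[OF integrable_u_powr_1_minus_q, of UNIV] pos less_imp_neq[OF pos] by simp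
  then have "sgn ((q - 1) * \<gamma> * (LBINT x. source x)) = sgn (q - (2 * DIM('a) + 1))"
    unfolding Pohozaev sgn_mult by simp
  then show ?thesis using q_gt integral_source_pos by (simp add: sgn_mult)
qed

end

lemma triharmonic_integral_equation:
  fixes u :: "real^5 \<Rightarrow> real"
  assumes q_gt: "q > 6" and Ck_u: "Ck 6 u" and pos: "\<And>x. u x > 0"
    and trilaplacian_u: "\<And>x. (laplacian ^^ 3) u x = u x powr (-q)"
    and lim: "((\<lambda>x. u x / norm x) \<longlongrightarrow> \<alpha>) at_infinity"
  shows "\<exists>\<gamma>. integral_equation u (gradient u) q (1 / (64 * pi\<^sup>2)) \<gamma>"
proof -
  define f where "f x = u x powr (-q)" for x
  define c where "c = 1 / (64 * pi\<^sup>2)"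
  have c_pos: "c > 0" by (simp add: c_def)
  have f_pos: "f x > 0" for x using pos[of x] by (simp add: f_def)
  have trilaplacian_eq: "(laplacian ^^ 3) u = f" using trilaplacian_u by (auto simp: f_def)
  have cont: "continuous_on UNIV u" using Ck_u by (rule Ck_imp_continuous_on)
  then have cont_f: "continuous_on UNIV f"
    unfolding f_def[abs_def] using less_imp_neq[OF pos] by (intro continuous_intros) auto
  have integrable_f: "integrable lborel f"
    using integrable_trilaplacian[OF Ck_u lim] f_pos cont_f by (simp add: trilaplacian_eq less_imp_le)
  have u_diff_eq: "u x - u 0 = c * (LBINT y. f y * (norm (x - y) - norm y))" for x
    using triharmonic_difference_formula[OF Ck_u lim, of x] integrable_f
    by (simp add: trilaplacian_eq c_def field_simps)
  have "(LBINT y. f y) > 0"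
    using integral_pos_lborel[OF integrable_f, of UNIV] f_pos by (simp add: less_imp_le)
  then have "\<alpha> > 0" using slope_at_infinity[OF lim integrable_f u_diff_eq] c_pos by simp
  have Ck_Suc_u: "Ck (Suc 5) u" using Ck_u by (simp add: eval_nat_numeral)
  interpret linear_growth u "gradient u" q
  proof
    show "\<exists>\<kappa>>0. \<forall>x. \<kappa> * (1 + norm x) \<le> u x"
      using cont pos \<open>\<alpha> > 0\<close> lim by (rule linear_lower_bound)
    show "(u has_derivative (\<lambda>v. gradient u x \<bullet> v)) (at x)" for x
      using Ck_Suc_u by (rule has_derivative_gradient)
    show "continuous_on UNIV (gradient u)" using Ck_Suc_u by (rule continuous_on_gradient)
  qed (use q_gt in simp)
  have "source = f" by (simp add: source_def[abs_def] f_def[abs_def])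
  show ?thesis
    unfolding c_def[symmetric]
  proof (intro exI, unfold_locales)
    show "u x = c * (LBINT y. norm (x - y) * source y) + (u 0 - c * (LBINT y. norm (0 - y) * source y))" for x
      using u_diff_eq[of x] integrable_potential[of x] integrable_potential[of 0]
      by (simp add: \<open>source = f\<close> mult.commute[of "f _"] left_diff_distrib right_diff_distrib)
  qed (rule c_pos)
qed

subsection \<open>Inversions\<close>

definition inversion :: "real \<Rightarrow> 'a::real_inner \<Rightarrow> 'a" where
  "inversion l x = (l\<^sup>2 / (norm x)\<^sup>2) *\<^sub>R x"

lemma borel_measurable_inversion [measurable]:
  "(inversion l :: 'a::euclidean_space \<Rightarrow> 'a) \<in> borel_measurable borel"
  unfolding inversion_def[abs_def] by measurable

lemma norm_inversion: "norm (inversion l x) = l\<^sup>2 / norm x"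
  by (cases "x = 0") (auto simp: inversion_def power2_eq_square)

lemma inversion_eq_0_iff [simp]: "inversion l x = 0 \<longleftrightarrow> l = 0 \<or> x = 0"
  by (simp add: inversion_def)

lemma inversion_inversion: "l \<noteq> 0 \<Longrightarrow> inversion l (inversion l x) = x"
  using norm_inversion[of l x]
  by (cases "x = 0") (simp_all add: inversion_def[of l "inversion l x"],
    simp add: inversion_def power_divide field_simps power2_eq_square)

lemma norm_inversion_diff:
  "norm (inversion k x - inversion l x) = \<bar>k\<^sup>2 - l\<^sup>2\<bar> / norm x"
proof -
  have "inversion k x - inversion l x = ((k\<^sup>2 - l\<^sup>2) / (norm x)\<^sup>2) *\<^sub>R x"
    by (simp add: inversion_def diff_divide_distrib scaleR_diff_left)
  then show ?thesis by (simp add: power2_eq_square)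
qed

definition reflected_dist :: "real \<Rightarrow> 'a::real_inner \<Rightarrow> 'a \<Rightarrow> real" where
  "reflected_dist l x z = norm z / l * norm (x - inversion l z)"

lemma norm_diff_square: "(norm (x - z))\<^sup>2 = (norm x)\<^sup>2 - 2 * (x \<bullet> z) + (norm z)\<^sup>2"
  for x z :: "'a::real_inner"
  unfolding power2_norm_eq_inner by (simp add: inner_diff_left inner_diff_right inner_commute)

lemma reflected_dist_square:
  assumes "l > 0" "z \<noteq> 0"
  shows "(reflected_dist l x z)\<^sup>2 = (norm x)\<^sup>2 * (norm z)\<^sup>2 / l\<^sup>2 - 2 * (x \<bullet> z) + l\<^sup>2"
proof -
  have "(norm (x - inversion l z))\<^sup>2 = (norm x)\<^sup>2 - 2 * (l\<^sup>2 / (norm z)\<^sup>2 * (x \<bullet> z)) + (l\<^sup>2 / norm z)\<^sup>2"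
    unfolding norm_diff_square norm_inversion by (simp add: inversion_def)
  then show ?thesis
    using assms by (simp add: reflected_dist_def power_mult_distrib power_divide field_simps power2_eq_square)
qed

lemma reflected_dist_commute:
  assumes "l > 0" "x \<noteq> 0" "z \<noteq> 0"
  shows "reflected_dist l z x = reflected_dist l x z"
proof (rule power2_eq_imp_eq)
  show "(reflected_dist l z x)\<^sup>2 = (reflected_dist l x z)\<^sup>2"
    using assms by (simp add: reflected_dist_square inner_commute mult.commute)
qed (use assms in \<open>auto simp: reflected_dist_def\<close>)

lemma reflected_dist_inversion:
  assumes "l > 0" "x \<noteq> 0" "z \<noteq> 0"
  shows "norm x / l * norm (inversion l x - z) = reflected_dist l x z"
    and "norm x / l * reflected_dist l (inversion l x) z = norm (x - z)"
proof -
  show "norm x / l * norm (inversion l x - z) = reflected_dist l x z"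
    using reflected_dist_commute[OF assms] by (simp add: reflected_dist_def norm_minus_commute)
  have "reflected_dist l (inversion l x) z = reflected_dist l z (inversion l x)"
    using assms by (intro reflected_dist_commute) auto
  then show "norm x / l * reflected_dist l (inversion l x) z = norm (x - z)"
    using assms by (simp add: reflected_dist_def inversion_inversion norm_inversion
      norm_minus_commute power2_eq_square)
qed

lemma reflected_dist_diff_lower_bound:
  assumes l_pos: "l > 0" and x_ge: "norm x \<ge> l" and z_ge: "norm z \<ge> l"
  shows "((norm x)\<^sup>2 - l\<^sup>2) / norm x * (((norm z)\<^sup>2 - l\<^sup>2) / (4 * l * norm z))
      \<le> reflected_dist l x z - norm (x - z)"
proof -
  define r s B D where "r = norm x" and "s = norm z" and "B = reflected_dist l x z" and "D = norm (x - z)"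
  have rs_bounds: "r \<ge> l" "s \<ge> l" "r > 0" "s > 0" using l_pos x_ge z_ge by (auto simp: r_def s_def)
  have nonneg: "B \<ge> 0" "D \<ge> 0" using l_pos by (auto simp: B_def D_def reflected_dist_def)
  have "z \<noteq> 0" using l_pos z_ge by auto
  then have "B\<^sup>2 - D\<^sup>2 = (r\<^sup>2 - l\<^sup>2) * (s\<^sup>2 - l\<^sup>2) / l\<^sup>2"
    unfolding B_def D_def reflected_dist_square[OF l_pos \<open>z \<noteq> 0\<close>] norm_diff_square r_def s_def
    using l_pos by (simp add: field_simps)
  then have product: "(B - D) * (B + D) = (r\<^sup>2 - l\<^sup>2) * (s\<^sup>2 - l\<^sup>2) / l\<^sup>2"
    by (simp add: power2_eq_square algebra_simps)
  moreover have "(r\<^sup>2 - l\<^sup>2) * (s\<^sup>2 - l\<^sup>2) / l\<^sup>2 \<ge> 0"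
    using rs_bounds l_pos by (intro divide_nonneg_nonneg mult_nonneg_nonneg) (auto intro: power_mono)
  ultimately have D_le_B: "D \<le> B" using nonneg by (smt (verit) mult_neg_pos)
  have "B + D \<le> 4 * (r * s / l)"
  proof -
    have "norm (x - inversion l z) \<le> r + l\<^sup>2 / s"
      using norm_triangle_ineq4[of x "inversion l z"] by (simp add: norm_inversion r_def s_def)
    then have "B \<le> s / l * (r + l\<^sup>2 / s)"
      unfolding B_def reflected_dist_def s_def using l_pos by (intro mult_left_mono) auto
    also have "\<dots> = r * s / l + l" using l_pos rs_bounds by (simp add: field_simps power2_eq_square)
    finally have "B \<le> r * s / l + l" .
    moreover have "l \<le> r * s / l" using l_pos rs_bounds mult_mono[of l r l s] by (simp add: field_simps)
    ultimately show ?thesis using D_le_B by linarith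
  qed
  then have "(B - D) * (B + D) \<le> (B - D) * (4 * (r * s / l))"
    using D_le_B by (intro mult_left_mono) auto
  then have "(r\<^sup>2 - l\<^sup>2) * (s\<^sup>2 - l\<^sup>2) / l\<^sup>2 / (4 * (r * s / l)) \<le> B - D"
    unfolding product using l_pos rs_bounds by (subst pos_divide_le_eq) auto
  also have "(r\<^sup>2 - l\<^sup>2) * (s\<^sup>2 - l\<^sup>2) / l\<^sup>2 / (4 * (r * s / l)) = (r\<^sup>2 - l\<^sup>2) / r * ((s\<^sup>2 - l\<^sup>2) / (4 * l * s))"
    using l_pos rs_bounds by (simp add: power2_eq_square[of l])
  finally show ?thesis by (simp add: B_def D_def r_def s_def)
qed

lemma has_derivative_inversion:
  assumes "x \<noteq> 0"
  shows "(inversion l has_derivative (\<lambda>v. (l\<^sup>2 / (norm x)\<^sup>2) *\<^sub>R (v - (2 * (x \<bullet> v) / (norm x)\<^sup>2) *\<^sub>R x))) (at x)"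
proof -
  have "((\<lambda>x. (l\<^sup>2 / (x \<bullet> x)) *\<^sub>R x) has_derivative
      (\<lambda>v. (l\<^sup>2 / (norm x)\<^sup>2) *\<^sub>R (v - (2 * (x \<bullet> v) / (norm x)\<^sup>2) *\<^sub>R x))) (at x)"
    using assms
    by (auto intro!: derivative_eq_intros simp: fun_eq_iff power2_norm_eq_inner inner_commute
        scaleR_diff_right field_simps)
  then show ?thesis by (simp add: inversion_def[abs_def] power2_norm_eq_inner)
qed

text \<open>Up to the factor \<open>l\<^sup>2 / |x|\<^sup>2\<close> the derivative of the inversion is a reflection.\<close>

lemma abs_det_inversion:
  fixes x :: "real^'n"
  assumes "x \<noteq> 0"
  shows "\<bar>det (matrix (\<lambda>v. (l\<^sup>2 / (norm x)\<^sup>2) *\<^sub>R (v - (2 * (x \<bullet> v) / (norm x)\<^sup>2) *\<^sub>R x)))\<bar>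
      = (l\<^sup>2 / (norm x)\<^sup>2) ^ CARD('n)"
proof -
  define H where "H v = v - (2 * (x \<bullet> v) / (norm x)\<^sup>2) *\<^sub>R x" for v
  have linear_H: "linear H"
    unfolding H_def by (rule linearI) (auto simp: inner_add_right algebra_simps add_divide_distrib)
  have "x \<bullet> x \<noteq> 0" using assms by simp
  then have "H v \<bullet> H w = v \<bullet> w" for v w
    by (simp add: H_def power2_norm_eq_inner inner_diff_left inner_diff_right inner_commute field_simps)
  then have "orthogonal_transformation H" using linear_H by (simp add: orthogonal_transformation_def)
  then have "\<bar>det (matrix H)\<bar> = 1" by simp
  moreover have "matrix (\<lambda>v. (l\<^sup>2 / (norm x)\<^sup>2) *\<^sub>R H v) = matrix ((*\<^sub>R) (l\<^sup>2 / (norm x)\<^sup>2)) ** matrix H"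
    using matrix_compose[OF linear_H linear_scale_self, of "l\<^sup>2 / (norm x)\<^sup>2"] by (simp add: o_def)
  ultimately show ?thesis by (simp add: H_def[symmetric] det_mul abs_mult)
qed

lemma inversion_image_exterior:
  assumes "l > 0"
  shows "inversion l ` (- cball 0 l) = ball 0 l - {0}"
proof (intro set_eqI iffI)
  have flip: "norm (inversion l z) < l \<longleftrightarrow> norm z > l" if "z \<noteq> 0" for z :: 'a
    using assms that by (simp add: norm_inversion field_simps power2_eq_square)
  fix y :: 'a
  show "y \<in> ball 0 l - {0}" if "y \<in> inversion l ` (- cball 0 l)"
  proof -
    obtain z where y_eq: "y = inversion l z" and z_gt: "norm z > l" using \<open>y \<in> _\<close> by auto
    then have "z \<noteq> 0" using assms by auto
    with y_eq z_gt assms show ?thesis by (simp add: flip)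
  qed
  assume "y \<in> ball 0 l - {0}"
  then have "inversion l y \<in> - cball 0 l"
    using flip[of "inversion l y"] inversion_inversion[of l y] assms by auto
  moreover have "y = inversion l (inversion l y)" using assms by (simp add: inversion_inversion)
  ultimately show "y \<in> inversion l ` (- cball 0 l)" by blast
qed

lemma absolutely_integrable_on_iff_set_integrable_lborel:
  fixes f :: "'a::euclidean_space \<Rightarrow> real"
  assumes "S \<in> sets borel" "f \<in> borel_measurable borel"
  shows "f absolutely_integrable_on S \<longleftrightarrow> set_integrable lborel S f"
  using assms unfolding set_integrable_def by (subst integrable_completion) auto

lemma integral_eq_set_integral_lborel:
  fixes f :: "'a::euclidean_space \<Rightarrow> real"
  assumes "S \<in> sets borel" "f \<in> borel_measurable borel" "set_integrable lborel S f"
  shows "integral S f = (LINT x:S|lborel. f x)"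
  using set_lebesgue_integral_eq_integral(2)[of S f] assms
  by (simp add: absolutely_integrable_on_iff_set_integrable_lborel set_lebesgue_integral_def integral_completion)

lemma
  fixes f :: "real^'n::{finite,wellorder} \<Rightarrow> real"
  assumes sets [measurable]: "S \<in> sets borel" "g ` S \<in> sets borel"
    and deriv: "\<And>x. x \<in> S \<Longrightarrow> (g has_derivative g' x) (at x)" and inj: "inj_on g S"
    and J_eq: "\<And>x. x \<in> S \<Longrightarrow> \<bar>det (matrix (g' x))\<bar> = J x"
    and measurable: "f \<in> borel_measurable borel" "(\<lambda>x. J x * f (g x)) \<in> borel_measurable borel"
    and f_on_image: "set_integrable lborel (g ` S) f"
  shows set_integrable_change_of_variables: "set_integrable lborel S (\<lambda>x. J x * f (g x))"
    and set_integral_change_of_variables: "(LINT x:S|lborel. J x * f (g x)) = (LINT y:g ` S|lborel. f y)"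
proof -
  have f_abs: "f absolutely_integrable_on g ` S"
    using absolutely_integrable_on_iff_set_integrable_lborel[OF sets(2) measurable(1)] f_on_image by simp
  have "(\<lambda>x. \<bar>det (matrix (g' x))\<bar> *\<^sub>R vec (f (g x)) :: real^1) absolutely_integrable_on S \<and>
      integral S (\<lambda>x. \<bar>det (matrix (g' x))\<bar> *\<^sub>R vec (f (g x)) :: real^1) = vec (integral (g ` S) f)"
    using has_absolute_integral_change_of_variables[of S g g'
        "\<lambda>y. vec (f y) :: real^1" "vec (integral (g ` S) f)"]
      deriv inj f_abs
    by (simp add: has_derivative_at_withinI absolutely_integrable_on_1_iff integral_on_1_eq)
  then have "(\<lambda>x. \<bar>det (matrix (g' x))\<bar> * f (g x)) absolutely_integrable_on S"
      "integral S (\<lambda>x. \<bar>det (matrix (g' x))\<bar> * f (g x)) = integral (g ` S) f"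
    by (simp_all add: absolutely_integrable_on_1_iff integral_on_1_eq vec_eq_iff)
  moreover have "(\<lambda>x. \<bar>det (matrix (g' x))\<bar> * f (g x)) absolutely_integrable_on S
      \<longleftrightarrow> (\<lambda>x. J x * f (g x)) absolutely_integrable_on S"
    using J_eq by (intro set_integrable_cong) auto
  moreover have "integral S (\<lambda>x. \<bar>det (matrix (g' x))\<bar> * f (g x)) = integral S (\<lambda>x. J x * f (g x))"
    using J_eq by (intro integral_cong) simp
  ultimately have J_abs: "(\<lambda>x. J x * f (g x)) absolutely_integrable_on S"
    and integral_eq: "integral S (\<lambda>x. J x * f (g x)) = integral (g ` S) f" by simp_all
  show J_int: "set_integrable lborel S (\<lambda>x. J x * f (g x))"
    using absolutely_integrable_on_iff_set_integrable_lborel[OF sets(1) measurable(2)] J_abs by simp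
  show "(LINT x:S|lborel. J x * f (g x)) = (LINT y:g ` S|lborel. f y)"
    using integral_eq integral_eq_set_integral_lborel[OF sets(1) measurable(2) J_int]
      integral_eq_set_integral_lborel[OF sets(2) measurable(1) f_on_image] by simp
qed

lemma
  fixes h :: "real^'n::{finite,wellorder} \<Rightarrow> real"
  assumes l_pos: "l > 0" and integrable_h: "integrable lborel h"
  shows set_integrable_inversion:
      "set_integrable lborel (- cball 0 l) (\<lambda>z. (l / norm z) ^ (2 * CARD('n)) * h (inversion l z))"
    and set_integral_inversion:
      "(LINT z:- cball 0 l|lborel. (l / norm z) ^ (2 * CARD('n)) * h (inversion l z))
          = (LINT y:ball 0 l|lborel. h y)"
proof -
  let ?S = "- cball (0::real^'n::_) l"
  have nonzero: "z \<noteq> 0" if "z \<in> ?S" for z using that l_pos by auto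
  have [measurable]: "h \<in> borel_measurable borel" using integrable_h by auto
  have sets: "?S \<in> sets borel" "inversion l ` ?S \<in> sets borel"
    using l_pos by (auto simp: inversion_image_exterior)
  have inj: "inj_on (inversion l) ?S"
    using l_pos by (intro inj_on_inverseI[where g="inversion l"]) (simp add: inversion_inversion)
  have det: "\<bar>det (matrix (\<lambda>v. (l\<^sup>2 / (norm z)\<^sup>2) *\<^sub>R (v - (2 * (z \<bullet> v) / (norm z)\<^sup>2) *\<^sub>R z)))\<bar>
      = (l / norm z) ^ (2 * CARD('n))"
    if "z \<in> ?S" for z
    using abs_det_inversion[OF nonzero[OF that]] by (simp add: power_mult power_divide)
  have image: "set_integrable lborel (inversion l ` ?S) h"
    unfolding set_integrable_def using integrable_h sets(2) by (intro integrable_mult_indicator) auto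
  have measurable: "h \<in> borel_measurable borel"
    "(\<lambda>z. (l / norm z) ^ (2 * CARD('n)) * h (inversion l z)) \<in> borel_measurable borel" by measurable
  note change = sets has_derivative_inversion[OF nonzero] inj det measurable image
  show "set_integrable lborel ?S (\<lambda>z. (l / norm z) ^ (2 * CARD('n)) * h (inversion l z))"
    by (rule set_integrable_change_of_variables[OF change])
  have "(LINT z:?S|lborel. (l / norm z) ^ (2 * CARD('n)) * h (inversion l z))
      = (LINT y:inversion l ` ?S|lborel. h y)"
    by (rule set_integral_change_of_variables[OF change])
  also have "\<dots> = (LINT y:ball 0 l|lborel. h y)"
    unfolding inversion_image_exterior[OF l_pos]
    by (rule set_integral_discrete_difference[where X="{0}"]) auto
  finally show "(LINT z:?S|lborel. (l / norm z) ^ (2 * CARD('n)) * h (inversion l z))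
      = (LINT y:ball 0 l|lborel. h y)" .
qed

lemma integral_eq_exterior_plus_ball:
  fixes h :: "'a::euclidean_space \<Rightarrow> real"
  assumes integrable_h: "integrable lborel h"
  shows "(LBINT z. h z) = (LINT z:- cball 0 l|lborel. h z) + (LINT z:ball 0 l|lborel. h z)"
proof -
  have h_on: "set_integrable lborel A h" if "A \<in> sets borel" for A
    unfolding set_integrable_def using integrable_h that by (intro integrable_mult_indicator) auto
  have [measurable]: "h \<in> borel_measurable borel" using integrable_h by auto
  have "sphere (0::'a) l \<in> null_sets lborel"
    using negligible_sphere[of "0::'a" l] by (simp add: negligible_iff_null_sets null_sets_completion_iff)
  then have "AE z in lborel. z \<notin> sphere (0::'a) l" by (rule AE_not_in)
  then have "(LINT z:UNIV|lborel. h z) = (LINT z:- cball 0 l \<union> ball 0 l|lborel. h z)"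
    by (intro set_integral_cong_set) (auto simp: set_borel_measurable_def
      intro!: borel_measurable_times borel_measurable_indicator elim!: eventually_mono)
  also have "\<dots> = (LINT z:- cball 0 l|lborel. h z) + (LINT z:ball 0 l|lborel. h z)"
    by (intro set_integral_Un h_on) auto
  finally show ?thesis by (simp add: set_lebesgue_integral_def)
qed

subsection \<open>The method of moving spheres\<close>

locale conformal_equation = integral_equation u grad "2 * real CARD('n) + 1" c 0
  for u :: "real^'n::{finite,wellorder} \<Rightarrow> real" and grad and c
begin

definition kelvin where "kelvin l x = norm x / l * u (inversion l x)"

definition kelvin_source where "kelvin_source l x = kelvin l x powr (- (2 * real CARD('n) + 1))"

abbreviation exterior :: "real \<Rightarrow> (real^'n::_) set" where "exterior l \<equiv> - cball 0 l"

lemma borel_measurable_kelvin [measurable]: "kelvin l \<in> borel_measurable borel"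
  unfolding kelvin_def[abs_def] by measurable

lemma borel_measurable_kelvin_source [measurable]: "kelvin_source l \<in> borel_measurable borel"
  unfolding kelvin_source_def[abs_def] by measurable

lemma continuous_on_kelvin: "l > 0 \<Longrightarrow> continuous_on (exterior l) (kelvin l)"
  unfolding kelvin_def[abs_def] inversion_def
  by (intro continuous_intros continuous_on_compose2[OF continuous_on_u]) auto

lemma kelvin_on_sphere: "l > 0 \<Longrightarrow> norm x = l \<Longrightarrow> kelvin l x = u x"
  by (simp add: kelvin_def inversion_def)

lemma kelvin_ray: "t > 0 \<Longrightarrow> norm e = 1 \<Longrightarrow> kelvin l (t *\<^sub>R e) = t / l * u ((l\<^sup>2 / t) *\<^sub>R e)"
  by (simp add: kelvin_def inversion_def power2_eq_square)

lemma source_inversion: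
  assumes "l > 0" "z \<noteq> 0"
  shows "(l / norm z) ^ (2 * CARD('n)) * source (inversion l z) = norm z / l * kelvin_source l z"
proof -
  define t where "t = norm z / l"
  have t_pos: "t > 0" using assms by (simp add: t_def)
  have "t * kelvin_source l z = t * t powr (- (2 * real CARD('n) + 1)) * source (inversion l z)"
    using t_pos less_imp_le[OF pos]
    by (simp add: kelvin_source_def kelvin_def source_def t_def[symmetric] powr_mult)
  also have "t * t powr (- (2 * real CARD('n) + 1)) = inverse t ^ (2 * CARD('n))"
    using t_pos powr_mult_base[of t "- (2 * real CARD('n) + 1)"] powr_realpow[of t "2 * CARD('n)"]
    by (simp add: powr_minus power_inverse)
  finally show ?thesis by (simp add: t_def)
qed

lemma
  assumes l_pos: "l > 0"
  shows set_integrable_potential: "set_integrable lborel (exterior l) (\<lambda>z. norm (x - z) * source z)"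
    and set_integrable_reflected_potential:
      "set_integrable lborel (exterior l) (\<lambda>z. reflected_dist l x z * kelvin_source l z)"
    and u_eq_exterior: "u x = c * ((LINT z:exterior l|lborel. norm (x - z) * source z)
      + (LINT z:exterior l|lborel. reflected_dist l x z * kelvin_source l z))"
proof -
  let ?h = "\<lambda>y. norm (x - y) * source y"
  have integrable_h: "integrable lborel ?h" by (rule integrable_potential)
  show "set_integrable lborel (exterior l) ?h"
    unfolding set_integrable_def using integrable_h by (intro integrable_mult_indicator) auto
  have reflect: "(l / norm z) ^ (2 * CARD('n)) * ?h (inversion l z) = reflected_dist l x z * kelvin_source l z"
    if "z \<in> exterior l" for z
  proof -
    have "z \<noteq> 0" using that l_pos by auto
    from source_inversion[OF l_pos this] show ?thesis by (simp add: reflected_dist_def mult.left_commute)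
  qed
  show "set_integrable lborel (exterior l) (\<lambda>z. reflected_dist l x z * kelvin_source l z)"
    by (rule iffD1[OF set_integrable_cong[OF refl refl reflect] set_integrable_inversion[OF l_pos integrable_h]])
  have "(LBINT z. ?h z) = (LINT z:exterior l|lborel. ?h z) + (LINT z:ball 0 l|lborel. ?h z)"
    by (rule integral_eq_exterior_plus_ball[OF integrable_h])
  also have "(LINT z:ball 0 l|lborel. ?h z) = (LINT z:exterior l|lborel. reflected_dist l x z * kelvin_source l z)"
    unfolding set_integral_inversion[OF l_pos integrable_h, symmetric]
    by (intro set_lebesgue_integral_cong) (auto simp: reflect)
  finally show "u x = c * ((LINT z:exterior l|lborel. ?h z)
      + (LINT z:exterior l|lborel. reflected_dist l x z * kelvin_source l z))"
    using u_eq[of x] by simp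
qed

lemma
  assumes l_pos: "l > 0" and x_nonzero: "x \<noteq> 0"
  shows set_integrable_kelvin_diff: "set_integrable lborel (exterior l)
      (\<lambda>z. (reflected_dist l x z - norm (x - z)) * (source z - kelvin_source l z))"
    and kelvin_diff_eq: "kelvin l x - u x = c * (LINT z:exterior l|lborel.
      (reflected_dist l x z - norm (x - z)) * (source z - kelvin_source l z))"
proof -
  let ?y = "inversion l x" and ?D = "\<lambda>x z. norm (x - z)" and ?R = "reflected_dist l"
  note int_x = set_integrable_potential[OF l_pos, of x] set_integrable_reflected_potential[OF l_pos, of x]
  note int_y = set_integrable_potential[OF l_pos, of ?y] set_integrable_reflected_potential[OF l_pos, of ?y]
  have direct: "norm x / l * (?D ?y z * source z) = ?R x z * source z"
    and reflected: "norm x / l * (?R ?y z * kelvin_source l z) = ?D x z * kelvin_source l z"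
    if "z \<in> exterior l" for z
  proof -
    have "z \<noteq> 0" using that l_pos by auto
    from reflected_dist_inversion[OF l_pos x_nonzero this, symmetric]
    show "norm x / l * (?D ?y z * source z) = ?R x z * source z"
      "norm x / l * (?R ?y z * kelvin_source l z) = ?D x z * kelvin_source l z" by simp_all
  qed
  have int_direct: "set_integrable lborel (exterior l) (\<lambda>z. ?R x z * source z)"
    by (rule iffD1[OF set_integrable_cong[OF refl refl direct] set_integrable_mult_right[OF int_y(1)]])
  have int_reflected: "set_integrable lborel (exterior l) (\<lambda>z. ?D x z * kelvin_source l z)"
    by (rule iffD1[OF set_integrable_cong[OF refl refl reflected] set_integrable_mult_right[OF int_y(2)]])
  have "kelvin l x = c * (norm x / l * (LINT z:exterior l|lborel. ?D ?y z * source z)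
      + norm x / l * (LINT z:exterior l|lborel. ?R ?y z * kelvin_source l z))"
    unfolding kelvin_def u_eq_exterior[OF l_pos, of ?y] by (simp add: algebra_simps)
  also have "norm x / l * (LINT z:exterior l|lborel. ?D ?y z * source z)
      = (LINT z:exterior l|lborel. ?R x z * source z)"
    unfolding set_integral_mult_right[symmetric] using direct by (intro set_lebesgue_integral_cong) auto
  also have "norm x / l * (LINT z:exterior l|lborel. ?R ?y z * kelvin_source l z)
      = (LINT z:exterior l|lborel. ?D x z * kelvin_source l z)"
    unfolding set_integral_mult_right[symmetric] using reflected by (intro set_lebesgue_integral_cong) auto
  finally have kelvin_eq: "kelvin l x = c * ((LINT z:exterior l|lborel. ?R x z * source z)
      + (LINT z:exterior l|lborel. ?D x z * kelvin_source l z))" .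
  have expand: "(?R x z - ?D x z) * (source z - kelvin_source l z) =
     (?R x z * source z + ?D x z * kelvin_source l z) - (?D x z * source z + ?R x z * kelvin_source l z)" for z
    by (simp add: algebra_simps)
  show "set_integrable lborel (exterior l) (\<lambda>z. (?R x z - ?D x z) * (source z - kelvin_source l z))"
    unfolding expand by (intro set_integral_diff set_integral_add int_x int_direct int_reflected)
  show "kelvin l x - u x = c * (LINT z:exterior l|lborel. (?R x z - ?D x z) * (source z - kelvin_source l z))"
    unfolding expand kelvin_eq u_eq_exterior[OF l_pos, of x] using int_x int_direct int_reflected
    by (simp add: right_diff_distrib)
qed

definition dominates where "dominates l \<longleftrightarrow> (\<forall>x. norm x \<ge> l \<longrightarrow> u x \<le> kelvin l x)"

definition gap_weight where
  "gap_weight l z = ((norm z)\<^sup>2 - l\<^sup>2) / (4 * l * norm z) * (source z - kelvin_source l z)"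

lemma source_ge_kelvin_source:
  assumes "dominates l" "norm z \<ge> l" shows "kelvin_source l z \<le> source z"
  using assms pos[of z] unfolding dominates_def source_def kelvin_source_def by (auto intro!: powr_mono2')

lemma gap_weight_nonneg:
  assumes "l > 0" "dominates l" "z \<in> exterior l" shows "gap_weight l z \<ge> 0"
proof -
  have z_gt: "norm z > l" using assms(3) by simp
  then have "l\<^sup>2 \<le> (norm z)\<^sup>2" using assms(1) by (intro power_mono) auto
  then show ?thesis
    using assms z_gt source_ge_kelvin_source[OF assms(2), of z] by (simp add: gap_weight_def)
qed

lemma gap_weight_le:
  assumes l_pos: "l > 0" and dom: "dominates l" and x_ge: "norm x \<ge> l" and z_exterior: "z \<in> exterior l"
  shows "((norm x)\<^sup>2 - l\<^sup>2) / norm x * gap_weight l z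
    \<le> (reflected_dist l x z - norm (x - z)) * (source z - kelvin_source l z)"
proof -
  have "norm z \<ge> l" using z_exterior by simp
  from mult_right_mono[OF reflected_dist_diff_lower_bound[OF l_pos x_ge this],
      of "source z - kelvin_source l z"] source_ge_kelvin_source[OF dom this]
  show ?thesis by (simp add: gap_weight_def mult.assoc)
qed

lemma set_integrable_gap_weight:
  assumes l_pos: "l > 0" and dom: "dominates l"
  shows "set_integrable lborel (exterior l) (gap_weight l)"
proof -
  obtain e :: "real^'n::_" where norm_e: "norm e = 1" using norm_Basis nonempty_Basis by blast
  define x where "x = (2 * l) *\<^sub>R e"
  define a where "a = ((norm x)\<^sup>2 - l\<^sup>2) / norm x"
  have norm_x: "norm x = 2 * l" and x_nonzero: "x \<noteq> 0" using l_pos norm_e by (auto simp: x_def)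
  then have a_pos: "a > 0" using l_pos by (simp add: a_def power2_eq_square)
  define K where "K z = (reflected_dist l x z - norm (x - z)) * (source z - kelvin_source l z)" for z
  show ?thesis
  proof (rule set_integrable_bound)
    show "set_integrable lborel (exterior l) (\<lambda>z. 1 / a * K z)"
      unfolding K_def using set_integrable_kelvin_diff[OF l_pos x_nonzero] by (rule set_integrable_mult_right)
    show "set_borel_measurable lborel (exterior l) (gap_weight l)"
      unfolding set_borel_measurable_def gap_weight_def[abs_def] by measurable
    have "norm (gap_weight l z) \<le> norm (1 / a * K z)" if "z \<in> exterior l" for z
    proof -
      have "a * gap_weight l z \<le> K z"
        using gap_weight_le[OF l_pos dom _ that, of x] norm_x l_pos by (simp add: a_def K_def)
      then have "gap_weight l z \<le> 1 / a * K z" using a_pos by (simp add: pos_le_divide_eq mult.commute)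
      then show ?thesis using gap_weight_nonneg[OF l_pos dom that] unfolding real_norm_def by linarith
    qed
    then show "AE z in lborel. z \<in> exterior l \<longrightarrow> norm (gap_weight l z) \<le> norm (1 / a * K z)" by simp
  qed
qed

lemma set_integral_gap_weight_pos:
  assumes l_pos: "l > 0"
    and dom: "dominates l" and z0_exterior: "z0 \<in> exterior l" and z0_gap: "kelvin l z0 \<noteq> u z0"
  shows "(LINT z:exterior l|lborel. gap_weight l z) > 0"
  unfolding set_lebesgue_integral_def
proof (rule integral_pos_lborel)
  let ?U = "exterior l \<inter> (\<lambda>z. kelvin l z - u z) -` {0<..}"
  show "integrable lborel (\<lambda>z. indicator (exterior l) z *\<^sub>R gap_weight l z)"
    using set_integrable_gap_weight[OF l_pos dom] by (simp add: set_integrable_def)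
  show "indicator (exterior l) z *\<^sub>R gap_weight l z \<ge> 0" for z
    using gap_weight_nonneg[OF l_pos dom, of z] by (simp add: indicator_def)
  show "open ?U"
    by (intro continuous_open_preimage continuous_intros continuous_on_kelvin l_pos
        continuous_on_subset[OF continuous_on_u]) auto
  show "?U \<noteq> {}" using z0_exterior z0_gap dom by (force simp: dominates_def less_le)
  show "indicator (exterior l) y *\<^sub>R gap_weight l y > 0" if "y \<in> ?U" for y
  proof -
    have y_gt: "norm y > l" and "kelvin l y > u y" using that by auto
    then have "kelvin_source l y < source y"
      unfolding source_def kelvin_source_def using pos[of y] by (auto intro!: powr_less_mono2_neg)
    moreover have "l\<^sup>2 < (norm y)\<^sup>2" using y_gt l_pos by (intro power_strict_mono) auto
    moreover have "norm y > 0" using y_gt l_pos by linarith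
    ultimately have "gap_weight l y > 0"
      unfolding gap_weight_def using l_pos by (intro mult_pos_pos divide_pos_pos) auto
    then show ?thesis using that by simp
  qed
qed

lemma kelvin_gap:
  assumes l_pos: "l > 0"
    and dom: "dominates l" and z0_exterior: "z0 \<in> exterior l" and z0_gap: "kelvin l z0 \<noteq> u z0"
  obtains m where "m > 0" "\<And>x. norm x \<ge> l \<Longrightarrow> m * (norm x - l\<^sup>2 / norm x) \<le> kelvin l x - u x"
proof (rule that)
  define m where "m = c * (LINT z:exterior l|lborel. gap_weight l z)"
  show "m > 0" using set_integral_gap_weight_pos[OF l_pos dom z0_exterior z0_gap] c_pos by (simp add: m_def)
  fix x :: "real^'n::_" assume x_ge: "norm x \<ge> l"
  then have "x \<noteq> 0" using l_pos by auto
  have "(LINT z:exterior l|lborel. ((norm x)\<^sup>2 - l\<^sup>2) / norm x * gap_weight l z)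
      \<le> (LINT z:exterior l|lborel. (reflected_dist l x z - norm (x - z)) * (source z - kelvin_source l z))"
    by (intro set_integral_mono set_integrable_kelvin_diff[OF l_pos \<open>x \<noteq> 0\<close>] set_integrable_mult_right
        set_integrable_gap_weight[OF l_pos dom] gap_weight_le[OF l_pos dom x_ge])
  from mult_left_mono[OF this, of c] c_pos have "((norm x)\<^sup>2 - l\<^sup>2) / norm x * m \<le> kelvin l x - u x"
    unfolding kelvin_diff_eq[OF l_pos \<open>x \<noteq> 0\<close>] by (simp add: m_def mult_ac)
  moreover have "((norm x)\<^sup>2 - l\<^sup>2) / norm x = norm x - l\<^sup>2 / norm x"
    using \<open>x \<noteq> 0\<close> by (simp add: diff_divide_distrib power2_eq_square)
  ultimately show "m * (norm x - l\<^sup>2 / norm x) \<le> kelvin l x - u x" by (simp add: mult.commute)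
qed

lemma norm_inversion_le:
  assumes "0 < l" "l \<le> norm x" shows "norm (inversion l x) \<le> l"
proof -
  have "l\<^sup>2 / norm x \<le> l\<^sup>2 / l"
    using assms by (intro divide_left_mono mult_pos_pos) (auto intro: less_le_trans)
  then show ?thesis using assms(1) by (simp add: norm_inversion power2_eq_square)
qed

lemma dominates_small:
  assumes l_pos: "l > 0" and l_le: "l \<le> u 0 / (3 * slope)"
  shows "dominates l"
  unfolding dominates_def
proof (intro allI impI)
  fix x :: "real^'n::_" assume x_ge: "norm x \<ge> l"
  define r where "r = norm x"
  have r_ge: "r \<ge> l" and r_pos: "r > 0" using x_ge l_pos by (auto simp: r_def)
  let ?y = "inversion l x"
  have norm_y: "norm ?y = l\<^sup>2 / r" and y_le: "l\<^sup>2 / r \<le> l"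
    using norm_inversion_le[OF l_pos x_ge] by (auto simp: norm_inversion r_def)
  have "u 0 - u ?y \<le> slope * (l\<^sup>2 / r)" using abs_u_diff_le[of 0 ?y] norm_y by simp
  also have "\<dots> \<le> slope * l" using y_le slope_pos by (intro mult_left_mono) auto
  finally have "2 * (slope * l) \<le> u ?y" using l_le slope_pos by (simp add: field_simps)
  moreover have "slope * (l\<^sup>2 / r) \<le> slope * l" using y_le slope_pos by (intro mult_left_mono) auto
  ultimately have u_y_ge: "slope * (l + l\<^sup>2 / r) \<le> u ?y" by (simp add: distrib_left)
  have "norm (x - ?y) = r - l\<^sup>2 / r"
  proof -
    have "x - ?y = (1 - l\<^sup>2 / r\<^sup>2) *\<^sub>R x" by (simp add: inversion_def r_def algebra_simps)
    moreover have "l\<^sup>2 / r\<^sup>2 \<le> 1" using r_ge r_pos l_pos power_mono[of l r 2] by simp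
    ultimately have "norm (x - ?y) = (1 - l\<^sup>2 / r\<^sup>2) * r" by (simp add: r_def)
    then show ?thesis using r_pos by (simp add: left_diff_distrib power2_eq_square)
  qed
  also have "\<dots> = (r / l - 1) * (l + l\<^sup>2 / r)"
    using r_ge r_pos l_pos by (simp add: field_simps power2_eq_square)
  finally have norm_diff: "norm (x - ?y) = (r / l - 1) * (l + l\<^sup>2 / r)" .
  have "u x - u ?y \<le> slope * norm (x - ?y)" using abs_u_diff_le[of x ?y] by linarith
  also have "\<dots> = (r / l - 1) * (slope * (l + l\<^sup>2 / r))" by (simp add: norm_diff)
  also have "\<dots> \<le> (r / l - 1) * u ?y" using u_y_ge r_ge r_pos l_pos by (intro mult_left_mono) auto
  finally show "u x \<le> kelvin l x" by (simp add: kelvin_def r_def algebra_simps)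
qed

lemma tendsto_kelvin_ray:
  assumes l_pos: "l > 0" and norm_e: "norm e = 1"
  shows "((\<lambda>t. kelvin l (t *\<^sub>R e) / t) \<longlongrightarrow> u 0 / l) at_top"
proof -
  have "((\<lambda>t. (l\<^sup>2 * inverse t) *\<^sub>R e) \<longlongrightarrow> (l\<^sup>2 * 0) *\<^sub>R e) at_top"
    by (intro tendsto_intros tendsto_inverse_at_top)
  then have "((\<lambda>t. u ((l\<^sup>2 * inverse t) *\<^sub>R e) / l) \<longlongrightarrow> u 0 / l) at_top"
    using continuous_on_u l_pos by (intro tendsto_divide tendsto_const)
      (auto simp: continuous_on_eq_continuous_at intro: isCont_tendsto_compose)
  moreover have "\<forall>\<^sub>F t in at_top. u ((l\<^sup>2 * inverse t) *\<^sub>R e) / l = kelvin l (t *\<^sub>R e) / t"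
    using eventually_gt_at_top[of 0] by eventually_elim (simp add: kelvin_ray norm_e divide_inverse)
  ultimately show ?thesis by (rule Lim_transform_eventually)
qed

lemma slope_le_if_dominates:
  assumes l_pos: "l > 0" and dom: "dominates l"
  shows "slope \<le> u 0 / l"
proof -
  obtain e :: "real^'n::_" where norm_e: "norm e = 1" using norm_Basis nonempty_Basis by blast
  show ?thesis
  proof (rule tendsto_le[OF trivial_limit_at_top_linorder
        tendsto_kelvin_ray[OF l_pos norm_e] tendsto_ray[OF norm_e]])
    show "\<forall>\<^sub>F t in at_top. u (t *\<^sub>R e) / t \<le> kelvin l (t *\<^sub>R e) / t"
      using eventually_ge_at_top[of l] eventually_gt_at_top[of 0]
      by eventually_elim (use dom norm_e in \<open>auto simp: dominates_def intro!: divide_right_mono\<close>)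
  qed
qed

lemma slope_eq_if_kelvin_eq:
  assumes l_pos: "l > 0" and kelvin_eq: "\<And>x. norm x \<ge> l \<Longrightarrow> kelvin l x = u x"
  shows "slope = u 0 / l"
proof -
  obtain e :: "real^'n::_" where norm_e: "norm e = 1" using norm_Basis nonempty_Basis by blast
  have "\<forall>\<^sub>F t in at_top. kelvin l (t *\<^sub>R e) / t = u (t *\<^sub>R e) / t"
    using eventually_ge_at_top[of l] eventually_gt_at_top[of 0]
    by eventually_elim (simp add: kelvin_eq norm_e)
  with tendsto_kelvin_ray[OF l_pos norm_e] have "((\<lambda>t. u (t *\<^sub>R e) / t) \<longlongrightarrow> u 0 / l) at_top"
    by (rule Lim_transform_eventually)
  with tendsto_ray[OF norm_e] show ?thesis by (rule tendsto_unique[OF trivial_limit_at_top_linorder])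
qed

lemma u_inversion_le:
  assumes "0 < l" "l \<le> norm x"
  shows "u (inversion l x) \<le> u 0 + slope * l"
proof -
  have "slope * norm (inversion l x) \<le> slope * l"
    using norm_inversion_le[OF assms] slope_pos by (intro mult_left_mono) auto
  then show ?thesis using abs_u_diff_le[of "inversion l x" 0] by simp
qed

lemma u_inversion_diff_le:
  assumes "0 < k" "k \<le> l" "l \<le> norm x"
  shows "u (inversion k x) - u (inversion l x) \<le> slope * ((l - k) * (l + k) / k)"
proof -
  have "norm (inversion k x - inversion l x) = (l - k) * (l + k) / norm x"
    using assms power_mono[of k l 2] by (simp add: norm_inversion_diff power2_eq_square algebra_simps)
  also have "\<dots> \<le> (l - k) * (l + k) / k" using assms by (intro divide_left_mono mult_pos_pos) auto
  finally have "slope * norm (inversion k x - inversion l x) \<le> slope * ((l - k) * (l + k) / k)"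
    using slope_pos by (intro mult_left_mono) auto
  then show ?thesis using abs_u_diff_le[of "inversion k x" "inversion l x"] by linarith
qed

lemma kelvin_radius_diff_le:
  assumes k_pos: "0 < k" and radii: "k \<le> l" "l \<le> norm x"
  shows "kelvin k x - kelvin l x \<le> norm x * ((slope * (l + k) + (u 0 + slope * l)) / k\<^sup>2 * (l - k))"
proof -
  let ?y = "inversion k x" and ?z = "inversion l x"
  have l_pos: "l > 0" using k_pos radii by linarith
  have "1 / k - 1 / l = (l - k) / (k * l)" using k_pos l_pos by (simp add: field_simps)
  also have "\<dots> \<le> (l - k) / (k * k)"
    using k_pos radii by (intro divide_left_mono mult_left_mono mult_pos_pos) auto
  finally have reciprocal_diff: "1 / k - 1 / l \<le> (l - k) / k\<^sup>2" by (simp add: power2_eq_square)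
  have "1 / k - 1 / l \<ge> 0" using k_pos radii by (simp add: field_simps)
  then have u_z_le: "u ?z * (1 / k - 1 / l) \<le> (u 0 + slope * l) * ((l - k) / k\<^sup>2)"
    using u_inversion_le[OF l_pos radii(2)] reciprocal_diff less_imp_le[OF pos] slope_pos l_pos
    by (intro mult_mono) (auto intro: add_nonneg_nonneg)
  have "kelvin k x - kelvin l x = norm x * ((u ?y - u ?z) / k + u ?z * (1 / k - 1 / l))"
    using k_pos l_pos by (simp add: kelvin_def field_simps)
  also have "\<dots> \<le> norm x * (slope * ((l - k) * (l + k) / k) / k + (u 0 + slope * l) * ((l - k) / k\<^sup>2))"
    using u_inversion_diff_le[OF k_pos radii] u_z_le k_pos
    by (intro mult_left_mono add_mono divide_right_mono) auto
  also have "\<dots> = norm x * ((slope * (l + k) + (u 0 + slope * l)) / k\<^sup>2 * (l - k))"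
    using k_pos by (simp add: field_simps power2_eq_square)
  finally show ?thesis .
qed

definition radial_gap_deriv where
  "radial_gap_deriv l t e = u ((l\<^sup>2 / t) *\<^sub>R e) / l - l / t * (grad ((l\<^sup>2 / t) *\<^sub>R e) \<bullet> e) - grad (t *\<^sub>R e) \<bullet> e"

lemma has_real_derivative_radial_gap:
  assumes "l > 0" "t > 0"
  shows "((\<lambda>t. t / l * u ((l\<^sup>2 / t) *\<^sub>R e) - u (t *\<^sub>R e)) has_real_derivative radial_gap_deriv l t e) (at t)"
proof -
  have along: "((\<lambda>t. u (p t *\<^sub>R e)) has_real_derivative grad (p t *\<^sub>R e) \<bullet> (p' *\<^sub>R e)) (at t)"
    if "(p has_real_derivative p') (at t)" for p p'
    using that by (intro has_real_derivative_along_curve) (auto intro!: derivative_eq_intros)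
  have reciprocal: "((\<lambda>t. l\<^sup>2 / t) has_real_derivative - (l\<^sup>2 / t\<^sup>2)) (at t)"
    and linear: "((\<lambda>t. t / l) has_real_derivative 1 / l) (at t)"
    using assms by (auto intro!: derivative_eq_intros simp: power2_eq_square)
  show ?thesis
    by (rule DERIV_cong[OF DERIV_diff[OF DERIV_mult[OF linear along[OF reciprocal]] along[OF DERIV_ident]]])
       (use assms in \<open>simp add: radial_gap_deriv_def field_simps power2_eq_square\<close>)
qed

lemma radial_gap_deriv_lower_bound:
  assumes L_pos: "L > 0" and norm_e: "norm e = 1"
    and gap: "\<And>x. norm x \<ge> L \<Longrightarrow> m * (norm x - L\<^sup>2 / norm x) \<le> kelvin L x - u x"
  shows "2 * m \<le> radial_gap_deriv L L e"
proof (rule ccontr)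
  assume "\<not> ?thesis"
  define \<psi> where "\<psi> t = (t / L * u ((L\<^sup>2 / t) *\<^sub>R e) - u (t *\<^sub>R e)) - m * (t - L\<^sup>2 / t)" for t
  have "((\<lambda>t. m * (t - L\<^sup>2 / t)) has_real_derivative 2 * m) (at L)"
    using L_pos by (auto intro!: derivative_eq_intros simp: power2_eq_square)
  from DERIV_diff[OF has_real_derivative_radial_gap[OF L_pos L_pos, of e] this]
  have "(\<psi> has_real_derivative radial_gap_deriv L L e - 2 * m) (at L)" unfolding \<psi>_def[abs_def] .
  from DERIV_neg_dec_right[OF this] \<open>\<not> ?thesis\<close>
  obtain d where d_pos: "d > 0" and \<psi>_less: "\<And>h. h > 0 \<Longrightarrow> h < d \<Longrightarrow> \<psi> (L + h) < \<psi> L" by auto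
  have "\<psi> L = 0" using L_pos by (simp add: \<psi>_def power2_eq_square)
  moreover have "\<psi> (L + d / 2) \<ge> 0"
    using gap[of "(L + d / 2) *\<^sub>R e"] kelvin_ray[of "L + d / 2" e L] norm_e d_pos L_pos by (simp add: \<psi>_def)
  ultimately show False using \<psi>_less[of "d / 2"] d_pos by simp
qed

lemma radial_gap_deriv_uniform:
  assumes L_pos: "L > 0" and m_pos: "m > 0"
  obtains d where "d > 0"
    "\<And>l t e. L \<le> l \<Longrightarrow> l \<le> L + d \<Longrightarrow> L \<le> t \<Longrightarrow> t \<le> L + d \<Longrightarrow> norm e = 1 \<Longrightarrow>
      \<bar>radial_gap_deriv l t e - radial_gap_deriv L L e\<bar> < m"
proof -
  let ?K = "{L..L+1} \<times> {L..L+1} \<times> sphere (0::real^'n::_) 1"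
  let ?F = "\<lambda>p. radial_gap_deriv (fst p) (fst (snd p)) (snd (snd p))"
  have nonzero: "fst (snd p) \<noteq> 0" "fst p \<noteq> 0" if "p \<in> ?K" for p using that L_pos by auto
  have "continuous_on ?K ?F"
    unfolding radial_gap_deriv_def
    by (intro continuous_intros continuous_on_compose2[OF continuous_on_u]
        continuous_on_compose2[OF continuous_on_grad] ballI nonzero) (auto simp: nonzero)
  moreover have "compact ?K" by (intro compact_Times) auto
  ultimately have "uniformly_continuous_on ?K ?F" by (rule compact_uniformly_continuous)
  then obtain d where d_pos: "d > 0"
    and uniform: "\<And>p p'. p \<in> ?K \<Longrightarrow> p' \<in> ?K \<Longrightarrow> dist p' p < d \<Longrightarrow> dist (?F p') (?F p) < m"
    using m_pos unfolding uniformly_continuous_on_def by meson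
  show ?thesis
  proof (rule that[of "min 1 (d / 4)"])
    fix l t and e :: "real^'n::_"
    assume near: "L \<le> l" "l \<le> L + min 1 (d / 4)" "L \<le> t" "t \<le> L + min 1 (d / 4)" "norm e = 1"
    have in_K: "l \<le> L + 1" "t \<le> L + 1" using near by linarith+
    have "dist (l, t, e) (L, L, e) \<le> \<bar>l - L\<bar> + \<bar>t - L\<bar>"
      unfolding dist_Pair_Pair
      using sqrt_sum_squares_le_sum_abs[of "l - L" "t - L"] by (simp add: dist_real_def)
    also have "\<dots> < d" using near d_pos by simp
    finally show "\<bar>radial_gap_deriv l t e - radial_gap_deriv L L e\<bar> < m"
      using uniform[of "(L, L, e)" "(l, t, e)"] near in_K by (simp add: dist_real_def)
  qed (use d_pos in auto)
qed

lemma dominates_near: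
  assumes L_pos: "L > 0" and m_pos: "m > 0"
    and gap: "\<And>x. norm x \<ge> L \<Longrightarrow> m * (norm x - L\<^sup>2 / norm x) \<le> kelvin L x - u x"
  shows "\<exists>d>0. \<forall>l\<in>{L..L+d}. \<forall>x. norm x \<in> {l..L+d} \<longrightarrow> u x \<le> kelvin l x"
proof -
  obtain d where d_pos: "d > 0"
    and uniform: "\<And>l t e. L \<le> l \<Longrightarrow> l \<le> L + d \<Longrightarrow> L \<le> t \<Longrightarrow> t \<le> L + d \<Longrightarrow> norm e = 1 \<Longrightarrow>
      \<bar>radial_gap_deriv l t e - radial_gap_deriv L L e\<bar> < m"
    using radial_gap_deriv_uniform[OF L_pos m_pos] by blast
  have "u x \<le> kelvin l x"
    if l_bounds: "L \<le> l" "l \<le> L + d" and x_bounds: "l \<le> norm x" "norm x \<le> L + d" for l and x :: "real^'n::_"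
  proof -
    define r e where "r = norm x" and "e = (1 / r) *\<^sub>R x"
    have r_bounds: "r > 0" "l \<le> r" "r \<le> L + d" using x_bounds l_bounds L_pos by (auto simp: r_def)
    have norm_e: "norm e = 1" and x_eq: "x = r *\<^sub>R e" using r_bounds(1) by (auto simp: e_def r_def)
    let ?\<phi> = "\<lambda>t. t / l * u ((l\<^sup>2 / t) *\<^sub>R e) - u (t *\<^sub>R e)"
    have "?\<phi> l \<le> ?\<phi> r"
    proof (rule DERIV_nonneg_imp_nondecreasing[OF r_bounds(2)])
      fix t assume t_bounds: "l \<le> t" "t \<le> r"
      have "\<bar>radial_gap_deriv l t e - radial_gap_deriv L L e\<bar> < m"
        using t_bounds l_bounds r_bounds norm_e by (intro uniform) auto
      moreover have "2 * m \<le> radial_gap_deriv L L e"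
        by (rule radial_gap_deriv_lower_bound[OF L_pos norm_e gap])
      ultimately have "radial_gap_deriv l t e \<ge> 0" using m_pos by linarith
      then show "\<exists>y. (?\<phi> has_real_derivative y) (at t) \<and> 0 \<le> y"
        using has_real_derivative_radial_gap[of l t e] t_bounds l_bounds L_pos by auto
    qed
    moreover have "?\<phi> l = 0" using l_bounds L_pos by (simp add: power2_eq_square)
    ultimately show ?thesis using kelvin_ray[OF r_bounds(1) norm_e, of l] x_eq by simp
  qed
  with d_pos show ?thesis by (intro exI[of _ d]) auto
qed

lemma dominates_far:
  assumes L_pos: "L > 0" and m_pos: "m > 0" and d_pos: "d > 0"
    and gap: "\<And>x. norm x \<ge> L \<Longrightarrow> m * (norm x - L\<^sup>2 / norm x) \<le> kelvin L x - u x"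
  shows "\<exists>\<epsilon>>0. \<forall>l\<in>{L..L+\<epsilon>}. \<forall>x. norm x \<ge> max l (L + d) \<longrightarrow> u x \<le> kelvin l x"
proof -
  define C where "C = (slope * (2 * L + 1) + (u 0 + slope * (L + 1))) / L\<^sup>2"
  have C_pos: "C > 0" using L_pos slope_pos pos[of 0] by (simp add: C_def add_pos_pos)
  define \<eta> where "\<eta> = 1 - L\<^sup>2 / (L + d)\<^sup>2"
  define \<epsilon> where "\<epsilon> = min 1 (m * \<eta> / C)"
  have "\<eta> > 0" using L_pos d_pos power_strict_mono[of L "L + d" 2] by (simp add: \<eta>_def)
  then have "\<epsilon> > 0" using m_pos C_pos by (simp add: \<epsilon>_def)
  moreover have "u x \<le> kelvin l x"
    if l_bounds: "L \<le> l" "l \<le> L + \<epsilon>" and x_bounds: "L + d \<le> norm x" "l \<le> norm x" for l and x :: "real^'n::_"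
  proof -
    have x_pos: "norm x > 0" and x_ge: "L \<le> norm x" using x_bounds L_pos d_pos by linarith+
    have "L\<^sup>2 / (norm x)\<^sup>2 \<le> L\<^sup>2 / (L + d)\<^sup>2"
      using x_bounds(1) L_pos d_pos x_pos by (intro divide_left_mono power_mono mult_pos_pos) auto
    then have "norm x * (m * \<eta>) \<le> norm x * (m * (1 - L\<^sup>2 / (norm x)\<^sup>2))"
      using m_pos by (intro mult_left_mono) (auto simp: \<eta>_def)
    also have "\<dots> = m * (norm x - L\<^sup>2 / norm x)" using x_pos by (simp add: field_simps power2_eq_square)
    also have "\<dots> \<le> kelvin L x - u x" by (rule gap[OF x_ge])
    finally have far_gap: "norm x * (m * \<eta>) \<le> kelvin L x - u x" .
    have "(slope * (l + L) + (u 0 + slope * l)) / L\<^sup>2 \<le> C"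
    proof -
      have "l \<le> L + 1" using l_bounds(2) by (simp add: \<epsilon>_def)
      then have "slope * l \<le> slope * (L + 1)" "slope * (l + L) \<le> slope * (2 * L + 1)"
        using slope_pos by (auto intro!: mult_left_mono)
      then show ?thesis unfolding C_def by (intro divide_right_mono) auto
    qed
    then have "kelvin L x - kelvin l x \<le> norm x * (C * (l - L))"
      using kelvin_radius_diff_le[OF L_pos l_bounds(1) x_bounds(2)] l_bounds(1)
      by (elim order_trans) (intro mult_left_mono mult_right_mono; simp)
    also have "\<dots> \<le> norm x * (m * \<eta>)"
    proof (rule mult_left_mono)
      have "l - L \<le> m * \<eta> / C" using l_bounds(2) by (simp add: \<epsilon>_def)
      then show "C * (l - L) \<le> m * \<eta>" using C_pos by (simp add: pos_le_divide_eq mult.commute)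
    qed simp
    finally show ?thesis using far_gap by linarith
  qed
  ultimately show ?thesis by (intro exI[of _ \<epsilon>]) auto
qed

lemma dominates_extend:
  assumes L_pos: "L > 0"
    and dom: "dominates L" and z0_exterior: "z0 \<in> exterior L" and z0_gap: "kelvin L z0 \<noteq> u z0"
  shows "\<exists>\<epsilon>>0. \<forall>l\<in>{L..L+\<epsilon>}. dominates l"
proof -
  obtain m where m_pos: "m > 0" and gap: "\<And>x. norm x \<ge> L \<Longrightarrow> m * (norm x - L\<^sup>2 / norm x) \<le> kelvin L x - u x"
    using kelvin_gap[OF L_pos dom z0_exterior z0_gap] by blast
  obtain d where d_pos: "d > 0" and near: "\<forall>l\<in>{L..L+d}. \<forall>x. norm x \<in> {l..L+d} \<longrightarrow> u x \<le> kelvin l x"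
    using dominates_near[OF L_pos m_pos gap] by blast
  obtain \<epsilon> where \<epsilon>_pos: "\<epsilon> > 0" and far: "\<forall>l\<in>{L..L+\<epsilon>}. \<forall>x. norm x \<ge> max l (L + d) \<longrightarrow> u x \<le> kelvin l x"
    using dominates_far[OF L_pos m_pos d_pos gap] by blast
  have "dominates l" if "l \<in> {L..L + min d \<epsilon>}" for l
    unfolding dominates_def
  proof (intro allI impI)
    fix x :: "real^'n::_" assume "norm x \<ge> l"
    then show "u x \<le> kelvin l x"
      using near far that by (cases "norm x \<le> L + d") auto
  qed
  with d_pos \<epsilon>_pos show ?thesis by (intro exI[of _ "min d \<epsilon>"]) auto
qed

lemma dominates_closed:
  assumes L_pos: "L > 0" and dom: "\<And>l. 0 < l \<Longrightarrow> l < L \<Longrightarrow> dominates l"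
  shows "dominates L"
  unfolding dominates_def
proof (intro allI impI)
  fix x :: "real^'n::_" assume x_ge: "norm x \<ge> L"
  have "((\<lambda>l. kelvin l x) \<longlongrightarrow> kelvin L x) (at_left L)"
    unfolding kelvin_def inversion_def using L_pos x_ge continuous_on_u
    by (intro tendsto_intros isCont_tendsto_compose[of _ u]) (auto simp: continuous_on_eq_continuous_at)
  moreover have "\<forall>\<^sub>F l in at_left L. u x \<le> kelvin l x"
    using eventually_at_left_real[OF L_pos]
  proof eventually_elim
    case (elim l)
    then show ?case using dom[of l] x_ge by (auto simp: dominates_def)
  qed
  ultimately show "u x \<le> kelvin L x" by (intro tendsto_lowerbound[of _ _ "at_left L"]) auto
qed

text \<open>The largest radius up to which all Kelvin transforms dominate \<open>u\<close> is critical: there the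
  Kelvin transform cannot differ from \<open>u\<close>, since otherwise a larger radius would be admissible.\<close>

lemma critical_radius:
  obtains L where "L > 0" "\<And>x. norm x \<ge> L \<Longrightarrow> kelvin L x = u x"
proof -
  define A where "A = {b. b > 0 \<and> (\<forall>l. 0 < l \<longrightarrow> l \<le> b \<longrightarrow> dominates l)}"
  have "u 0 / (3 * slope) \<in> A" using dominates_small pos[of 0] slope_pos by (auto simp: A_def)
  then have nonempty: "A \<noteq> {}" by auto
  have bdd: "bdd_above A"
  proof (rule bdd_aboveI)
    show "b \<le> u 0 / slope" if "b \<in> A" for b
      using slope_le_if_dominates[of b] that slope_pos by (auto simp: A_def field_simps)
  qed
  define L where "L = Sup A"
  have L_pos: "L > 0"
    using cSup_upper[OF \<open>u 0 / (3 * slope) \<in> A\<close> bdd] pos[of 0] slope_pos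
    by (simp add: L_def) (meson divide_pos_pos less_le_trans mult_pos_pos zero_less_numeral)
  have below: "dominates l" if "0 < l" "l < L" for l
    using that less_cSup_iff[OF nonempty bdd, of l] by (auto simp: L_def A_def)
  have dom: "dominates L" by (rule dominates_closed[OF L_pos below])
  have "kelvin L z = u z" if z_ge: "norm z \<ge> L" for z
  proof (rule ccontr)
    assume neq: "kelvin L z \<noteq> u z"
    then have "z \<in> exterior L" using kelvin_on_sphere[OF L_pos, of z] z_ge by force
    from dominates_extend[OF L_pos dom this neq]
    obtain \<epsilon> where \<epsilon>_pos: "\<epsilon> > 0" and larger: "\<forall>l\<in>{L..L+\<epsilon>}. dominates l" by blast
    have "dominates l" if "0 < l" "l \<le> L + \<epsilon>" for l
    proof (cases "l < L")
      case False
      then show ?thesis using larger that(2) by simp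
    qed (rule below[OF that(1)])
    then have "L + \<epsilon> \<in> A" using L_pos \<epsilon>_pos by (simp add: A_def)
    then have "L + \<epsilon> \<le> L" unfolding L_def using bdd by (rule cSup_upper)
    then show False using \<epsilon>_pos by simp
  qed
  with L_pos show ?thesis by (rule that)
qed

lemma kelvin_invariant:
  assumes x_nonzero: "x \<noteq> 0"
  shows "kelvin (u 0 / slope) x = u x"
proof -
  obtain L where L_pos: "L > 0" and outside: "\<And>x. norm x \<ge> L \<Longrightarrow> kelvin L x = u x"
    using critical_radius by blast
  have "kelvin L x = u x"
  proof (cases "norm x \<ge> L")
    case False
    then have "norm (inversion L x) \<ge> L"
      using L_pos x_nonzero by (simp add: norm_inversion field_simps power2_eq_square)
    from outside[OF this] have "u (inversion L x) = L / norm x * u x"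
      using L_pos by (simp add: kelvin_def inversion_inversion norm_inversion power2_eq_square)
    then show ?thesis using L_pos x_nonzero by (simp add: kelvin_def)
  qed (rule outside)
  moreover have "L = u 0 / slope"
    using slope_eq_if_kelvin_eq[OF L_pos outside] L_pos slope_pos by (simp add: field_simps)
  ultimately show ?thesis by simp
qed

end

subsection \<open>Classification\<close>

lemma (in integral_equation) tendsto_translated_ray_diff:
  assumes norm_e: "norm e = 1"
  shows "((\<lambda>t. u (a + t *\<^sub>R e) - u (t *\<^sub>R e)) \<longlongrightarrow> slope * (e \<bullet> a)) at_top"
proof -
  have "((\<lambda>t. LBINT y. source y * (norm (a + t *\<^sub>R e - y) - norm (t *\<^sub>R e - y)))
      \<longlongrightarrow> (LBINT y. source y * (e \<bullet> a))) at_top"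
  proof (rule integral_dominated_convergence_at_top[where w="\<lambda>y. source y * norm a"])
    have "((\<lambda>t. (norm (t *\<^sub>R e - (y - a)) - t) - (norm (t *\<^sub>R e - y) - t))
        \<longlongrightarrow> - (e \<bullet> (y - a)) - - (e \<bullet> y)) at_top" for y
      by (intro tendsto_diff tendsto_norm_unit_ray_diff norm_e)
    then have "((\<lambda>t. norm (a + t *\<^sub>R e - y) - norm (t *\<^sub>R e - y)) \<longlongrightarrow> e \<bullet> a) at_top" for y
      by (simp add: inner_diff_right algebra_simps)
    then show "AE y in lborel. ((\<lambda>t. source y * (norm (a + t *\<^sub>R e - y) - norm (t *\<^sub>R e - y)))
        \<longlongrightarrow> source y * (e \<bullet> a)) at_top"
      by (intro AE_I2 tendsto_mult tendsto_const)
    have "norm (source y * (norm (a + t *\<^sub>R e - y) - norm (t *\<^sub>R e - y))) \<le> source y * norm a" for t y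
      using norm_triangle_ineq3[of "a + t *\<^sub>R e - y" "t *\<^sub>R e - y"] source_pos[of y]
      by (simp add: abs_mult mult_left_mono)
    then show "\<forall>\<^sub>F t in at_top. AE y in lborel.
        norm (source y * (norm (a + t *\<^sub>R e - y) - norm (t *\<^sub>R e - y))) \<le> source y * norm a" by simp
  qed (use integrable_source in auto)
  from tendsto_mult[OF tendsto_const[of c] this] show ?thesis
    unfolding u_diff_eq slope_def by (simp add: mult_ac)
qed

context conformal_equation
begin

lemma conformal_equation_translate: "conformal_equation (\<lambda>x. u (a + x)) (\<lambda>x. grad (a + x)) c"
proof -
  have translate: "((\<lambda>x. a + x) has_derivative (\<lambda>v. v)) (at x)" for x :: "real^'n::_"
    by (auto intro!: derivative_eq_intros)
  interpret T: linear_growth "\<lambda>x. u (a + x)" "\<lambda>x. grad (a + x)" "2 * real CARD('n) + 1"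
  proof
    obtain \<kappa> where \<kappa>_pos: "\<kappa> > 0" and u_ge: "\<And>x. \<kappa> * (1 + norm x) \<le> u x" using lower by blast
    have "\<kappa> / (1 + norm a) * (1 + norm x) \<le> u (a + x)" for x
    proof -
      have "norm x \<le> norm a + norm (a + x)" using norm_triangle_ineq4[of "a + x" a] by simp
      moreover have "(1 + norm a) * (1 + norm (a + x)) = 1 + norm a + norm (a + x) + norm a * norm (a + x)"
        by (simp add: algebra_simps)
      moreover have "norm a * norm (a + x) \<ge> 0" by simp
      ultimately have "1 + norm x \<le> (1 + norm a) * (1 + norm (a + x))" by linarith
      then have "\<kappa> * (1 + norm x) \<le> \<kappa> * ((1 + norm a) * (1 + norm (a + x)))"
        using \<kappa>_pos by (intro mult_left_mono) auto
      also have "\<dots> = (1 + norm a) * (\<kappa> * (1 + norm (a + x)))" by simp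
      also have "\<dots> \<le> (1 + norm a) * u (a + x)" using u_ge by (intro mult_left_mono) auto
      finally have "\<kappa> * (1 + norm x) \<le> (1 + norm a) * u (a + x)" .
      then show ?thesis by (simp add: pos_divide_le_eq add_pos_nonneg mult.commute)
    qed
    then show "\<exists>\<kappa>>0. \<forall>x. \<kappa> * (1 + norm x) \<le> u (a + x)"
      using \<kappa>_pos by (intro exI[of _ "\<kappa> / (1 + norm a)"]) (simp add: add_pos_nonneg)
    show "((\<lambda>x. u (a + x)) has_derivative (\<lambda>v. grad (a + x) \<bullet> v)) (at x)" for x
      by (rule has_derivative_compose[OF translate has_derivative])
    show "continuous_on UNIV (\<lambda>x. grad (a + x))"
      by (rule continuous_on_compose2[OF continuous_on_grad]) (auto intro!: continuous_intros)
  qed (use q_gt in simp)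
  show ?thesis
  proof (unfold_locales, rule c_pos)
    show "u (a + x) = c * (LBINT y. norm (x - y) * T.source y) + 0" for x
      using u_eq[of "a + x"] integral_lborel_translate[of "\<lambda>y. norm (a + x - y) * source y" a]
      by (simp add: source_def T.source_def)
  qed
qed

lemma tendsto_ray_offset:
  assumes norm_e: "norm e = 1"
  shows "((\<lambda>t. u (t *\<^sub>R e) - slope * t) \<longlongrightarrow> u 0 / slope * (grad 0 \<bullet> e)) at_top"
proof -
  define l where "l = u 0 / slope"
  have l_pos: "l > 0" and l_slope: "l * slope = u 0" using pos[of 0] slope_pos by (simp_all add: l_def)
  have "((\<lambda>s. (u (s *\<^sub>R (l\<^sup>2 *\<^sub>R e)) - u 0) / s) \<longlongrightarrow> l\<^sup>2 * (grad 0 \<bullet> e)) (at 0)"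
    using has_real_derivative_along_line[of 0 "l\<^sup>2 *\<^sub>R e"] by (simp add: has_field_derivative_iff)
  from tendsto_mult[OF tendsto_const[of "1 / l"] filterlim_compose[OF this filterlim_inverse_at_0]]
  have "((\<lambda>t. 1 / l * ((u (inverse t *\<^sub>R (l\<^sup>2 *\<^sub>R e)) - u 0) / inverse t))
      \<longlongrightarrow> 1 / l * (l\<^sup>2 * (grad 0 \<bullet> e))) at_top" .
  moreover have "\<forall>\<^sub>F t in at_top. 1 / l * ((u (inverse t *\<^sub>R (l\<^sup>2 *\<^sub>R e)) - u 0) / inverse t)
      = u (t *\<^sub>R e) - slope * t"
    using eventually_gt_at_top[of 0]
  proof eventually_elim
    case (elim t)
    have "t *\<^sub>R e \<noteq> 0" using elim norm_e by auto
    then have "u (t *\<^sub>R e) = t / l * u ((l\<^sup>2 / t) *\<^sub>R e)"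
      using kelvin_invariant[of "t *\<^sub>R e"] kelvin_ray[OF elim norm_e, of l] by (simp add: l_def)
    moreover have "slope * t = t / l * u 0" using l_pos l_slope by (simp add: field_simps)
    ultimately show ?case by (simp add: divide_inverse algebra_simps)
  qed
  ultimately have "((\<lambda>t. u (t *\<^sub>R e) - slope * t) \<longlongrightarrow> 1 / l * (l\<^sup>2 * (grad 0 \<bullet> e))) at_top"
    by (rule Lim_transform_eventually)
  also have "1 / l * (l\<^sup>2 * (grad 0 \<bullet> e)) = l * (grad 0 \<bullet> e)" using l_pos by (simp add: power2_eq_square)
  finally show ?thesis by (simp add: l_def)
qed

lemma tendsto_ray_offset_at:
  assumes norm_e: "norm e = 1"
  shows "((\<lambda>t. u (a + t *\<^sub>R e) - slope * t) \<longlongrightarrow> u a / slope * (grad a \<bullet> e)) at_top"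
proof -
  interpret T: conformal_equation "\<lambda>x. u (a + x)" "\<lambda>x. grad (a + x)" c
    by (rule conformal_equation_translate)
  have "T.slope = slope"
    using integral_lborel_translate[of source a] by (simp add: T.slope_def slope_def T.source_def source_def)
  then show ?thesis using T.tendsto_ray_offset[OF norm_e] by simp
qed

lemma u_grad_eq: "u x *\<^sub>R grad x = slope\<^sup>2 *\<^sub>R x + u 0 *\<^sub>R grad 0"
proof (rule euclidean_eqI)
  fix e :: "real^'n::_" assume "e \<in> Basis"
  then have norm_e: "norm e = 1" by (rule norm_Basis)
  have "((\<lambda>t. (u (x + t *\<^sub>R e) - slope * t) - (u (t *\<^sub>R e) - slope * t))
      \<longlongrightarrow> u x / slope * (grad x \<bullet> e) - u 0 / slope * (grad 0 \<bullet> e)) at_top"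
    by (intro tendsto_diff tendsto_ray_offset_at tendsto_ray_offset norm_e)
  then have "((\<lambda>t. u (x + t *\<^sub>R e) - u (t *\<^sub>R e))
      \<longlongrightarrow> u x / slope * (grad x \<bullet> e) - u 0 / slope * (grad 0 \<bullet> e)) at_top"
    by simp
  then have "u x / slope * (grad x \<bullet> e) - u 0 / slope * (grad 0 \<bullet> e) = slope * (e \<bullet> x)"
    using tendsto_translated_ray_diff[OF norm_e, of x]
    by (rule tendsto_unique[OF trivial_limit_at_top_linorder])
  then show "(u x *\<^sub>R grad x) \<bullet> e = (slope\<^sup>2 *\<^sub>R x + u 0 *\<^sub>R grad 0) \<bullet> e"
    using slope_pos by (simp add: inner_add_left inner_commute[of e] field_simps power2_eq_square)
qed

lemma u_square_eq: "(u x)\<^sup>2 = slope\<^sup>2 * (norm x)\<^sup>2 + 2 * u 0 * (grad 0 \<bullet> x) + (u 0)\<^sup>2"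
proof -
  define F where "F x = u x * u x - slope\<^sup>2 * (x \<bullet> x) - 2 * u 0 * (grad 0 \<bullet> x)" for x
  have "(F has_derivative (\<lambda>h. 0)) (at x within UNIV)" for x
  proof -
    let ?F' = "\<lambda>h. (u x * (grad x \<bullet> h) + (grad x \<bullet> h) * u x) - slope\<^sup>2 * (x \<bullet> h + h \<bullet> x)
      - 2 * u 0 * (grad 0 \<bullet> h)"
    have "(F has_derivative ?F') (at x)"
      unfolding F_def[abs_def] by (auto intro!: derivative_eq_intros has_derivative)
    moreover have "?F' h = 0" for h
    proof -
      have "(u x *\<^sub>R grad x) \<bullet> h = (slope\<^sup>2 *\<^sub>R x + u 0 *\<^sub>R grad 0) \<bullet> h" by (simp only: u_grad_eq[of x])
      then show ?thesis by (simp add: inner_add_left inner_commute algebra_simps)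
    qed
    ultimately show ?thesis by simp
  qed
  then have "\<exists>k. \<forall>x\<in>UNIV. F x = k" by (intro has_derivative_zero_constant) auto
  then have "F x = F 0" by auto
  then show ?thesis by (simp add: F_def power2_eq_square[of "u _"] power2_norm_eq_inner)
qed

theorem classification:
  "\<exists>C s x0. C > 0 \<and> s > 0 \<and> (\<forall>x. u x = C * sqrt (1 + (s * norm (x - x0))\<^sup>2))"
proof -
  define x0 where "x0 = - (u 0 / slope\<^sup>2) *\<^sub>R grad 0"
  define k where "k = (u 0)\<^sup>2 - slope\<^sup>2 * (norm x0)\<^sup>2"
  have square: "(u x)\<^sup>2 = slope\<^sup>2 * (norm (x - x0))\<^sup>2 + k" for x
  proof -
    have "slope\<^sup>2 * (x \<bullet> x0) = - (u 0 * (grad 0 \<bullet> x))"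
      using slope_pos by (simp add: x0_def inner_commute)
    then show ?thesis unfolding u_square_eq[of x] k_def norm_diff_square by (simp add: algebra_simps)
  qed
  have "k = (u x0)\<^sup>2" using square[of x0] by simp
  then have k_pos: "k > 0" using pos[of x0] by simp
  have "u x = sqrt k * sqrt (1 + (slope / sqrt k * norm (x - x0))\<^sup>2)" for x
  proof -
    have "k * (1 + (slope / sqrt k * norm (x - x0))\<^sup>2) = (u x)\<^sup>2"
      unfolding square[of x] using k_pos by (simp add: power_mult_distrib power_divide algebra_simps)
    then have "sqrt (k * (1 + (slope / sqrt k * norm (x - x0))\<^sup>2)) = u x"
      using less_imp_le[OF pos[of x]] by simp
    then show ?thesis by (simp add: real_sqrt_mult)
  qed
  moreover have "sqrt k > 0" "slope / sqrt k > 0" using k_pos slope_pos by auto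
  ultimately show ?thesis by blast
qed

end

theorem mainTheorem11:
  fixes u :: "real^5 \<Rightarrow> real" and q \<alpha> :: real
  assumes "q > 6"
    and "Ck 6 u"
    and "\<forall>x. u x > 0"
    and "\<forall>x. (laplacian ^^ 3) u x = u x powr (-q)"
    and "\<alpha> \<ge> 0"
    and "((\<lambda>x. u x / norm x) \<longlongrightarrow> \<alpha>) at_infinity"
  shows "\<exists>\<gamma>::real.
      (\<forall>x. (\<lambda>y. norm (x - y) * u y powr (-q)) integrable_on UNIV
         \<and> u x = 1 / (64 * pi\<^sup>2) * integral UNIV (\<lambda>y. norm (x - y) * u y powr (-q)) + \<gamma>)
      \<and> (q < 11 \<longrightarrow> \<gamma> < 0) \<and> (q = 11 \<longrightarrow> \<gamma> = 0) \<and> (q > 11 \<longrightarrow> \<gamma> > 0)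
      \<and> (q = 11 \<longrightarrow> (\<exists>c s :: real. \<exists>x0 :: real^5. c > 0 \<and> s > 0 \<and>
      (\<forall>x. u x = c * sqrt (1 + (s * norm (x - x0))\<^sup>2))))"
proof -
  obtain \<gamma> where equation: "integral_equation u (gradient u) q (1 / (64 * pi\<^sup>2)) \<gamma>"
    using triharmonic_integral_equation assms by blast
  interpret integral_equation u "gradient u" q "1 / (64 * pi\<^sup>2)" \<gamma> by (rule equation)
  have "(\<lambda>y. norm (x - y) * u y powr (-q)) integrable_on UNIV
      \<and> u x = 1 / (64 * pi\<^sup>2) * integral UNIV (\<lambda>y. norm (x - y) * u y powr (-q)) + \<gamma>" for x
    using integrable_on_lborel[OF integrable_potential] integral_lborel[OF integrable_potential, of x] u_eq[of x]
    by (simp add: source_def)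
  moreover have sign: "(q < 11 \<longrightarrow> \<gamma> < 0) \<and> (q = 11 \<longrightarrow> \<gamma> = 0) \<and> (q > 11 \<longrightarrow> \<gamma> > 0)"
    using sgn_\<gamma> by (auto simp: sgn_if split: if_splits)
  moreover have "\<exists>c s :: real. \<exists>x0 :: real^5. c > 0 \<and> s > 0 \<and> (\<forall>x. u x = c * sqrt (1 + (s * norm (x - x0))\<^sup>2))"
    if "q = 11"
  proof (rule conformal_equation.classification)
    show "conformal_equation u (gradient u) (1 / (64 * pi\<^sup>2))"
      using equation that sign by (simp add: conformal_equation_def)
  qed
  ultimately show ?thesis by blast
qed

end
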